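(* Let $\Gamma$ be a countable discrete group acting on a set $X$ by $\pi$, let $I\colon X\to X$ be a bijection with $I^2=\mathrm{id}_X$ and $I\pi_g=\pi_gI$ for all $g\in\Gamma$, and let $\mathsf X_{\rm full}$, $\mathcal G_{\rm full}$, $\ell^\infty(\partial\mathcal G_{\rm full})$ and $C(\partial\mathcal G_{\rm full})$ be as defined in the context. Assume that $\Gamma$ is exact and that the action $\Gamma\curvearrowright^\pi X$ has finite stabilizers and finitely many orbits. Then the left translation action $\Gamma\curvearrowright C(\partial\mathcal G_{\rm full})$ is amenable. In particular $\Gamma\curvearrowright^\pi \mathsf X_{\rm full}$ is bi-exact relative to $\mathcal G_{\rm full}$, i.e. the left-right translation action $\Gamma\times\Gamma\curvearrowright\ell^\infty(\partial\mathcal G_{\rm full})$ is amenable.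
   Context: Semigroups. $\mathsf X_{\rm full}=\{\star\}\sqcup\bigsqcup_{n\ge1}X^n$ is the free monoid on $X$ (words in $X$ with concatenation, unit $\star$). $\mathsf X_{\rm sym}=\{\star\}\sqcup\bigsqcup_{n\ge1}X^n/\mathfrak S_n$ is the free commutative monoid on $X$ (finite multisets), with quotient map $x\mapsto[x]$. $\Gamma$ acts on both letterwise by $\pi$. For $S\in\{\mathsf X_{\rm full},\mathsf X_{\rm sym}\}$, the semidirect product $S\rtimes\Gamma$ is $S\times\Gamma$ with $(s,g)(t,h)=(s\,\pi_g(t),gh)$; $S$ and $\Gamma$ are regarded as subsets via $s\mapsto(s,e)$, $g\mapsto(\star,g)$. Families of subsets. $\mathcal G_{\rm sym}$ is the family of all finite unions of sets $s\Gamma t\subset \mathsf X_{\rm sym}\rtimes\Gamma$ with $s,t\in\mathsf X_{\rm sym}$. With $Q\colon\mathsf X_{\rm full}\rtimes\Gamma\to\mathsf X_{\rm sym}\rtimes\Gamma$, $Q(x,g)=([x],g)$, put $\mathcal G_{\rm full}=\{Q^{-1}(E)\mid E\in\mathcal G_{\rm sym}\}$. For a family $\mathcal G$ of subsets of a set $Z$ closed under finite unions, a subset is small relative to $\mathcal G$ if it is contained in a member of $\mathcal G$, and $c_0(\mathcal G)$ is the closed ideal of all $f\in\ell^\infty(Z)$ such that $\{z:|f(z)|>\varepsilon\}$ is small relative to $\mathcal G$ for every $\varepsilon>0$. Boundary algebras. $\ell^\infty(\overline{\mathcal G_{\rm full}})$ is the set of $f\in\ell^\infty(\mathsf X_{\rm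 full}\rtimes\Gamma)$ such that $f-f(s\,\cdot\,)$ and $f-f(\,\cdot\,s)$ lie in $c_0(\mathcal G_{\rm full})$ for all $s\in\mathsf X_{\rm full}$; $C(\overline{\mathcal G_{\rm full}})$ is the set of $f\in\ell^\infty(\overline{\mathcal G_{\rm full}})$ with $f-f(\,\cdot\,h)\in c_0(\mathcal G_{\rm full})$ for all $h\in\Gamma$. Then $\ell^\infty(\partial\mathcal G_{\rm full})=\ell^\infty(\overline{\mathcal G_{\rm full}})/c_0(\mathcal G_{\rm full})$ and $C(\partial\mathcal G_{\rm full})=C(\overline{\mathcal G_{\rm full}})/c_0(\mathcal G_{\rm full})$. The left-right translation action of $\Gamma\times\Gamma$ is induced by $f\mapsto f(g^{-1}\,\cdot\,h)$; the left translation action of $\Gamma$ by $f\mapsto f(g^{-1}\,\cdot\,)$. Amenability. An action of a discrete group $G$ on a unital commutative C$^*$-algebra $C(Y)$ ($Y$ compact Hausdorff) is (topologically) amenable if there is a net of continuous maps $m_i\colon Y\to\mathrm{Prob}(G)$ with $\sup_{y\in Y}\|g\cdot m_i(y)-m_i(g\cdot y)\|_1\to0$ for every $g\in G$ (for exact $G$ this is equivalent to coincidence of the full and reduced crossed products $C(Y)\rtimes G$). *)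

theory Defs
  imports
    "HOL-Algebra.Group_Action"
    "HOL-Algebra.QuotRing"
    "HOL-Algebra.Module"
    "HOL-Library.Multiset"
    "HOL-Analysis.Analysis"
    "HOL-Probability.Probability_Mass_Function"
begin

section \<open>Amenable actions\<close>

text \<open>
  Elements of \<open>Prob(G)\<close> are probability mass functions supported in the carrier of \<open>G\<close>,
  with the topology of the norm of \<open>\<ell>\<^sup>1(G)\<close>.
\<close>

definition Prob :: "('g, 'm) monoid_scheme \<Rightarrow> 'g pmf set" where
  "Prob G = {p. set_pmf p \<subseteq> carrier G}"

definition l1_dist :: "'g pmf \<Rightarrow> 'g pmf \<Rightarrow> real" where
  "l1_dist p q = (\<Sum>\<^sub>\<infinity>h\<in>UNIV. \<bar>pmf p h - pmf q h\<bar>)"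

lemma l1_dist_summable: "(\<lambda>h. \<bar>pmf p h - pmf q h\<bar>) summable_on UNIV"
proof -
  have *: "(\<lambda>h. pmf r h) summable_on UNIV" for r :: "'a pmf"
    using abs_summable_equivalent[of "pmf r" UNIV] pmf_abs_summable[of r UNIV]
      abs_summable_summable by blast
  show ?thesis
    by (rule summable_on_comparison_test[where f = "\<lambda>h. pmf p h + pmf q h"])
       (auto intro!: summable_on_add * simp: abs_le_iff pmf_nonneg add_increasing add_increasing2)
qed

lemma Metric_space_Prob: "Metric_space (Prob G) l1_dist"
proof
  fix p q r :: "'a pmf"
  show "0 \<le> l1_dist p q"
    by (simp add: l1_dist_def infsum_nonneg)
  show "l1_dist p q = l1_dist q p"
    by (simp add: l1_dist_def abs_minus_commute)
  show "l1_dist p q = 0 \<longleftrightarrow> p = q"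
  proof
    assume "l1_dist p q = 0"
    then have "\<bar>pmf p h - pmf q h\<bar> = 0" for h
      using nonneg_infsum_le_0D[of "\<lambda>h. \<bar>pmf p h - pmf q h\<bar>" UNIV h] l1_dist_summable[of p q]
      by (simp add: l1_dist_def)
    then show "p = q"
      by (intro pmf_eqI) simp
  qed (simp add: l1_dist_def)
  have "l1_dist p r \<le> (\<Sum>\<^sub>\<infinity>h\<in>UNIV. \<bar>pmf p h - pmf q h\<bar> + \<bar>pmf q h - pmf r h\<bar>)"
    unfolding l1_dist_def
    by (intro infsum_mono summable_on_add l1_dist_summable) simp
  also have "\<dots> = l1_dist p q + l1_dist q r"
    unfolding l1_dist_def by (intro infsum_add l1_dist_summable)
  finally show "l1_dist p r \<le> l1_dist p q + l1_dist q r" .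
qed

definition Prob_topology :: "('g, 'm) monoid_scheme \<Rightarrow> 'g pmf topology" where
  "Prob_topology G = Metric_space.mtopology (Prob G) l1_dist"

text \<open>
  Amenability of an action \<open>act\<close> of a discrete group \<open>G\<close> on a compact Hausdorff space \<open>Y\<close>.
  The net of continuous maps is given by a proper filter on the maps \<open>Y \<rightarrow> Prob(G)\<close>; the
  convergence to \<open>0\<close> of the supremum over \<open>Y\<close> is uniform convergence to \<open>0\<close> on \<open>Y\<close>.
\<close>

definition amenable_on_space ::
    "('g, 'm) monoid_scheme \<Rightarrow> 'y topology \<Rightarrow> ('g \<Rightarrow> 'y \<Rightarrow> 'y) \<Rightarrow> bool" where
  "amenable_on_space G Y act \<longleftrightarrow>
     (\<exists>F :: ('y \<Rightarrow> 'g pmf) filter. F \<noteq> bot \<and>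
        (\<forall>\<^sub>F m in F. continuous_map Y (Prob_topology G) m) \<and>
        (\<forall>g\<in>carrier G.
           uniform_limit (topspace Y)
             (\<lambda>m y. l1_dist (map_pmf (\<lambda>h. g \<otimes>\<^bsub>G\<^esub> h) (m y)) (m (act g y))) (\<lambda>y. 0) F))"

text \<open>
  A unital commutative C*-algebra enters through its underlying complex algebra, since its
  Gelfand spectrum (unital characters with the topology of pointwise convergence) depends on
  nothing else: characters of a C*-algebra are automatically contractive and *-preserving.
\<close>

definition characters :: "(complex, 'a, 'm) module_scheme \<Rightarrow> ('a \<Rightarrow> complex) set" where
  "characters A = {\<phi> \<in> extensional (carrier A).
     \<phi> \<one>\<^bsub>A\<^esub> = 1 \<and>
     (\<forall>a\<in>carrier A. \<forall>b\<in>carrier A. \<phi> (a \<oplus>\<^bsub>A\<^esub> b) = \<phi> a + \<phi> b \<and> \<phi> (a \<otimes>\<^bsub>A\<^esub> b) = \<phi> a * \<phi> b) \<and>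
     (\<forall>c. \<forall>a\<in>carrier A. \<phi> (c \<odot>\<^bsub>A\<^esub> a) = c * \<phi> a)}"

definition spectrum_topology :: "(complex, 'a, 'm) module_scheme \<Rightarrow> ('a \<Rightarrow> complex) topology" where
  "spectrum_topology A =
     subtopology (product_topology (\<lambda>_. euclidean) (carrier A)) (characters A)"

text \<open>The action on the spectrum dual to an action \<open>\<alpha>\<close> on the algebra: \<open>(g\<cdot>f)(y) = f(g\<^sup>-\<^sup>1\<cdot>y)\<close>.\<close>

definition dual_action ::
    "('g, 'n) monoid_scheme \<Rightarrow> (complex, 'a, 'm) module_scheme \<Rightarrow> ('g \<Rightarrow> 'a \<Rightarrow> 'a)
      \<Rightarrow> 'g \<Rightarrow> ('a \<Rightarrow> complex) \<Rightarrow> ('a \<Rightarrow> complex)" where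
  "dual_action G A \<alpha> g \<phi> = (\<lambda>a\<in>carrier A. \<phi> (\<alpha> (inv\<^bsub>G\<^esub> g) a))"

definition amenable_action ::
    "('g, 'n) monoid_scheme \<Rightarrow> (complex, 'a, 'm) module_scheme \<Rightarrow> ('g \<Rightarrow> 'a \<Rightarrow> 'a) \<Rightarrow> bool" where
  "amenable_action G A \<alpha> \<longleftrightarrow> amenable_on_space G (spectrum_topology A) (dual_action G A \<alpha>)"


section \<open>Algebras of bounded functions\<close>

definition linfty :: "'z set \<Rightarrow> ('z \<Rightarrow> complex) set" where
  "linfty Z = {f \<in> extensional Z. bounded (f ` Z)}"

definition function_algebra ::
    "'z set \<Rightarrow> ('z \<Rightarrow> complex) set \<Rightarrow> (complex, 'z \<Rightarrow> complex) module" where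
  "function_algebra Z A = \<lparr>carrier = A,
     monoid.mult = (\<lambda>f g. \<lambda>z\<in>Z. f z * g z), one = (\<lambda>z\<in>Z. 1),
     zero = (\<lambda>z\<in>Z. 0), add = (\<lambda>f g. \<lambda>z\<in>Z. f z + g z),
     module.smult = (\<lambda>c f. \<lambda>z\<in>Z. c * f z)\<rparr>"

text \<open>The ring \<open>A Quot J\<close> of cosets, with the scalar multiplication \<open>c \<odot> (f + J) = (c \<odot> f) + J\<close>.\<close>

definition quotient_algebra ::
    "(complex, 'a, 'm) module_scheme \<Rightarrow> 'a set \<Rightarrow> (complex, 'a set) module" where
  "quotient_algebra A J =
     ring.extend (A Quot J) (Module.module.fields (\<lambda>c C. J <+>\<^bsub>A\<^esub> ((\<lambda>a. c \<odot>\<^bsub>A\<^esub> a) ` C)))"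

definition left_translate ::
    "('z, 'm) monoid_scheme \<Rightarrow> 'z \<Rightarrow> ('z \<Rightarrow> complex) \<Rightarrow> 'z \<Rightarrow> complex" where
  "left_translate M a f = (\<lambda>z\<in>carrier M. f (a \<otimes>\<^bsub>M\<^esub> z))"

definition right_translate ::
    "('z, 'm) monoid_scheme \<Rightarrow> 'z \<Rightarrow> ('z \<Rightarrow> complex) \<Rightarrow> 'z \<Rightarrow> complex" where
  "right_translate M a f = (\<lambda>z\<in>carrier M. f (z \<otimes>\<^bsub>M\<^esub> a))"

definition fun_diff :: "'z set \<Rightarrow> ('z \<Rightarrow> complex) \<Rightarrow> ('z \<Rightarrow> complex) \<Rightarrow> 'z \<Rightarrow> complex" where
  "fun_diff Z f g = (\<lambda>z\<in>Z. f z - g z)"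

text \<open>
  Exactness of a discrete group \<open>G\<close>, in its dynamical form (amenability at infinity): the left
  translation action of \<open>G\<close> on \<open>\<ell>\<^sup>\<infinity>(G)\<close>, that is, on the Stone-Cech compactification of \<open>G\<close>,
  is amenable.
\<close>

definition exact_group :: "('g, 'm) monoid_scheme \<Rightarrow> bool" where
  "exact_group G \<longleftrightarrow>
     amenable_action G (function_algebra (carrier G) (linfty (carrier G)))
       (\<lambda>g. left_translate G (inv\<^bsub>G\<^esub> g))"

definition small_rel :: "'z set set \<Rightarrow> 'z set \<Rightarrow> bool" where
  "small_rel \<G> A \<longleftrightarrow> (\<exists>E\<in>\<G>. A \<subseteq> E)"

definition c0 :: "'z set \<Rightarrow> 'z set set \<Rightarrow> ('z \<Rightarrow> complex) set" where
  "c0 Z \<G> = {f \<in> linfty Z. \<forall>\<epsilon>>0. small_rel \<G> {z \<in> Z. cmod (f z) > \<epsilon>}}"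


section \<open>The semigroups and the families of subsets\<close>

definition X_full :: "'x set \<Rightarrow> 'x list monoid" where
  "X_full X = \<lparr>carrier = lists X, monoid.mult = (@), one = []\<rparr>"

definition X_sym :: "'x set \<Rightarrow> 'x multiset monoid" where
  "X_sym X = \<lparr>carrier = {M. set_mset M \<subseteq> X}, monoid.mult = (+), one = {#}\<rparr>"

definition semidirect ::
    "('s, 'm) monoid_scheme \<Rightarrow> ('g, 'n) monoid_scheme \<Rightarrow> ('g \<Rightarrow> 's \<Rightarrow> 's) \<Rightarrow> ('s \<times> 'g) monoid" where
  "semidirect S G \<alpha> = \<lparr>carrier = carrier S \<times> carrier G,
     monoid.mult = (\<lambda>(s, g) (t, h). (s \<otimes>\<^bsub>S\<^esub> \<alpha> g t, g \<otimes>\<^bsub>G\<^esub> h)),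
     one = (\<one>\<^bsub>S\<^esub>, \<one>\<^bsub>G\<^esub>)\<rparr>"

definition full_semidirect ::
    "('g, 'm) monoid_scheme \<Rightarrow> 'x set \<Rightarrow> ('g \<Rightarrow> 'x \<Rightarrow> 'x) \<Rightarrow> ('x list \<times> 'g) monoid" where
  "full_semidirect G X \<pi> = semidirect (X_full X) G (\<lambda>g. map (\<pi> g))"

definition sym_semidirect ::
    "('g, 'm) monoid_scheme \<Rightarrow> 'x set \<Rightarrow> ('g \<Rightarrow> 'x \<Rightarrow> 'x) \<Rightarrow> ('x multiset \<times> 'g) monoid" where
  "sym_semidirect G X \<pi> = semidirect (X_sym X) G (\<lambda>g. image_mset (\<pi> g))"

text \<open>The set \<open>s\<Gamma>t\<close> for \<open>s\<close>, \<open>t\<close> in the free commutative monoid.\<close>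

definition sym_coset ::
    "('g, 'm) monoid_scheme \<Rightarrow> 'x set \<Rightarrow> ('g \<Rightarrow> 'x \<Rightarrow> 'x) \<Rightarrow> 'x multiset \<Rightarrow> 'x multiset
      \<Rightarrow> ('x multiset \<times> 'g) set" where
  "sym_coset G X \<pi> s t =
     (let M = sym_semidirect G X \<pi>
      in {(s, \<one>\<^bsub>G\<^esub>) \<otimes>\<^bsub>M\<^esub> ({#}, g) \<otimes>\<^bsub>M\<^esub> (t, \<one>\<^bsub>G\<^esub>) | g. g \<in> carrier G})"

definition G_sym ::
    "('g, 'm) monoid_scheme \<Rightarrow> 'x set \<Rightarrow> ('g \<Rightarrow> 'x \<Rightarrow> 'x) \<Rightarrow> ('x multiset \<times> 'g) set set" where
  "G_sym G X \<pi> =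
     {\<Union>\<F> | \<F>. finite \<F> \<and>
        \<F> \<subseteq> {sym_coset G X \<pi> s t | s t. s \<in> carrier (X_sym X) \<and> t \<in> carrier (X_sym X)}}"

definition Q_map :: "'x list \<times> 'g \<Rightarrow> 'x multiset \<times> 'g" where
  "Q_map = (\<lambda>(x, g). (mset x, g))"

definition G_full ::
    "('g, 'm) monoid_scheme \<Rightarrow> 'x set \<Rightarrow> ('g \<Rightarrow> 'x \<Rightarrow> 'x) \<Rightarrow> ('x list \<times> 'g) set set" where
  "G_full G X \<pi> = {Q_map -` E \<inter> carrier (full_semidirect G X \<pi>) | E. E \<in> G_sym G X \<pi>}"


section \<open>Boundary algebras\<close>

definition linfty_closure ::
    "('g, 'm) monoid_scheme \<Rightarrow> 'x set \<Rightarrow> ('g \<Rightarrow> 'x \<Rightarrow> 'x) \<Rightarrow> ('x list \<times> 'g) set set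
      \<Rightarrow> ('x list \<times> 'g \<Rightarrow> complex) set" where
  "linfty_closure G X \<pi> \<G> =
     (let M = full_semidirect G X \<pi>; Z = carrier M
      in {f \<in> linfty Z. \<forall>s\<in>carrier (X_full X).
            fun_diff Z f (left_translate M (s, \<one>\<^bsub>G\<^esub>) f) \<in> c0 Z \<G> \<and>
            fun_diff Z f (right_translate M (s, \<one>\<^bsub>G\<^esub>) f) \<in> c0 Z \<G>})"

definition C_closure ::
    "('g, 'm) monoid_scheme \<Rightarrow> 'x set \<Rightarrow> ('g \<Rightarrow> 'x \<Rightarrow> 'x) \<Rightarrow> ('x list \<times> 'g) set set
      \<Rightarrow> ('x list \<times> 'g \<Rightarrow> complex) set" where
  "C_closure G X \<pi> \<G> =
     (let M = full_semidirect G X \<pi>; Z = carrier M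
      in {f \<in> linfty_closure G X \<pi> \<G>. \<forall>h\<in>carrier G.
            fun_diff Z f (right_translate M ([], h) f) \<in> c0 Z \<G>})"

definition linfty_boundary ::
    "('g, 'm) monoid_scheme \<Rightarrow> 'x set \<Rightarrow> ('g \<Rightarrow> 'x \<Rightarrow> 'x) \<Rightarrow> ('x list \<times> 'g) set set
      \<Rightarrow> (complex, ('x list \<times> 'g \<Rightarrow> complex) set) module" where
  "linfty_boundary G X \<pi> \<G> =
     (let Z = carrier (full_semidirect G X \<pi>)
      in quotient_algebra (function_algebra Z (linfty_closure G X \<pi> \<G>)) (c0 Z \<G>))"

definition C_boundary ::
    "('g, 'm) monoid_scheme \<Rightarrow> 'x set \<Rightarrow> ('g \<Rightarrow> 'x \<Rightarrow> 'x) \<Rightarrow> ('x list \<times> 'g) set set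
      \<Rightarrow> (complex, ('x list \<times> 'g \<Rightarrow> complex) set) module" where
  "C_boundary G X \<pi> \<G> =
     (let Z = carrier (full_semidirect G X \<pi>)
      in quotient_algebra (function_algebra Z (C_closure G X \<pi> \<G>)) (c0 Z \<G>))"

text \<open>
  The actions on cosets induced by \<open>f \<mapsto> f(g\<^sup>-\<^sup>1 \<cdot> h)\<close> and \<open>f \<mapsto> f(g\<^sup>-\<^sup>1 \<cdot>)\<close>. These maps are invertible
  and preserve \<open>c\<^sub>0(\<G>)\<close> for the family used here, so the image of the coset of \<open>f\<close> is the coset
  of the image of \<open>f\<close>.
\<close>

definition left_right_action ::
    "('g, 'm) monoid_scheme \<Rightarrow> 'x set \<Rightarrow> ('g \<Rightarrow> 'x \<Rightarrow> 'x) \<Rightarrow> 'g \<times> 'g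
      \<Rightarrow> ('x list \<times> 'g \<Rightarrow> complex) set \<Rightarrow> ('x list \<times> 'g \<Rightarrow> complex) set" where
  "left_right_action G X \<pi> = (\<lambda>(g, h) C. let M = full_semidirect G X \<pi> in
     (\<lambda>f. left_translate M ([], inv\<^bsub>G\<^esub> g) (right_translate M ([], h) f)) ` C)"

definition left_action ::
    "('g, 'm) monoid_scheme \<Rightarrow> 'x set \<Rightarrow> ('g \<Rightarrow> 'x \<Rightarrow> 'x) \<Rightarrow> 'g
      \<Rightarrow> ('x list \<times> 'g \<Rightarrow> complex) set \<Rightarrow> ('x list \<times> 'g \<Rightarrow> complex) set" where
  "left_action G X \<pi> = (\<lambda>g C. let M = full_semidirect G X \<pi> in
     left_translate M ([], inv\<^bsub>G\<^esub> g) ` C)"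

definition bi_exact_rel ::
    "('g, 'm) monoid_scheme \<Rightarrow> 'x set \<Rightarrow> ('g \<Rightarrow> 'x \<Rightarrow> 'x) \<Rightarrow> ('x list \<times> 'g) set set \<Rightarrow> bool" where
  "bi_exact_rel G X \<pi> \<G> \<longleftrightarrow>
     amenable_action (G \<times>\<times> G) (linfty_boundary G X \<pi> \<G>) (left_right_action G X \<pi>)"

end

theory Submission
  imports Defs
begin

text \<open>
  Call a subset of \<open>Z = X_full \<rtimes> \<Gamma>\<close> small if it lies in a member of \<open>\<G>\<close>. It is small iff its points
  \<open>(x, g)\<close> are words \<open>x\<close> of bounded length with letters in \<open>K \<union> gK\<close> for some finite \<open>K\<close>.
  Exactness gives almost equivariant maps \<open>p\<close> from \<open>\<Gamma>\<close> to probability measures on a fixed finite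
  subset of \<open>\<Gamma>\<close>; averaging \<open>p\<close> over the finite sets \<open>{g. g r = y}\<close>, \<open>r\<close> a representative of the
  orbit of \<open>y\<close>, extends it to \<open>X\<close>. The point \<open>(x, g)\<close> is sent to the normalisation of
  \<open>p(g) + \<Sum>\<^sub>i w(x\<^sub>i) p(x\<^sub>i)\<close> with \<open>w(y) = L + |x| + min |y| |g\<^sup>-\<^sup>1y|\<close>, where \<open>|\<cdot>|\<close> is a proper function on \<open>X\<close>
  changed by each group element by a bounded amount. The total mass \<open>W\<close> is at least \<open>|x|\<^sup>2\<close> and
  bounded only on small sets, while inserting letters or multiplying \<open>g\<close> on the right changes the
  unnormalised measure by \<open>O(|x| + 1)\<close>. Hence the coordinates lie in \<open>C\<close>, and they are almost
  equivariant once \<open>L\<close> is large. A character of the quotient algebra evaluated at these coordinates is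
  a probability measure on the finite set. For the bi-action one multiplies with the same map composed
  with the anti-automorphism \<open>(x, g) \<mapsto> (g\<^sup>-\<^sup>1 rev x, g\<^sup>-\<^sup>1)\<close>, which exchanges the two sides.
\<close>

section \<open>Functions vanishing along a family of small sets\<close>

text \<open>Each summand of the mass answers an obstacle. Right insertion of a letter
  \<open>s\<close> at \<open>(x, g)\<close> appends \<open>g s\<close>, whose length is unbounded in
  \<open>g\<close>, and left insertion prepends \<open>s\<close> itself; the minimum of
  \<open>|y|\<close> and \<open>|g^-1 y|\<close> stays bounded in both cases. Long words over a
  fixed finite set of letters leave every small set, yet replacing \<open>g\<close> by
  \<open>g h\<close> may change each of their weights by a constant; the summand \<open>|x|\<close>
  makes the mass quadratic in the length against a linear error. The term \<open>p(g)\<close> keeps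
  the mass at least 1 on the empty word. Finitely many orbits give the proper length function,
  finite stabilizers the finite averages, and compactness of the spectrum turns exactness into
  measures with a common finite support, so that a character is evaluated at finitely many
  coordinates. The facts about characters rest on one observation: a function bounded away from zero
  is invertible inside the algebra. The left-equivariant map ignores the right action modulo
  functions vanishing along small sets, so in the product for the bi-action each factor follows one
  coordinate of the group.\<close>

locale small_sets =
  fixes Z :: "'z set" and \<G> :: "'z set set"
  assumes small_empty: "small_rel \<G> {}"
    and small_Un: "small_rel \<G> A \<Longrightarrow> small_rel \<G> B \<Longrightarrow> small_rel \<G> (A \<union> B)"
begin

lemma small_mono: "small_rel \<G> B \<Longrightarrow> A \<subseteq> B \<Longrightarrow> small_rel \<G> A"
  unfolding small_rel_def by blast

definition vanishing :: "('z \<Rightarrow> 'b::real_normed_vector) \<Rightarrow> bool" where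
  "vanishing f \<longleftrightarrow> (\<forall>\<epsilon>>0. small_rel \<G> {z \<in> Z. norm (f z) > \<epsilon>})"

text \<open>Two dominating functions are allowed because the change of a product is controlled by
  the changes of both factors. The three codomains may differ, so that real estimates control
  complex functions.\<close>

lemma vanishing_dominated:
  fixes f :: "'z \<Rightarrow> 'a::real_normed_vector" and g :: "'z \<Rightarrow> 'b::real_normed_vector"
    and h :: "'z \<Rightarrow> 'c::real_normed_vector"
  assumes "vanishing f" "vanishing g"
    and le: "\<And>z. z \<in> Z \<Longrightarrow> norm (h z) \<le> K * (norm (f z) + norm (g z))"
  shows "vanishing h"
  unfolding vanishing_def
proof (intro allI impI)
  fix \<epsilon> :: real assume \<epsilon>: "\<epsilon> > 0"
  \<comment> \<open>The factor 2 shares the error between \<open>f\<close> and \<open>g\<close>;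
    \<open>\<bar>K\<bar> + 1\<close> is positive even if \<open>K\<close> is zero or
    negative.\<close>
  define \<delta> where "\<delta> = \<epsilon> / (2 * (\<bar>K\<bar> + 1))"
  have nz: "\<bar>K\<bar> + 1 \<noteq> 0" by linarith
  have \<delta>: "\<delta> > 0" using \<epsilon> by (simp add: \<delta>_def)
  have "small_rel \<G> ({z \<in> Z. norm (f z) > \<delta>} \<union> {z \<in> Z. norm (g z) > \<delta>})"
    using assms(1,2) \<delta> unfolding vanishing_def by (intro small_Un) auto
  moreover have False if z: "z \<in> {z \<in> Z. \<epsilon> < norm (h z)}"
      and n: "z \<notin> {z \<in> Z. norm (f z) > \<delta>} \<union> {z \<in> Z. norm (g z) > \<delta>}" for z
  proof -
    have "norm (h z) \<le> K * (norm (f z) + norm (g z))" using le z by auto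
    also have "\<dots> \<le> (\<bar>K\<bar> + 1) * (norm (f z) + norm (g z))" by (intro mult_right_mono) auto
    also have "\<dots> \<le> (\<bar>K\<bar> + 1) * (\<delta> + \<delta>)" using n z by (intro mult_left_mono) auto
    also have "\<dots> = \<epsilon>" using nz unfolding \<delta>_def by (simp del: distrib_left_numeral)
    finally show False using z by simp
  qed
  ultimately show "small_rel \<G> {z \<in> Z. norm (h z) > \<epsilon>}" by (meson small_mono subsetI)
qed

lemma vanishing_dominated1:
  assumes "vanishing f" and "\<And>z. z \<in> Z \<Longrightarrow> norm (h z) \<le> K * norm (f z)"
  shows "vanishing h"
proof (rule vanishing_dominated[OF assms(1) assms(1)])
  fix z assume "z \<in> Z"
  then show "norm (h z) \<le> (K / 2) * (norm (f z) + norm (f z))" using assms(2)[of z] by simp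
qed

lemma vanishing_zero: "vanishing (\<lambda>z. 0)"
  by (simp add: vanishing_def small_empty)

lemma vanishing_add: "vanishing f \<Longrightarrow> vanishing g \<Longrightarrow> vanishing (\<lambda>z. f z + g z)"
  by (rule vanishing_dominated[of f g _ 1]) (auto intro: norm_triangle_ineq)

lemma vanishing_sum:
  "finite I \<Longrightarrow> (\<And>i. i \<in> I \<Longrightarrow> vanishing (f i)) \<Longrightarrow> vanishing (\<lambda>z. \<Sum>i\<in>I. f i z)"
  by (induction I rule: finite_induct) (auto intro: vanishing_zero vanishing_add)

lemma vanishing_comp:
  assumes "vanishing f" and "\<And>z. z \<in> Z \<Longrightarrow> T z \<in> Z"
    and "\<And>A. small_rel \<G> A \<Longrightarrow> small_rel \<G> {z \<in> Z. T z \<in> A}"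
  shows "vanishing (\<lambda>z. f (T z))"
  unfolding vanishing_def
proof (intro allI impI)
  fix \<epsilon> :: real assume "\<epsilon> > 0"
  then have "small_rel \<G> {z \<in> Z. T z \<in> {z \<in> Z. \<epsilon> < norm (f z)}}"
    using assms unfolding vanishing_def by blast
  then show "small_rel \<G> {z \<in> Z. norm (f (T z)) > \<epsilon>}"
    by (rule small_mono) (use assms(2) in auto)
qed

lemma vanishing_cong: "(\<And>z. z \<in> Z \<Longrightarrow> f z = g z) \<Longrightarrow> vanishing f \<longleftrightarrow> vanishing g"
  unfolding vanishing_def by (metis (mono_tags, lifting) Collect_cong)

lemma c0_iff: "f \<in> c0 Z \<G> \<longleftrightarrow> f \<in> linfty Z \<and> vanishing f"
  by (simp add: c0_def vanishing_def)

end

lemma linfty_bound: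
  assumes "f \<in> linfty Z" obtains M where "M > 0" "\<And>z. z \<in> Z \<Longrightarrow> cmod (f z) \<le> M"
  using assms unfolding linfty_def bounded_pos by auto

lemma linftyI:
  assumes "\<And>z. z \<in> Z \<Longrightarrow> cmod (f z) \<le> M" shows "(\<lambda>z\<in>Z. f z) \<in> linfty Z"
  using assms unfolding linfty_def bounded_iff by auto

lemma linfty_restrict: "f \<in> linfty Z \<Longrightarrow> restrict f Z = f"
  by (simp add: linfty_def extensional_restrict)

lemma linfty_add:
  assumes "f \<in> linfty Z" "g \<in> linfty Z" shows "(\<lambda>z\<in>Z. f z + g z) \<in> linfty Z"
proof -
  obtain M N where "\<And>z. z \<in> Z \<Longrightarrow> cmod (f z) \<le> M" "\<And>z. z \<in> Z \<Longrightarrow> cmod (g z) \<le> N"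
    using assms linfty_bound by metis
  then show ?thesis by (intro linftyI[of _ _ "M + N"] norm_triangle_mono) auto
qed

lemma linfty_mult:
  assumes "f \<in> linfty Z" "g \<in> linfty Z" shows "(\<lambda>z\<in>Z. f z * g z) \<in> linfty Z"
proof -
  obtain M N where "\<And>z. z \<in> Z \<Longrightarrow> cmod (f z) \<le> M" "\<And>z. z \<in> Z \<Longrightarrow> cmod (g z) \<le> N" "M > 0"
    using assms linfty_bound by metis
  then show ?thesis by (intro linftyI[of _ _ "M * N"]) (auto simp: norm_mult intro!: mult_mono)
qed

lemma linfty_const: "(\<lambda>z\<in>Z. c) \<in> linfty Z"
  by (rule linftyI[of _ _ "cmod c"]) auto

lemma linfty_comp:
  assumes "f \<in> linfty Z" "\<And>z. z \<in> Z \<Longrightarrow> T z \<in> Z" shows "(\<lambda>z\<in>Z. f (T z)) \<in> linfty Z"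
proof -
  obtain M where "\<And>z. z \<in> Z \<Longrightarrow> cmod (f z) \<le> M" using linfty_bound[OF assms(1)] by blast
  then show ?thesis using assms(2) by (intro linftyI[of _ _ M]) auto
qed

lemma linfty_diff:
  assumes "f \<in> linfty Z" "g \<in> linfty Z" shows "(\<lambda>z\<in>Z. f z - g z) \<in> linfty Z"
proof -
  have "(\<lambda>z\<in>Z. f z + (\<lambda>z\<in>Z. (\<lambda>z\<in>Z. -1) z * g z) z) \<in> linfty Z"
    by (intro linfty_add linfty_mult linfty_const assms)
  moreover have "(\<lambda>z\<in>Z. f z + (\<lambda>z\<in>Z. (\<lambda>z\<in>Z. -1) z * g z) z) = (\<lambda>z\<in>Z. f z - g z)"
    by (rule ext) auto
  ultimately show ?thesis by simp
qed

section \<open>Algebras of functions almost invariant under shifts\<close>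

definition shift_algebra :: "'z set \<Rightarrow> 'z set set \<Rightarrow> ('z \<Rightarrow> 'z) set \<Rightarrow> ('z \<Rightarrow> complex) set" where
  "shift_algebra Z \<G> \<T> =
     {f \<in> linfty Z. \<forall>T\<in>\<T>. fun_diff Z f (\<lambda>z\<in>Z. f (T z)) \<in> c0 Z \<G>}"

text \<open>The two closures in the theorem differ only in the set of shifts, so quotients and
  characters are treated once for an arbitrary set. With no shifts the algebra is all of
  \<open>linfty Z\<close>, which is the case needed for exactness.\<close>

locale shifts = small_sets Z \<G> for Z :: "'z set" and \<G> +
  fixes \<T> :: "('z \<Rightarrow> 'z) set"
  assumes shift_closed: "T \<in> \<T> \<Longrightarrow> z \<in> Z \<Longrightarrow> T z \<in> Z"
    and shift_small: "T \<in> \<T> \<Longrightarrow> small_rel \<G> A \<Longrightarrow> small_rel \<G> {z \<in> Z. T z \<in> A}"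
begin

abbreviation \<A> where "\<A> \<equiv> shift_algebra Z \<G> \<T>"
abbreviation \<J> where "\<J> \<equiv> c0 Z \<G>"
abbreviation FA where "FA \<equiv> function_algebra Z \<A>"

lemma mem_iff: "f \<in> \<A> \<longleftrightarrow> f \<in> linfty Z \<and> (\<forall>T\<in>\<T>. vanishing (\<lambda>z. f z - f (T z)))"
proof -
  have "fun_diff Z f (\<lambda>z\<in>Z. f (T z)) \<in> c0 Z \<G> \<longleftrightarrow> vanishing (\<lambda>z. f z - f (T z))"
    if "f \<in> linfty Z" "T \<in> \<T>" for T
  proof -
    have "fun_diff Z f (\<lambda>z\<in>Z. f (T z)) \<in> linfty Z"
      unfolding fun_diff_def using that by (intro linfty_diff linfty_comp) (auto intro: shift_closed)
    moreover have "vanishing (fun_diff Z f (\<lambda>z\<in>Z. f (T z))) \<longleftrightarrow> vanishing (\<lambda>z. f z - f (T z))"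
      by (rule vanishing_cong) (simp add: fun_diff_def)
    ultimately show ?thesis by (simp add: c0_iff)
  qed
  then show ?thesis by (auto simp: shift_algebra_def)
qed

lemma mem_linfty: "f \<in> \<A> \<Longrightarrow> f \<in> linfty Z"
  by (simp add: mem_iff)

lemma restrict_mem_iff:
  "(\<lambda>z\<in>Z. f z) \<in> \<A> \<longleftrightarrow> (\<lambda>z\<in>Z. f z) \<in> linfty Z \<and> (\<forall>T\<in>\<T>. vanishing (\<lambda>z. f z - f (T z)))"
proof -
  have "vanishing (\<lambda>z. (\<lambda>z\<in>Z. f z) z - (\<lambda>z\<in>Z. f z) (T z)) \<longleftrightarrow> vanishing (\<lambda>z. f z - f (T z))"
    if "T \<in> \<T>" for T
    by (rule vanishing_cong) (simp add: shift_closed that)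
  then show ?thesis by (auto simp: mem_iff)
qed

text \<open>A vanishing function stays vanishing after a shift because shifts pull small sets back
  to small sets.\<close>

lemma J_subset: "\<J> \<subseteq> \<A>"
proof
  fix f assume f: "f \<in> \<J>"
  have "vanishing (\<lambda>z. f z - f (T z))" if "T \<in> \<T>" for T
  proof (rule vanishing_dominated[of f "\<lambda>z. f (T z)" _ 1])
    show f: "vanishing f" using f by (simp add: c0_iff)
    show "vanishing (\<lambda>z. f (T z))"
      by (rule vanishing_comp[OF f shift_closed[OF that] shift_small[OF that]])
  qed (simp add: norm_triangle_ineq4)
  then show "f \<in> \<A>" using f by (simp add: mem_iff c0_iff)
qed

lemma add_mem: "f \<in> \<A> \<Longrightarrow> g \<in> \<A> \<Longrightarrow> (\<lambda>z\<in>Z. f z + g z) \<in> \<A>"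
  unfolding restrict_mem_iff
proof (intro conjI ballI)
  fix T assume fg: "f \<in> \<A>" "g \<in> \<A>" "T \<in> \<T>"
  have "norm (f z + g z - (f (T z) + g (T z))) \<le> 1 * (norm (f z - f (T z)) + norm (g z - g (T z)))" for z
    using norm_triangle_ineq[of "f z - f (T z)" "g z - g (T z)"] by (simp add: algebra_simps)
  then show "vanishing (\<lambda>z. f z + g z - (f (T z) + g (T z)))"
    by (rule vanishing_dominated[rotated 2]) (use fg in \<open>auto simp: mem_iff\<close>)
qed (auto simp: mem_iff intro: linfty_add)

lemma const_mem: "(\<lambda>z\<in>Z. c) \<in> \<A>"
  unfolding restrict_mem_iff by (auto intro: linfty_const vanishing_zero)

lemma mult_mem: "f \<in> \<A> \<Longrightarrow> g \<in> \<A> \<Longrightarrow> (\<lambda>z\<in>Z. f z * g z) \<in> \<A>"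
  unfolding restrict_mem_iff
proof (intro conjI ballI)
  fix T assume fg: "f \<in> \<A>" "g \<in> \<A>" "T \<in> \<T>"
  obtain M where M: "M > 0" "\<And>z. z \<in> Z \<Longrightarrow> cmod (f z) \<le> M" using fg linfty_bound mem_linfty by blast
  obtain N where N: "N > 0" "\<And>z. z \<in> Z \<Longrightarrow> cmod (g z) \<le> N" using fg linfty_bound mem_linfty by blast
  show "vanishing (\<lambda>z. f z * g z - f (T z) * g (T z))"
  proof (rule vanishing_dominated[of "\<lambda>z. f z - f (T z)" "\<lambda>z. g z - g (T z)" _ "M + N"])
    fix z assume z: "z \<in> Z"
    have "norm (f z * g z - f (T z) * g (T z)) = norm (f z * (g z - g (T z)) + (f z - f (T z)) * g (T z))"
      by (simp add: algebra_simps)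
    also have "\<dots> \<le> norm (f z) * norm (g z - g (T z)) + norm (f z - f (T z)) * norm (g (T z))"
      by (metis norm_mult norm_triangle_ineq)
    also have "\<dots> \<le> (M + N) * norm (g z - g (T z)) + norm (f z - f (T z)) * (M + N)"
    proof (intro add_mono mult_left_mono mult_right_mono)
      show "cmod (f z) \<le> M + N" using M(2)[OF z] N(1) by simp
      show "cmod (g (T z)) \<le> M + N" using N(2)[of "T z"] M(1) shift_closed[OF fg(3) z] by simp
    qed auto
    finally show "norm (f z * g z - f (T z) * g (T z))
        \<le> (M + N) * (norm (f z - f (T z)) + norm (g z - g (T z)))"
      by (simp add: algebra_simps)
  qed (use fg in \<open>auto simp: mem_iff\<close>)
qed (auto simp: mem_iff intro: linfty_mult)

lemma smult_mem: "f \<in> \<A> \<Longrightarrow> (\<lambda>z\<in>Z. c * f z) \<in> \<A>"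
proof -
  assume "f \<in> \<A>"
  then have "(\<lambda>z\<in>Z. (\<lambda>z\<in>Z. c) z * f z) \<in> \<A>" by (intro mult_mem const_mem)
  also have "(\<lambda>z\<in>Z. (\<lambda>z\<in>Z. c) z * f z) = (\<lambda>z\<in>Z. c * f z)" by (rule ext) auto
  finally show ?thesis .
qed

text \<open>The difference of two inverses is the difference of the values times two factors of size
  at most \<open>inverse \<delta>\<close>, so almost invariance survives inversion. This replaces
  the general theory of spectra: it makes values of characters lie in the closure of the
  range.\<close>

lemma inverse_mem:
  assumes f: "f \<in> \<A>" and "\<delta> > 0" and lower: "\<And>z. z \<in> Z \<Longrightarrow> \<delta> \<le> cmod (f z)"
  shows "(\<lambda>z\<in>Z. inverse (f z)) \<in> \<A>"
  unfolding restrict_mem_iff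
proof (intro conjI ballI)
  have inv: "cmod (inverse (f z)) \<le> inverse \<delta>" if "z \<in> Z" for z
    using lower[OF that] \<open>\<delta> > 0\<close> unfolding norm_inverse by (intro le_imp_inverse_le) auto
  show "(\<lambda>z\<in>Z. inverse (f z)) \<in> linfty Z" by (rule linftyI[of _ _ "inverse \<delta>"]) (rule inv)
  fix T assume T: "T \<in> \<T>"
  show "vanishing (\<lambda>z. inverse (f z) - inverse (f (T z)))"
  proof (rule vanishing_dominated1[of "\<lambda>z. f z - f (T z)" _ "inverse \<delta> * inverse \<delta>"])
    fix z assume z: "z \<in> Z"
    then have "f z \<noteq> 0" "f (T z) \<noteq> 0"
      using lower[of z] lower[of "T z"] shift_closed[OF T z] \<open>\<delta> > 0\<close> by auto
    then have "norm (inverse (f z) - inverse (f (T z)))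
        = norm (inverse (f z)) * norm (inverse (f (T z))) * norm (f z - f (T z))"
      by (simp add: inverse_diff_inverse norm_mult mult_ac)
    also have "\<dots> \<le> inverse \<delta> * inverse \<delta> * norm (f z - f (T z))"
      using inv[OF z] inv[OF shift_closed[OF T z]] \<open>\<delta> > 0\<close> by (intro mult_right_mono mult_mono) auto
    finally show "norm (inverse (f z) - inverse (f (T z))) \<le> inverse \<delta> * inverse \<delta> * norm (f z - f (T z))" .
  qed (use f T in \<open>auto simp: mem_iff\<close>)
qed

text \<open>The shift \<open>T'\<close> may differ from \<open>T\<close>: left translation by
  \<open>h\<close> turns the insertion of \<open>s\<close> on the left into the insertion of
  \<open>h s\<close>, and \<open>star\<close> exchanges the two sides.\<close>

lemma comp_mem:
  assumes f: "f \<in> \<A>" and closed: "\<And>z. z \<in> Z \<Longrightarrow> \<sigma> z \<in> Z"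
    and small: "\<And>A. small_rel \<G> A \<Longrightarrow> small_rel \<G> {z \<in> Z. \<sigma> z \<in> A}"
    and intertwine: "\<And>T. T \<in> \<T> \<Longrightarrow> \<exists>T'\<in>\<T>. \<forall>z\<in>Z. \<sigma> (T z) = T' (\<sigma> z)"
  shows "(\<lambda>z\<in>Z. f (\<sigma> z)) \<in> \<A>"
  unfolding restrict_mem_iff
proof (intro conjI ballI)
  show "(\<lambda>z\<in>Z. f (\<sigma> z)) \<in> linfty Z" using mem_linfty[OF f] closed by (rule linfty_comp)
  fix T assume "T \<in> \<T>"
  then obtain T' where T': "T' \<in> \<T>" "\<forall>z\<in>Z. \<sigma> (T z) = T' (\<sigma> z)" using intertwine by blast
  have v: "vanishing (\<lambda>z. f z - f (T' z))" using f T' by (simp add: mem_iff)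
  have "vanishing (\<lambda>z. f (\<sigma> z) - f (T' (\<sigma> z)))" by (rule vanishing_comp[OF v closed small])
  then show "vanishing (\<lambda>z. f (\<sigma> z) - f (\<sigma> (T z)))"
    by (rule vanishing_cong[THEN iffD1, rotated]) (simp add: T')
qed

lemma FA_simps:
  "carrier FA = \<A>" "f \<otimes>\<^bsub>FA\<^esub> g = (\<lambda>z\<in>Z. f z * g z)" "\<one>\<^bsub>FA\<^esub> = (\<lambda>z\<in>Z. 1)"
  "\<zero>\<^bsub>FA\<^esub> = (\<lambda>z\<in>Z. 0)" "f \<oplus>\<^bsub>FA\<^esub> g = (\<lambda>z\<in>Z. f z + g z)" "c \<odot>\<^bsub>FA\<^esub> f = (\<lambda>z\<in>Z. c * f z)"
  by (simp_all add: function_algebra_def)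

lemma cring_FA: "cring FA"
proof (rule cringI)
  show "abelian_group FA"
  proof (rule abelian_groupI)
    fix f assume f: "f \<in> carrier FA"
    show "\<exists>g\<in>carrier FA. g \<oplus>\<^bsub>FA\<^esub> f = \<zero>\<^bsub>FA\<^esub>"
      using smult_mem[of f "-1"] f by (intro bexI[of _ "\<lambda>z\<in>Z. -1 * f z"]) (auto simp: FA_simps)
    show "\<zero>\<^bsub>FA\<^esub> \<oplus>\<^bsub>FA\<^esub> f = f"
      using f linfty_restrict[OF mem_linfty] by (auto simp: FA_simps cong: restrict_cong)
  qed (auto simp: FA_simps add_mem const_mem add.commute add.assoc)
  show "Group.comm_monoid FA"
  proof (rule comm_monoidI)
    fix f assume f: "f \<in> carrier FA"
    show "\<one>\<^bsub>FA\<^esub> \<otimes>\<^bsub>FA\<^esub> f = f"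
      using f linfty_restrict[OF mem_linfty] by (auto simp: FA_simps cong: restrict_cong)
  qed (auto simp: FA_simps mult_mem const_mem mult.commute mult.assoc)
qed (auto simp: FA_simps distrib_right fun_eq_iff)

lemma J_add: "f \<in> \<J> \<Longrightarrow> g \<in> \<J> \<Longrightarrow> (\<lambda>z\<in>Z. f z + g z) \<in> \<J>"
  using linfty_add vanishing_add[of f g]
    vanishing_cong[of "\<lambda>z\<in>Z. f z + g z" "\<lambda>z. f z + g z"] by (auto simp: c0_iff)

lemma J_mult:
  assumes f: "f \<in> \<J>" and g: "g \<in> linfty Z" shows "(\<lambda>z\<in>Z. f z * g z) \<in> \<J>"
proof -
  obtain M where M: "M > 0" "\<And>z. z \<in> Z \<Longrightarrow> cmod (g z) \<le> M" using g linfty_bound by blast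
  have "vanishing (\<lambda>z\<in>Z. f z * g z)"
  proof (rule vanishing_dominated1[of f _ M])
    show "vanishing f" using f by (simp add: c0_iff)
    show "norm ((\<lambda>z\<in>Z. f z * g z) z) \<le> M * norm (f z)" if "z \<in> Z" for z
      using M(2)[OF that] that by (simp add: norm_mult mult_right_mono mult.commute[of "cmod (f z)"])
  qed
  then show ?thesis using f g by (auto simp: c0_iff intro: linfty_mult)
qed

lemma J_zero: "(\<lambda>z\<in>Z. 0) \<in> \<J>"
proof -
  have "vanishing (\<lambda>z\<in>Z. 0 :: complex) \<longleftrightarrow> vanishing (\<lambda>z. 0 :: complex)"
    by (rule vanishing_cong) simp
  then show ?thesis using vanishing_zero linfty_const[where Z = Z and c = 0] by (simp add: c0_iff)
qed

lemma ideal_J: "ideal \<J> FA"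
proof (rule idealI)
  interpret cring FA by (rule cring_FA)
  show "ring FA" by (rule ring_axioms)
  have neg: "(\<lambda>z\<in>Z. - f z) \<in> \<J>" if "f \<in> \<J>" for f
  proof -
    have "(\<lambda>z\<in>Z. f z * (\<lambda>z\<in>Z. -1) z) \<in> \<J>" by (intro J_mult linfty_const that)
    also have "(\<lambda>z\<in>Z. f z * (\<lambda>z\<in>Z. -1) z) = (\<lambda>z\<in>Z. - f z)" by (rule ext) auto
    finally show ?thesis .
  qed
  show "subgroup \<J> (add_monoid FA)"
  proof (rule add.subgroupI)
    show "\<J> \<subseteq> carrier FA" using J_subset by (simp add: FA_simps)
    show "\<J> \<noteq> {}" using J_zero by auto
    fix f assume f: "f \<in> \<J>"
    have "\<ominus>\<^bsub>FA\<^esub> f = (\<lambda>z\<in>Z. - f z)"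
      by (rule minus_equality) (use f neg[OF f] J_subset in \<open>auto simp: FA_simps fun_eq_iff\<close>)
    then show "\<ominus>\<^bsub>FA\<^esub> f \<in> \<J>" using neg[OF f] by simp
    fix g assume "g \<in> \<J>"
    with f show "f \<oplus>\<^bsub>FA\<^esub> g \<in> \<J>" by (simp add: FA_simps J_add)
  qed
  fix f g assume fg: "f \<in> \<J>" "g \<in> carrier FA"
  show "f \<otimes>\<^bsub>FA\<^esub> g \<in> \<J>" using fg J_mult mem_linfty by (simp add: FA_simps)
  moreover have "g \<otimes>\<^bsub>FA\<^esub> f = f \<otimes>\<^bsub>FA\<^esub> g" by (simp add: FA_simps mult.commute)
  ultimately show "g \<otimes>\<^bsub>FA\<^esub> f \<in> \<J>" by simp
qed

section \<open>Characters\<close>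

lemma charD:
  assumes "\<psi> \<in> characters FA"
  shows "\<psi> (\<lambda>z\<in>Z. 1) = 1"
    and "f \<in> \<A> \<Longrightarrow> g \<in> \<A> \<Longrightarrow> \<psi> (\<lambda>z\<in>Z. f z + g z) = \<psi> f + \<psi> g"
    and "f \<in> \<A> \<Longrightarrow> g \<in> \<A> \<Longrightarrow> \<psi> (\<lambda>z\<in>Z. f z * g z) = \<psi> f * \<psi> g"
    and "f \<in> \<A> \<Longrightarrow> \<psi> (\<lambda>z\<in>Z. c * f z) = c * \<psi> f"
  using assms unfolding characters_def by (auto simp: FA_simps)

lemma char_const:
  assumes "\<psi> \<in> characters FA" shows "\<psi> (\<lambda>z\<in>Z. c) = c"
proof -
  have "\<psi> (\<lambda>z\<in>Z. c * (\<lambda>z\<in>Z. 1) z) = c * \<psi> (\<lambda>z\<in>Z. 1)"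
    by (rule charD(4)[OF assms const_mem])
  moreover have "(\<lambda>z\<in>Z. c * (\<lambda>z\<in>Z. 1) z) = (\<lambda>z\<in>Z. c)" by (rule ext) auto
  ultimately show ?thesis using charD(1)[OF assms] by simp
qed

text \<open>If the value of the character were at positive distance from \<open>K\<close>, then
  \<open>f\<close> minus that value would be bounded away from zero, hence invertible in the
  algebra, although the character sends it to 0.\<close>

lemma char_in_closed:
  assumes \<psi>: "\<psi> \<in> characters FA" and f: "f \<in> \<A>" and K: "closed K" "\<And>z. z \<in> Z \<Longrightarrow> f z \<in> K"
  shows "\<psi> f \<in> K"
proof (rule ccontr)
  assume "\<psi> f \<notin> K"
  then obtain \<delta> where \<delta>: "\<delta> > 0" "\<And>y. y \<in> K \<Longrightarrow> \<delta> \<le> dist (\<psi> f) y"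
    using separate_point_closed[OF K(1)] by blast
  define g where "g = (\<lambda>z\<in>Z. f z + (\<lambda>z\<in>Z. - \<psi> f) z)"
  have g: "g \<in> \<A>" unfolding g_def by (intro add_mem f const_mem)
  have \<psi>g: "\<psi> g = 0" unfolding g_def using charD(2)[OF \<psi> f const_mem] char_const[OF \<psi>] by simp
  have lower: "\<delta> \<le> cmod (g z)" if "z \<in> Z" for z
    using \<delta>(2)[OF K(2)[OF that]] that by (simp add: g_def dist_norm norm_minus_commute)
  have i: "(\<lambda>z\<in>Z. inverse (g z)) \<in> \<A>" by (rule inverse_mem[OF g \<delta>(1) lower])
  have "(\<lambda>z\<in>Z. g z * (\<lambda>z\<in>Z. inverse (g z)) z) = (\<lambda>z\<in>Z. 1)"
    by (rule restrict_ext) (use lower \<delta>(1) in \<open>force intro!: right_inverse\<close>)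
  then have "1 = \<psi> g * \<psi> (\<lambda>z\<in>Z. inverse (g z))"
    using charD(1)[OF \<psi>] charD(3)[OF \<psi> g i] by simp
  then show False using \<psi>g by simp
qed

lemma char_bound:
  assumes \<psi>: "\<psi> \<in> characters FA" and f: "f \<in> \<A>" and "\<And>z. z \<in> Z \<Longrightarrow> cmod (f z) \<le> M"
  shows "cmod (\<psi> f) \<le> M"
  using char_in_closed[OF \<psi> f, of "cball 0 M"] assms(3) by simp

text \<open>Cutting \<open>f\<close> off where it exceeds \<open>M\<close> changes it only on a
  small set, hence by an element of the ideal, which the character kills. Exceptional small sets are
  therefore harmless in all later estimates.\<close>

lemma char_essential_bound:
  assumes \<psi>: "\<psi> \<in> characters FA" and vanish: "\<And>j. j \<in> \<J> \<Longrightarrow> \<psi> j = 0" and f: "f \<in> \<A>"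
    and M: "M \<ge> 0" and small: "small_rel \<G> {z \<in> Z. cmod (f z) > M}"
  shows "cmod (\<psi> f) \<le> M"
proof -
  define j where "j = (\<lambda>z\<in>Z. if cmod (f z) > M then f z else 0)"
  define r where "r = (\<lambda>z\<in>Z. f z + (\<lambda>z\<in>Z. -1 * j z) z)"
  have "j \<in> linfty Z"
    unfolding j_def by (rule linfty_bound[OF mem_linfty[OF f]]) (rule linftyI, force)
  moreover have "vanishing j"
    unfolding vanishing_def
  proof (intro allI impI)
    fix \<epsilon> :: real assume "\<epsilon> > 0"
    then show "small_rel \<G> {z \<in> Z. cmod (j z) > \<epsilon>}"
      by (intro small_mono[OF small]) (auto simp: j_def split: if_splits)
  qed
  ultimately have j: "j \<in> \<J>" by (simp add: c0_iff)
  then have j': "(\<lambda>z\<in>Z. -1 * j z) \<in> \<A>" by (intro smult_mem subsetD[OF J_subset])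
  have "\<psi> (\<lambda>z\<in>Z. -1 * j z) = -1 * \<psi> j" using j J_subset by (intro charD(4)[OF \<psi>]) auto
  with vanish[OF j] have "\<psi> r = \<psi> f" using charD(2)[OF \<psi> f j'] by (simp add: r_def)
  moreover have "cmod (\<psi> r) \<le> M"
  proof (rule char_bound[OF \<psi>])
    show "r \<in> \<A>" unfolding r_def by (intro add_mem f j')
    show "cmod (r z) \<le> M" if "z \<in> Z" for z using that M by (auto simp: r_def j_def)
  qed
  ultimately show ?thesis by simp
qed

lemma sum_mem:
  assumes "finite I" "\<And>i. i \<in> I \<Longrightarrow> f i \<in> \<A>"
  shows "(\<lambda>z\<in>Z. \<Sum>i\<in>I. f i z) \<in> \<A>"
  using assms
proof (induction I rule: finite_induct)
  case empty then show ?case by (simp only: sum.empty const_mem)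
next
  case (insert i I)
  have "(\<lambda>z\<in>Z. f i z + (\<lambda>z\<in>Z. \<Sum>i\<in>I. f i z) z) \<in> \<A>" using insert by (intro add_mem) auto
  also have "(\<lambda>z\<in>Z. f i z + (\<lambda>z\<in>Z. \<Sum>i\<in>I. f i z) z) = (\<lambda>z\<in>Z. \<Sum>i\<in>insert i I. f i z)"
    using insert by (intro restrict_ext) auto
  finally show ?case .
qed

lemma char_sum:
  assumes \<psi>: "\<psi> \<in> characters FA" and "finite I" "\<And>i. i \<in> I \<Longrightarrow> f i \<in> \<A>"
  shows "\<psi> (\<lambda>z\<in>Z. \<Sum>i\<in>I. f i z) = (\<Sum>i\<in>I. \<psi> (f i))"
  using assms(2,3)
proof (induction I rule: finite_induct)
  case empty then show ?case by (simp only: sum.empty char_const[OF \<psi>])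
next
  case (insert i I)
  have "\<psi> (\<lambda>z\<in>Z. f i z + (\<lambda>z\<in>Z. \<Sum>i\<in>I. f i z) z) = \<psi> (f i) + \<psi> (\<lambda>z\<in>Z. \<Sum>i\<in>I. f i z)"
    using insert by (intro charD(2)[OF \<psi>] sum_mem) auto
  moreover have "(\<lambda>z\<in>Z. f i z + (\<lambda>z\<in>Z. \<Sum>i\<in>I. f i z) z) = (\<lambda>z\<in>Z. \<Sum>i\<in>insert i I. f i z)"
    using insert by (intro restrict_ext) auto
  ultimately have "\<psi> (\<lambda>z\<in>Z. \<Sum>i\<in>insert i I. f i z) = \<psi> (f i) + \<psi> (\<lambda>z\<in>Z. \<Sum>i\<in>I. f i z)"
    by (simp only:)
  also have "\<psi> (\<lambda>z\<in>Z. \<Sum>i\<in>I. f i z) = (\<Sum>i\<in>I. \<psi> (f i))" using insert by blast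
  finally show ?case using insert.hyps by simp
qed

section \<open>The quotient algebra and its characters\<close>

abbreviation QA where "QA \<equiv> quotient_algebra FA \<J>"

lemma QA_simps:
  "carrier QA = a_rcosets\<^bsub>FA\<^esub> \<J>" "monoid.mult QA = rcoset_mult FA \<J>" "\<one>\<^bsub>QA\<^esub> = \<J> +>\<^bsub>FA\<^esub> \<one>\<^bsub>FA\<^esub>"
  "ring.add QA = set_add FA"
  "c \<odot>\<^bsub>QA\<^esub> C = \<J> <+>\<^bsub>FA\<^esub> ((\<lambda>a. c \<odot>\<^bsub>FA\<^esub> a) ` C)"
  by (simp_all add: quotient_algebra_def FactRing_def ring.defs module.defs)

lemma coset_eq: "\<J> +>\<^bsub>FA\<^esub> f = {\<lambda>z\<in>Z. j z + f z | j. j \<in> \<J>}"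
  by (auto simp: a_r_coset_def' FA_simps)

lemma coset_in_carrier: "f \<in> \<A> \<Longrightarrow> \<J> +>\<^bsub>FA\<^esub> f \<in> carrier QA"
  by (auto simp: QA_simps A_RCOSETS_def' FA_simps)

text \<open>Adding the ideal in the definition of the scalar multiple matters for
  \<open>c = 0\<close>, where scaling the elements of a coset leaves the zero function
  alone.\<close>

lemma smult_coset:
  assumes f: "f \<in> \<A>" shows "c \<odot>\<^bsub>QA\<^esub> (\<J> +>\<^bsub>FA\<^esub> f) = \<J> +>\<^bsub>FA\<^esub> (\<lambda>z\<in>Z. c * f z)"
proof (intro subset_antisym subsetI)
  fix h assume "h \<in> c \<odot>\<^bsub>QA\<^esub> (\<J> +>\<^bsub>FA\<^esub> f)"
  then obtain i j where ij: "i \<in> \<J>" "j \<in> \<J>" and h: "h = (\<lambda>z\<in>Z. i z + (\<lambda>z\<in>Z. c * (\<lambda>z\<in>Z. j z + f z) z) z)"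
    unfolding QA_simps set_add_def' coset_eq FA_simps by blast
  have "(\<lambda>z\<in>Z. j z * (\<lambda>z\<in>Z. c) z) \<in> \<J>" by (intro J_mult linfty_const ij)
  then have "(\<lambda>z\<in>Z. i z + (\<lambda>z\<in>Z. j z * (\<lambda>z\<in>Z. c) z) z) \<in> \<J>" by (intro J_add ij)
  moreover have "h = (\<lambda>z\<in>Z. (\<lambda>z\<in>Z. i z + (\<lambda>z\<in>Z. j z * (\<lambda>z\<in>Z. c) z) z) z + (\<lambda>z\<in>Z. c * f z) z)"
    unfolding h by (rule restrict_ext) (simp add: algebra_simps)
  ultimately show "h \<in> \<J> +>\<^bsub>FA\<^esub> (\<lambda>z\<in>Z. c * f z)" unfolding coset_eq by blast
next
  fix h assume "h \<in> \<J> +>\<^bsub>FA\<^esub> (\<lambda>z\<in>Z. c * f z)"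
  then obtain i where i: "i \<in> \<J>" and h: "h = (\<lambda>z\<in>Z. i z + (\<lambda>z\<in>Z. c * f z) z)"
    unfolding coset_eq by blast
  have "h = (\<lambda>z\<in>Z. i z + (\<lambda>z\<in>Z. c * (\<lambda>z\<in>Z. (\<lambda>z\<in>Z. 0) z + f z) z) z)"
    unfolding h by (rule restrict_ext) simp
  with i J_zero show "h \<in> c \<odot>\<^bsub>QA\<^esub> (\<J> +>\<^bsub>FA\<^esub> f)"
    unfolding QA_simps set_add_def' coset_eq FA_simps by blast
qed

text \<open>Composing with the quotient map allows all estimates to be made on functions in place of
  cosets.\<close>

definition pullback where "pullback \<phi> = (\<lambda>f\<in>\<A>. \<phi> (\<J> +>\<^bsub>FA\<^esub> f))"

lemma pullback_character:
  assumes \<phi>: "\<phi> \<in> characters QA" shows "pullback \<phi> \<in> characters FA"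
proof -
  interpret ideal \<J> FA by (rule ideal_J)
  have "\<phi> (\<J> +>\<^bsub>FA\<^esub> (f \<oplus>\<^bsub>FA\<^esub> g)) = \<phi> (\<J> +>\<^bsub>FA\<^esub> f) + \<phi> (\<J> +>\<^bsub>FA\<^esub> g)"
    "\<phi> (\<J> +>\<^bsub>FA\<^esub> (f \<otimes>\<^bsub>FA\<^esub> g)) = \<phi> (\<J> +>\<^bsub>FA\<^esub> f) * \<phi> (\<J> +>\<^bsub>FA\<^esub> g)"
    "\<phi> (\<J> +>\<^bsub>FA\<^esub> (c \<odot>\<^bsub>FA\<^esub> f)) = c * \<phi> (\<J> +>\<^bsub>FA\<^esub> f)"
    if "f \<in> \<A>" "g \<in> \<A>" for f g c
  proof -
    have *: "\<phi> (C \<oplus>\<^bsub>QA\<^esub> C') = \<phi> C + \<phi> C'" "\<phi> (C \<otimes>\<^bsub>QA\<^esub> C') = \<phi> C * \<phi> C'" "\<phi> (c \<odot>\<^bsub>QA\<^esub> C) = c * \<phi> C"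
      if "C \<in> carrier QA" "C' \<in> carrier QA" for C C' c
      using \<phi> that unfolding characters_def by auto
    note ** = *[OF that[THEN coset_in_carrier]]
    show "\<phi> (\<J> +>\<^bsub>FA\<^esub> (f \<oplus>\<^bsub>FA\<^esub> g)) = \<phi> (\<J> +>\<^bsub>FA\<^esub> f) + \<phi> (\<J> +>\<^bsub>FA\<^esub> g)"
      using **(1) a_rcos_sum[of f g] that by (simp add: QA_simps FA_simps)
    show "\<phi> (\<J> +>\<^bsub>FA\<^esub> (f \<otimes>\<^bsub>FA\<^esub> g)) = \<phi> (\<J> +>\<^bsub>FA\<^esub> f) * \<phi> (\<J> +>\<^bsub>FA\<^esub> g)"
      using **(2) rcoset_mult_add[of f g] that by (simp add: QA_simps FA_simps)
    show "\<phi> (\<J> +>\<^bsub>FA\<^esub> (c \<odot>\<^bsub>FA\<^esub> f)) = c * \<phi> (\<J> +>\<^bsub>FA\<^esub> f)"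
      using **(3) smult_coset[OF that(1)] by (simp add: FA_simps)
  qed
  moreover have "\<phi> (\<J> +>\<^bsub>FA\<^esub> \<one>\<^bsub>FA\<^esub>) = 1"
    using \<phi> by (simp add: characters_def QA_simps)
  ultimately show ?thesis
    unfolding characters_def pullback_def
    by (auto simp: FA_simps add_mem mult_mem smult_mem const_mem)
qed

lemma pullback_vanish:
  assumes \<phi>: "\<phi> \<in> characters QA" and j: "j \<in> \<J>" shows "pullback \<phi> j = 0"
proof -
  interpret ideal \<J> FA by (rule ideal_J)
  have "\<J> +>\<^bsub>FA\<^esub> j = \<J> +>\<^bsub>FA\<^esub> (\<lambda>z\<in>Z. 0)"
    using a_rcos_zero[OF ideal_J j] a_rcos_zero[OF ideal_J J_zero] by simp
  then have "pullback \<phi> j = pullback \<phi> (\<lambda>z\<in>Z. 0)"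
    using j J_zero J_subset by (auto simp: pullback_def)
  also have "\<dots> = 0" by (rule char_const[OF pullback_character[OF \<phi>]])
  finally show ?thesis .
qed

end

section \<open>Finitely supported probability measures\<close>

lemma finite_sum_le_l1_dist: "finite B \<Longrightarrow> (\<Sum>k\<in>B. \<bar>pmf p k - pmf q k\<bar>) \<le> l1_dist p q"
  unfolding l1_dist_def by (intro finite_sum_le_infsum l1_dist_summable) auto

lemma l1_dist_eq_sum:
  assumes "finite B" "set_pmf p \<subseteq> B" "set_pmf q \<subseteq> B"
  shows "l1_dist p q = (\<Sum>k\<in>B. \<bar>pmf p k - pmf q k\<bar>)"
proof -
  have "l1_dist p q = (\<Sum>\<^sub>\<infinity>k\<in>B. \<bar>pmf p k - pmf q k\<bar>)"
    unfolding l1_dist_def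
  proof (rule infsum_cong_neutral)
    fix k assume "k \<in> UNIV - B"
    then have "pmf p k = 0" "pmf q k = 0" using assms by (auto simp: pmf_eq_0_set_pmf)
    then show "\<bar>pmf p k - pmf q k\<bar> = 0" by simp
  qed auto
  then show ?thesis using assms(1) by simp
qed

lemma finite_support_embed_pmf:
  fixes f :: "'a \<Rightarrow> real"
  assumes "finite E" "\<And>k. 0 \<le> f k" "\<And>k. k \<notin> E \<Longrightarrow> f k = 0" "(\<Sum>k\<in>E. f k) = 1"
  shows "pmf (embed_pmf f) k = f k" "set_pmf (embed_pmf f) \<subseteq> E"
proof -
  have "(\<integral>\<^sup>+x. ennreal (f x) \<partial>count_space UNIV) = (\<Sum>x\<in>E. ennreal (f x))"
    using assms by (intro nn_integral_count_space') auto
  also have "\<dots> = 1" using assms by (simp add: sum_ennreal)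
  finally have 1: "(\<integral>\<^sup>+x. ennreal (f x) \<partial>count_space UNIV) = 1" .
  show "pmf (embed_pmf f) k = f k" by (rule pmf_embed_pmf[OF assms(2) 1])
  show "set_pmf (embed_pmf f) \<subseteq> E"
    using assms(3) by (auto simp: set_embed_pmf[OF assms(2) 1])
qed

lemma pmf_map_translate:
  fixes H :: "('h, 'm) monoid_scheme"
  assumes "group H" "h \<in> carrier H" "set_pmf p \<subseteq> carrier H" "k \<in> carrier H"
  shows "pmf (map_pmf (\<lambda>k. h \<otimes>\<^bsub>H\<^esub> k) p) k = pmf p (inv\<^bsub>H\<^esub> h \<otimes>\<^bsub>H\<^esub> k)"
proof -
  interpret group H by fact
  have k: "k = h \<otimes>\<^bsub>H\<^esub> (inv\<^bsub>H\<^esub> h \<otimes>\<^bsub>H\<^esub> k)" using assms by (simp add: m_assoc[symmetric])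
  show ?thesis
  proof (cases "inv\<^bsub>H\<^esub> h \<otimes>\<^bsub>H\<^esub> k \<in> set_pmf p")
    case True
    have "inj_on (\<lambda>k. h \<otimes>\<^bsub>H\<^esub> k) (set_pmf p)"
      using inj_on_cmult[OF assms(2)] assms(3) by (rule inj_on_subset)
    from pmf_map_inj[OF this True] show ?thesis using k by simp
  next
    case False
    have "k \<notin> (\<lambda>k. h \<otimes>\<^bsub>H\<^esub> k) ` set_pmf p"
    proof
      assume "k \<in> (\<lambda>k. h \<otimes>\<^bsub>H\<^esub> k) ` set_pmf p"
      then obtain l where "l \<in> set_pmf p" "k = h \<otimes>\<^bsub>H\<^esub> l" by auto
      moreover then have "inv\<^bsub>H\<^esub> h \<otimes>\<^bsub>H\<^esub> k = l" using assms by (auto simp: m_assoc[symmetric])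
      ultimately show False using False by simp
    qed
    then show ?thesis using False by (simp add: pmf_eq_0_set_pmf pmf_map_outside)
  qed
qed

lemma topspace_Prob: "topspace (Prob_topology G) = Prob G"
  by (simp add: Prob_topology_def Metric_space.topspace_mtopology[OF Metric_space_Prob])

text \<open>The mass of a finite set is 1-Lipschitz for the norm distance, so the excess over
  \<open>c\<close> serves as a radius.\<close>

lemma openin_Prob_mass:
  assumes "finite E"
  shows "openin (Prob_topology G) {p \<in> Prob G. (\<Sum>k\<in>E. pmf p k) > c}"
proof -
  interpret Metric_space "Prob G" l1_dist by (rule Metric_space_Prob)
  show ?thesis
    unfolding Prob_topology_def openin_mtopology
  proof (intro conjI allI impI)
    fix p assume p: "p \<in> {p \<in> Prob G. (\<Sum>k\<in>E. pmf p k) > c}"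
    let ?r = "(\<Sum>k\<in>E. pmf p k) - c"
    have "(\<Sum>k\<in>E. pmf q k) > c" if "l1_dist p q < ?r" for q
    proof -
      have "(\<Sum>k\<in>E. pmf p k) - (\<Sum>k\<in>E. pmf q k) \<le> (\<Sum>k\<in>E. \<bar>pmf p k - pmf q k\<bar>)"
        unfolding sum_subtractf[symmetric] by (intro sum_mono) auto
      also have "\<dots> \<le> l1_dist p q" by (rule finite_sum_le_l1_dist[OF assms])
      finally show ?thesis using that by simp
    qed
    then have "mball p ?r \<subseteq> {p \<in> Prob G. (\<Sum>k\<in>E. pmf p k) > c}" by auto
    moreover have "?r > 0" using p by auto
    ultimately show "\<exists>r>0. mball p r \<subseteq> {p \<in> Prob G. (\<Sum>k\<in>E. pmf p k) > c}" by blast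
  qed auto
qed

lemma sum_pmf_le_1: "finite B \<Longrightarrow> (\<Sum>k\<in>B. pmf p k) \<le> 1"
  by (metis measure_measure_pmf_finite measure_pmf.prob_le_1)

lemma pmf_finite_mass:
  assumes "c < 1" obtains E where "finite E" "E \<subseteq> set_pmf p" "(\<Sum>k\<in>E. pmf p k) > c"
proof -
  have s: "pmf p summable_on UNIV"
    using abs_summable_equivalent[of "pmf p" UNIV] pmf_abs_summable[of p UNIV]
      abs_summable_summable by blast
  have "infsum (pmf p) UNIV = 1"
    using infsetsum_infsum[OF pmf_abs_summable[of p UNIV]] infsetsum_pmf_eq_1[of p UNIV] by simp
  then have "(pmf p has_sum 1) UNIV" using s by (metis has_sum_infsum)
  then have "eventually (\<lambda>F. sum (pmf p) F > c) (finite_subsets_at_top UNIV)"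
    using assms by (auto simp: has_sum_def intro: order_tendstoD)
  then obtain F where F: "finite F" "sum (pmf p) F > c"
    by (auto simp: eventually_finite_subsets_at_top)
  have "sum (pmf p) (F \<inter> set_pmf p) = sum (pmf p) F"
    by (rule sum.mono_neutral_left) (use F in \<open>auto simp: pmf_eq_0_set_pmf\<close>)
  then show ?thesis using F by (intro that[of "F \<inter> set_pmf p"]) auto
qed

text \<open>Each single measure has mass above \<open>c\<close> on some finite set, and this
  persists on a neighbourhood. The union of the finite sets belonging to a finite subcover serves
  all points at once.\<close>

lemma compact_tight:
  assumes Y: "compact_space Y" and m: "continuous_map Y (Prob_topology G) m" and "c < 1"
  obtains E where "finite E" "E \<subseteq> carrier G" "\<And>y. y \<in> topspace Y \<Longrightarrow> (\<Sum>k\<in>E. pmf (m y) k) > c"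
proof -
  interpret Metric_space "Prob G" l1_dist by (rule Metric_space_Prob)
  let ?U = "\<lambda>E. {y \<in> topspace Y. m y \<in> {p \<in> Prob G. (\<Sum>k\<in>E. pmf p k) > c}}"
  define \<F> where "\<F> = {E. finite E \<and> E \<subseteq> carrier G}"
  have mP: "m y \<in> Prob G" if "y \<in> topspace Y" for y
    using continuous_map_funspace[OF m] that by (auto simp: topspace_Prob)
  have op: "openin Y (?U E)" if "E \<in> \<F>" for E
    using that by (intro openin_continuous_map_preimage[OF m] openin_Prob_mass) (auto simp: \<F>_def)
  have cover: "topspace Y \<subseteq> \<Union>(?U ` \<F>)"
  proof
    fix y assume y: "y \<in> topspace Y"
    obtain E where "finite E" "E \<subseteq> set_pmf (m y)" "(\<Sum>k\<in>E. pmf (m y) k) > c"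
      using pmf_finite_mass[OF \<open>c < 1\<close>] by blast
    moreover have "set_pmf (m y) \<subseteq> carrier G" using mP[OF y] by (simp add: Prob_def)
    ultimately show "y \<in> \<Union>(?U ` \<F>)" using mP[OF y] y by (auto simp: \<F>_def)
  qed
  obtain \<D> where \<D>: "finite \<D>" "\<D> \<subseteq> ?U ` \<F>" "topspace Y \<subseteq> \<Union>\<D>"
    using Y cover op unfolding compact_space_alt by (metis (no_types, lifting) imageE)
  then obtain \<E> where \<E>: "finite \<E>" "\<E> \<subseteq> \<F>" "\<D> = ?U ` \<E>" by (meson finite_subset_image)
  show ?thesis
  proof (rule that[of "\<Union>\<E>"])
    show fin: "finite (\<Union>\<E>)" "\<Union>\<E> \<subseteq> carrier G" using \<E> by (auto simp: \<F>_def)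
    fix y assume "y \<in> topspace Y"
    then obtain E where E: "E \<in> \<E>" "(\<Sum>k\<in>E. pmf (m y) k) > c" using \<D> \<E> by auto
    have "(\<Sum>k\<in>E. pmf (m y) k) \<le> (\<Sum>k\<in>\<Union>\<E>. pmf (m y) k)"
      using E fin by (intro sum_mono2) auto
    then show "(\<Sum>k\<in>\<Union>\<E>. pmf (m y) k) > c" using E by simp
  qed
qed

text \<open>Real coordinates are kept in place of values of type \<open>pmf\<close>, since each
  coordinate has to become an element of the function algebra. The common finite support keeps all
  sums over coordinates finite.\<close>

definition finite_prob_family :: "'z set \<Rightarrow> 'h set \<Rightarrow> ('z \<Rightarrow> 'h \<Rightarrow> real) \<Rightarrow> bool" where
  "finite_prob_family Z E f \<longleftrightarrow> finite E \<and>
     (\<forall>z\<in>Z. (\<forall>k. 0 \<le> f z k) \<and> (\<forall>k. k \<notin> E \<longrightarrow> f z k = 0) \<and> (\<Sum>k\<in>E. f z k) = 1)"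

lemma finite_prob_familyD:
  assumes "finite_prob_family Z E f"
  shows "finite E" "z \<in> Z \<Longrightarrow> 0 \<le> f z k" "z \<in> Z \<Longrightarrow> k \<notin> E \<Longrightarrow> f z k = 0"
    "z \<in> Z \<Longrightarrow> (\<Sum>k\<in>E. f z k) = 1"
  using assms by (auto simp: finite_prob_family_def)

lemma finite_prob_family_sum_le:
  assumes "finite_prob_family Z E f" "z \<in> Z" "finite B" shows "(\<Sum>k\<in>B. f z k) \<le> 1"
proof -
  note D = finite_prob_familyD[OF assms(1)]
  have "(\<Sum>k\<in>B. f z k) \<le> (\<Sum>k\<in>B \<union> E. f z k)" using assms D by (intro sum_mono2) auto
  also have "\<dots> = (\<Sum>k\<in>E. f z k)" using assms D by (intro sum.mono_neutral_right) auto
  finally show ?thesis using D(4) assms by simp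
qed

lemma finite_prob_family_le_1:
  "finite_prob_family Z E f \<Longrightarrow> z \<in> Z \<Longrightarrow> f z k \<le> 1"
  using finite_prob_family_sum_le[of Z E f z "{k}"] by simp

section \<open>Amenability of actions on boundary algebras\<close>

lemma closedin_zero_set:
  assumes "\<And>c. c \<in> C \<Longrightarrow> continuous_map X euclidean c"
  shows "closedin X {x \<in> topspace X. \<forall>c\<in>C. c x = (0::complex)}"
proof (cases "C = {}")
  case False
  have "closedin X {x \<in> topspace X. c x \<in> {0}}" if "c \<in> C" for c
    by (rule closedin_continuous_map_preimage[OF assms[OF that]]) simp
  then have "closedin X (\<Inter>c\<in>C. {x \<in> topspace X. c x \<in> {0}})" using False by (intro closedin_INT) auto
  also have "(\<Inter>c\<in>C. {x \<in> topspace X. c x \<in> {0}}) = {x \<in> topspace X. \<forall>c\<in>C. c x = 0}"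
    using False by auto
  finally show ?thesis .
qed simp

lemma topspace_spectrum: "topspace (spectrum_topology A) = characters A"
  by (auto simp: spectrum_topology_def characters_def PiE_def)

context shifts
begin

text \<open>The bound on characters places them in a product of closed discs, compact by Tychonoff,
  and the algebraic identities cut out a closed subset of it. Exactness uses this for
  \<open>linfty\<close> of the group.\<close>

lemma compact_spectrum: "compact_space (spectrum_topology FA)"
proof -
  let ?P = "product_topology (\<lambda>_. euclidean :: complex topology) \<A>"
  have "\<exists>M. \<forall>z\<in>Z. cmod (f z) \<le> M" if "f \<in> \<A>" for f
    using linfty_bound[OF mem_linfty[OF that]] by metis
  then obtain M where M: "\<And>f z. f \<in> \<A> \<Longrightarrow> z \<in> Z \<Longrightarrow> cmod (f z) \<le> M f" by metis
  let ?K = "PiE \<A> (\<lambda>f. cball 0 (M f)) :: (('z \<Rightarrow> complex) \<Rightarrow> complex) set"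
  have K: "compactin ?P ?K" by (simp add: compactin_PiE)
  have sub: "characters FA \<subseteq> ?K"
  proof
    fix \<psi> assume \<psi>: "\<psi> \<in> characters FA"
    have "\<psi> \<in> extensional \<A>" using \<psi> by (simp add: characters_def FA_simps)
    moreover have "cmod (\<psi> f) \<le> M f" if "f \<in> \<A>" for f using char_bound[OF \<psi> that M[OF that]] .
    ultimately show "\<psi> \<in> ?K" by (auto simp: PiE_iff)
  qed
  \<comment> \<open>Every identity required of a character is written as a continuous function of it
    that has to vanish.\<close>
  define C where "C = {\<lambda>\<phi>. \<phi> (\<lambda>z\<in>Z. 1) - 1}
      \<union> (\<Union>f\<in>\<A>. \<Union>g\<in>\<A>. {\<lambda>\<phi>. \<phi> (\<lambda>z\<in>Z. f z + g z) - (\<phi> f + \<phi> g), \<lambda>\<phi>. \<phi> (\<lambda>z\<in>Z. f z * g z) - \<phi> f * \<phi> g})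
      \<union> (\<Union>f\<in>\<A>. range (\<lambda>c \<phi>. \<phi> (\<lambda>z\<in>Z. c * f z) - c * (\<phi> f :: complex)))"
  have "continuous_map ?P euclidean c" if "c \<in> C" for c
  proof -
    have pr: "continuous_map ?P euclidean (\<lambda>\<phi>. \<phi> f)" if "f \<in> \<A>" for f
      using that by (rule continuous_map_product_projection)
    have mul: "continuous_map ?P euclidean (\<lambda>\<phi>. u \<phi> * v \<phi>)"
      if "continuous_map ?P euclidean u" "continuous_map ?P euclidean v" for u v :: "_ \<Rightarrow> complex"
      using that by (simp add: continuous_map_atin tendsto_mult)
    show ?thesis using that unfolding C_def
      by (auto intro!: continuous_map_diff continuous_map_add mul pr add_mem mult_mem smult_mem const_mem)
  qed
  then have "closedin ?P {\<phi> \<in> topspace ?P. \<forall>c\<in>C. c \<phi> = 0}" by (rule closedin_zero_set)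
  also have "{\<phi> \<in> topspace ?P. \<forall>c\<in>C. c \<phi> = 0} = characters FA"
    unfolding C_def characters_def by (auto simp: FA_simps PiE_iff ball_Un)
  finally have "compactin ?P (characters FA)" by (rule closed_compactin[OF K sub])
  then show ?thesis
    unfolding spectrum_topology_def FA_simps by (rule compact_space_subtopology)
qed

text \<open>Maps from \<open>Z\<close> to probability measures on a fixed finite set extend to the spectrum by
  evaluating characters at the coordinates.\<close>

definition coord where "coord f k = (\<lambda>z\<in>Z. complex_of_real (f z k))"

definition spectral_pmf where "spectral_pmf \<psi> f = embed_pmf (\<lambda>k. Re (\<psi> (coord f k)))"

text \<open>Coordinates take values in the closed half-plane of nonnegative real part, so characters
  map them there. The masses add up to 1 because the coordinates sum to the constant function
  1.\<close>

lemma spectral_pmf: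
  assumes f: "finite_prob_family Z E f" and mem: "\<And>k. coord f k \<in> \<A>" and \<psi>: "\<psi> \<in> characters FA"
  shows "pmf (spectral_pmf \<psi> f) k = Re (\<psi> (coord f k))" "set_pmf (spectral_pmf \<psi> f) \<subseteq> E"
proof -
  note D = finite_prob_familyD[OF f]
  have nn: "0 \<le> Re (\<psi> (coord f k))" for k
  proof -
    have "\<psi> (coord f k) \<in> {w. 0 \<le> Re w}"
      by (rule char_in_closed[OF \<psi> mem closed_halfspace_Re_ge]) (simp add: coord_def D)
    then show ?thesis by simp
  qed
  have off: "Re (\<psi> (coord f k)) = 0" if "k \<notin> E" for k
  proof -
    have "coord f k = (\<lambda>z\<in>Z. 0)" unfolding coord_def by (rule restrict_ext) (simp add: D that)
    then show ?thesis using char_const[OF \<psi>, of 0] by simp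
  qed
  have "(\<Sum>k\<in>E. \<psi> (coord f k)) = \<psi> (\<lambda>z\<in>Z. \<Sum>k\<in>E. coord f k z)"
    by (rule char_sum[OF \<psi> D(1) mem, symmetric])
  also have "(\<lambda>z\<in>Z. \<Sum>k\<in>E. coord f k z) = (\<lambda>z\<in>Z. 1)"
    by (rule restrict_ext) (simp add: coord_def D of_real_sum[symmetric])
  finally have "(\<Sum>k\<in>E. Re (\<psi> (coord f k))) = 1" using charD(1)[OF \<psi>] by (metis Re_sum one_complex.sel(1))
  with D(1) nn off show "pmf (spectral_pmf \<psi> f) k = Re (\<psi> (coord f k))" "set_pmf (spectral_pmf \<psi> f) \<subseteq> E"
    unfolding spectral_pmf_def by (rule finite_support_embed_pmf; blast)+
qed

text \<open>All the measures live on \<open>E\<close>, so their norm distance is a finite sum of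
  evaluations and hence continuous for pointwise convergence of characters.\<close>

lemma continuous_spectral_pmf:
  assumes f: "finite_prob_family Z E f" and mem: "\<And>k. coord f k \<in> \<A>" and E: "E \<subseteq> carrier H"
  shows "continuous_map (spectrum_topology QA) (Prob_topology H) (\<lambda>\<phi>. spectral_pmf (pullback \<phi>) f)"
proof -
  interpret Metric_space "Prob H" l1_dist by (rule Metric_space_Prob)
  note D = finite_prob_familyD[OF f]
  note S = spectral_pmf[OF f mem pullback_character]
  let ?Y = "spectrum_topology QA"
  show ?thesis
    unfolding Prob_topology_def continuous_map_to_metric topspace_spectrum
  proof (intro ballI allI impI)
    fix \<phi> and \<epsilon> :: real assume \<phi>: "\<phi> \<in> characters QA" and "\<epsilon> > 0"
    let ?d = "\<lambda>\<phi>'. \<Sum>k\<in>E. \<bar>Re (\<phi> (\<J> +>\<^bsub>FA\<^esub> coord f k)) - Re (\<phi>' (\<J> +>\<^bsub>FA\<^esub> coord f k))\<bar>"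
    have dist: "l1_dist (spectral_pmf (pullback \<phi>) f) (spectral_pmf (pullback \<phi>') f) = ?d \<phi>'"
      if "\<phi>' \<in> characters QA" for \<phi>'
      using l1_dist_eq_sum[OF D(1) S(2)[OF \<phi>] S(2)[OF that]] S(1)[OF \<phi>] S(1)[OF that] mem
      by (simp add: pullback_def)
    have pr: "continuous_map ?Y euclidean (\<lambda>\<phi>. \<phi> (\<J> +>\<^bsub>FA\<^esub> coord f k))" for k
      unfolding spectrum_topology_def
      by (intro continuous_map_from_subtopology continuous_map_product_projection
          coset_in_carrier mem)
    have re: "continuous_map ?Y euclideanreal (\<lambda>\<phi>. Re (\<phi> (\<J> +>\<^bsub>FA\<^esub> coord f k)))" for k
      using pr[of k] by (simp add: continuous_map_atin tendsto_Re)
    have "continuous_map ?Y euclideanreal ?d"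
      using D(1) by (intro continuous_intros re) auto
    then have "openin ?Y {\<phi>' \<in> topspace ?Y. ?d \<phi>' \<in> {..<\<epsilon>}}"
      by (rule openin_continuous_map_preimage) simp
    moreover have "\<phi> \<in> {\<phi>' \<in> topspace ?Y. ?d \<phi>' \<in> {..<\<epsilon>}}"
      using \<phi> \<open>\<epsilon> > 0\<close> by (simp add: topspace_spectrum)
    moreover have "spectral_pmf (pullback \<phi>') f \<in> Prob H" if "\<phi>' \<in> characters QA" for \<phi>'
      using S(2)[OF that] E by (auto simp: Prob_def)
    then have "\<forall>\<phi>'\<in>{\<phi>' \<in> topspace ?Y. ?d \<phi>' \<in> {..<\<epsilon>}}.
        spectral_pmf (pullback \<phi>') f \<in> mball (spectral_pmf (pullback \<phi>) f) \<epsilon>"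
      using \<phi> by (auto simp: topspace_spectrum dist)
    ultimately show "\<exists>U. openin ?Y U \<and> \<phi> \<in> U \<and>
        (\<forall>\<phi>'\<in>U. spectral_pmf (pullback \<phi>') f \<in> mball (spectral_pmf (pullback \<phi>) f) \<epsilon>)"
      by blast
  qed
qed

end

section \<open>A criterion for amenability of the action on the quotient algebra\<close>

locale shifts_action = shifts Z \<G> \<T> + H: group H
  for Z :: "'z set" and \<G> \<T> and H :: "('h, 'm) monoid_scheme" +
  fixes \<tau> :: "'h \<Rightarrow> 'z \<Rightarrow> 'z"
  assumes act_closed: "h \<in> carrier H \<Longrightarrow> z \<in> Z \<Longrightarrow> \<tau> h z \<in> Z"
    and act_inv: "h \<in> carrier H \<Longrightarrow> z \<in> Z \<Longrightarrow> \<tau> (inv\<^bsub>H\<^esub> h) (\<tau> h z) = z"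
    and act_small: "h \<in> carrier H \<Longrightarrow> small_rel \<G> A \<Longrightarrow> small_rel \<G> {z \<in> Z. \<tau> h z \<in> A}"
    and act_shift: "h \<in> carrier H \<Longrightarrow> T \<in> \<T> \<Longrightarrow> \<exists>T'\<in>\<T>. \<forall>z\<in>Z. \<tau> h (T z) = T' (\<tau> h z)"
begin

lemma act_mem:
  assumes f: "f \<in> \<A>" and h: "h \<in> carrier H" shows "(\<lambda>z\<in>Z. f (\<tau> h z)) \<in> \<A>"
  by (rule comp_mem[OF f act_closed[OF h] act_small[OF h] act_shift[OF h]])

lemma act_J:
  assumes f: "f \<in> \<J>" and h: "h \<in> carrier H" shows "(\<lambda>z\<in>Z. f (\<tau> h z)) \<in> \<J>"
proof -
  have v: "vanishing f" and l: "f \<in> linfty Z" using f by (auto simp: c0_iff)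
  have "vanishing (\<lambda>z. f (\<tau> h z))" by (rule vanishing_comp[OF v act_closed[OF h] act_small[OF h]])
  then have "vanishing (\<lambda>z\<in>Z. f (\<tau> h z))"
    by (rule vanishing_cong[THEN iffD1, rotated]) simp
  then show ?thesis using linfty_comp[OF l act_closed[OF h]] by (simp add: c0_iff)
qed

lemma act_coset:
  assumes f: "f \<in> \<A>" and h: "h \<in> carrier H"
  shows "(\<lambda>f. \<lambda>z\<in>Z. f (\<tau> h z)) ` (\<J> +>\<^bsub>FA\<^esub> f) = \<J> +>\<^bsub>FA\<^esub> (\<lambda>z\<in>Z. f (\<tau> h z))"
proof (intro subset_antisym subsetI)
  fix g assume "g \<in> (\<lambda>f. \<lambda>z\<in>Z. f (\<tau> h z)) ` (\<J> +>\<^bsub>FA\<^esub> f)"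
  then obtain j where j: "j \<in> \<J>" and g: "g = (\<lambda>z\<in>Z. (\<lambda>z\<in>Z. j z + f z) (\<tau> h z))"
    unfolding coset_eq by blast
  have "g = (\<lambda>z\<in>Z. (\<lambda>z\<in>Z. j (\<tau> h z)) z + (\<lambda>z\<in>Z. f (\<tau> h z)) z)"
    unfolding g by (rule restrict_ext) (simp add: act_closed[OF h])
  then show "g \<in> \<J> +>\<^bsub>FA\<^esub> (\<lambda>z\<in>Z. f (\<tau> h z))" using act_J[OF j h] unfolding coset_eq by blast
next
  fix g assume "g \<in> \<J> +>\<^bsub>FA\<^esub> (\<lambda>z\<in>Z. f (\<tau> h z))"
  then obtain j where j: "j \<in> \<J>" and g: "g = (\<lambda>z\<in>Z. j z + (\<lambda>z\<in>Z. f (\<tau> h z)) z)"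
    unfolding coset_eq by blast
  have h': "inv\<^bsub>H\<^esub> h \<in> carrier H" using h by simp
  have "g = (\<lambda>z\<in>Z. (\<lambda>z\<in>Z. (\<lambda>z\<in>Z. j (\<tau> (inv\<^bsub>H\<^esub> h) z)) z + f z) (\<tau> h z))"
    unfolding g by (rule restrict_ext) (simp add: act_closed[OF h] act_inv[OF h])
  then show "g \<in> (\<lambda>f. \<lambda>z\<in>Z. f (\<tau> h z)) ` (\<J> +>\<^bsub>FA\<^esub> f)"
    using act_J[OF j h'] unfolding coset_eq by blast
qed

text \<open>The inequality says that the measure at \<open>h z\<close> is close to the translate by
  \<open>h\<close> of the measure at \<open>z\<close>. It is asked only off a small set, invisible
  to characters of the quotient, and for every finite \<open>B\<close>, since the set needed later
  depends on \<open>h\<close>.\<close>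

definition approx_equivariant :: "'h set \<Rightarrow> real \<Rightarrow> 'h set \<Rightarrow> ('z \<Rightarrow> 'h \<Rightarrow> real) \<Rightarrow> bool" where
  "approx_equivariant D \<epsilon> E f \<longleftrightarrow> finite_prob_family Z E f \<and> E \<subseteq> carrier H \<and> (\<forall>k. coord f k \<in> \<A>) \<and>
     (\<forall>h\<in>D. \<forall>B. finite B \<longrightarrow> B \<subseteq> carrier H \<longrightarrow>
        small_rel \<G> {z \<in> Z. (\<Sum>k\<in>B. \<bar>f (\<tau> h z) k - f z (inv\<^bsub>H\<^esub> h \<otimes>\<^bsub>H\<^esub> k)\<bar>) > \<epsilon>})"

lemma spectral_map:
  assumes act: "\<And>h C. h \<in> carrier H \<Longrightarrow> act h C = (\<lambda>f. \<lambda>z\<in>Z. f (\<tau> (inv\<^bsub>H\<^esub> h) z)) ` C"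
    and D: "D \<subseteq> carrier H" and \<epsilon>: "\<epsilon> \<ge> 0" and f: "approx_equivariant D \<epsilon> E f"
  shows "continuous_map (spectrum_topology QA) (Prob_topology H) (\<lambda>\<phi>. spectral_pmf (pullback \<phi>) f)"
    and "\<And>h \<phi>. h \<in> D \<Longrightarrow> \<phi> \<in> characters QA \<Longrightarrow>
      l1_dist (map_pmf (\<lambda>k. h \<otimes>\<^bsub>H\<^esub> k) (spectral_pmf (pullback \<phi>) f))
        (spectral_pmf (pullback (dual_action H QA act h \<phi>)) f) \<le> \<epsilon>"
proof -
  have fam: "finite_prob_family Z E f" and E: "E \<subseteq> carrier H" and mem: "\<And>k. coord f k \<in> \<A>"
    and eq: "\<And>h B. h \<in> D \<Longrightarrow> finite B \<Longrightarrow> B \<subseteq> carrier H \<Longrightarrow>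
        small_rel \<G> {z \<in> Z. (\<Sum>k\<in>B. \<bar>f (\<tau> h z) k - f z (inv\<^bsub>H\<^esub> h \<otimes>\<^bsub>H\<^esub> k)\<bar>) > \<epsilon>}"
    using f by (auto simp: approx_equivariant_def)
  note F = finite_prob_familyD[OF fam]
  show "continuous_map (spectrum_topology QA) (Prob_topology H) (\<lambda>\<phi>. spectral_pmf (pullback \<phi>) f)"
    by (rule continuous_spectral_pmf[OF fam mem E])
  fix h \<phi> assume hD: "h \<in> D" and \<phi>: "\<phi> \<in> characters QA"
  have h: "h \<in> carrier H" using hD D by auto
  define \<psi> where "\<psi> = pullback \<phi>"
  have \<psi>: "\<psi> \<in> characters FA" unfolding \<psi>_def by (rule pullback_character[OF \<phi>])
  define f' where "f' z k = f (\<tau> h z) k" for z k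
  have fam': "finite_prob_family Z E f'"
    using F act_closed[OF h] by (simp add: finite_prob_family_def f'_def)
  have coord': "coord f' k = (\<lambda>z\<in>Z. coord f k (\<tau> h z))" for k
    unfolding coord_def f'_def by (rule restrict_ext) (simp add: act_closed[OF h])
  have mem': "coord f' k \<in> \<A>" for k unfolding coord' by (rule act_mem[OF mem h])
  \<comment> \<open>The inverse in \<open>dual_action\<close> cancels the one in the assumption on
    \<open>act\<close>: moving the character by \<open>h\<close> amounts to composing the
    coordinates with \<open>\<tau> h\<close>.\<close>
  have "pullback (dual_action H QA act h \<phi>) (coord f k) = \<psi> (coord f' k)" for k
    using mem[of k] mem'[of k] coset_in_carrier[OF mem[of k]] act[of "inv\<^bsub>H\<^esub> h"] h act_coset[OF mem h, of k]
    by (simp add: pullback_def dual_action_def \<psi>_def coord')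
  then have dual: "spectral_pmf (pullback (dual_action H QA act h \<phi>)) f = spectral_pmf \<psi> f'"
    by (simp add: spectral_pmf_def)
  note S = spectral_pmf[OF fam mem \<psi>] and S' = spectral_pmf[OF fam' mem' \<psi>]
  \<comment> \<open>This set contains the supports of both measures that are compared.\<close>
  define B where "B = E \<union> (\<lambda>k. h \<otimes>\<^bsub>H\<^esub> k) ` E"
  have B: "finite B" "B \<subseteq> carrier H" using F(1) E h by (auto simp: B_def)
  let ?t = "\<lambda>k. inv\<^bsub>H\<^esub> h \<otimes>\<^bsub>H\<^esub> k"
  \<comment> \<open>The signs turn the sum of the absolute differences at the character into the
    value of the character at one element of the algebra. A single essential bound then applies,
    with no loss proportional to the size of \<open>B\<close>.\<close>
  define s where "s k = (if Re (\<psi> (coord f' k)) \<ge> Re (\<psi> (coord f (?t k))) then 1 else -1 :: real)" for k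
  define u where "u k = (\<lambda>z\<in>Z. of_real (s k) * (\<lambda>z\<in>Z. coord f' k z + (\<lambda>z\<in>Z. -1 * coord f (?t k) z) z) z)" for k
  have u: "u k \<in> \<A>" for k unfolding u_def by (intro smult_mem add_mem mem mem')
  have \<psi>u: "\<psi> (u k) = of_real (s k) * (\<psi> (coord f' k) - \<psi> (coord f (?t k)))" for k
  proof -
    have "\<psi> (u k) = of_real (s k) * (\<psi> (coord f' k) + -1 * \<psi> (coord f (?t k)))"
      unfolding u_def
      by (simp only: charD(2,4)[OF \<psi>] add_mem[OF mem' smult_mem[OF mem]] mem mem' smult_mem[OF mem])
    then show ?thesis by simp
  qed
  have "l1_dist (map_pmf (\<lambda>k. h \<otimes>\<^bsub>H\<^esub> k) (spectral_pmf \<psi> f)) (spectral_pmf \<psi> f')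
      = (\<Sum>k\<in>B. \<bar>pmf (map_pmf (\<lambda>k. h \<otimes>\<^bsub>H\<^esub> k) (spectral_pmf \<psi> f)) k - pmf (spectral_pmf \<psi> f') k\<bar>)"
    by (rule l1_dist_eq_sum[OF B(1)]) (use S(2) S'(2) in \<open>auto simp: B_def\<close>)
  also have "\<dots> = (\<Sum>k\<in>B. \<bar>Re (\<psi> (coord f (?t k))) - Re (\<psi> (coord f' k))\<bar>)"
    using B(2) E S S' pmf_map_translate[OF H.group_axioms h] by (intro sum.cong) auto
  also have "\<dots> = (\<Sum>k\<in>B. Re (\<psi> (u k)))"
    by (intro sum.cong refl) (auto simp: \<psi>u s_def)
  also have "\<dots> = Re (\<psi> (\<lambda>z\<in>Z. \<Sum>k\<in>B. u k z))"
    using char_sum[OF \<psi> B(1), of u] u by simp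
  also have "\<dots> \<le> cmod (\<psi> (\<lambda>z\<in>Z. \<Sum>k\<in>B. u k z))" by (rule complex_Re_le_cmod)
  also have "\<dots> \<le> \<epsilon>"
  proof (rule char_essential_bound[OF \<psi> _ sum_mem[OF B(1) u] \<epsilon>])
    show "\<psi> j = 0" if "j \<in> \<J>" for j unfolding \<psi>_def by (rule pullback_vanish[OF \<phi> that])
    show "small_rel \<G> {z \<in> Z. cmod ((\<lambda>z\<in>Z. \<Sum>k\<in>B. u k z) z) > \<epsilon>}"
    proof (rule small_mono[OF eq[OF hD B]], rule subsetI)
      fix z assume "z \<in> {z \<in> Z. cmod ((\<lambda>z\<in>Z. \<Sum>k\<in>B. u k z) z) > \<epsilon>}"
      then have z: "z \<in> Z" "cmod (\<Sum>k\<in>B. u k z) > \<epsilon>" by auto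
      have "cmod (\<Sum>k\<in>B. u k z) \<le> (\<Sum>k\<in>B. cmod (u k z))" by (rule norm_sum)
      also have "\<dots> = (\<Sum>k\<in>B. \<bar>f (\<tau> h z) k - f z (?t k)\<bar>)"
      proof (rule sum.cong)
        fix k
        have "u k z = of_real (s k * (f (\<tau> h z) k - f z (?t k)))"
          using z by (simp add: u_def coord_def f'_def)
        then show "cmod (u k z) = \<bar>f (\<tau> h z) k - f z (?t k)\<bar>"
          by (simp only: norm_of_real) (simp add: s_def abs_mult)
      qed simp
      finally show "z \<in> {z \<in> Z. (\<Sum>k\<in>B. \<bar>f (\<tau> h z) k - f z (?t k)\<bar>) > \<epsilon>}" using z by auto
    qed
  qed
  finally show "l1_dist (map_pmf (\<lambda>k. h \<otimes>\<^bsub>H\<^esub> k) (spectral_pmf (pullback \<phi>) f))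
        (spectral_pmf (pullback (dual_action H QA act h \<phi>)) f) \<le> \<epsilon>"
    unfolding dual \<psi>_def .
qed

text \<open>Countability lets a sequence play the role of the net: the finite sets
  \<open>D n\<close> exhaust the group while the error \<open>1 / Suc n\<close> tends to 0.\<close>

lemma amenable_actionI:
  assumes act: "\<And>h C. h \<in> carrier H \<Longrightarrow> act h C = (\<lambda>f. \<lambda>z\<in>Z. f (\<tau> (inv\<^bsub>H\<^esub> h) z)) ` C"
    and cnt: "countable (carrier H)"
    and approx: "\<And>D \<epsilon>. finite D \<Longrightarrow> D \<subseteq> carrier H \<Longrightarrow> \<epsilon> > 0 \<Longrightarrow> \<exists>E f. approx_equivariant D \<epsilon> E f"
  shows "amenable_action H QA act"
proof -
  define D where "D n = from_nat_into (carrier H) ` {..<n}" for n :: nat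
  have D: "finite (D n)" "D n \<subseteq> carrier H" for n
    using from_nat_into[of "carrier H"] H.one_closed by (auto simp: D_def)
  have "\<exists>E f. approx_equivariant (D n) (1 / Suc n) E f" for n
    using D by (intro approx) auto
  then obtain f where f: "\<And>n. \<exists>E. approx_equivariant (D n) (1 / Suc n) E (f n)" by metis
  let ?m = "\<lambda>n \<phi>. spectral_pmf (pullback \<phi>) (f n)"
  have m: "continuous_map (spectrum_topology QA) (Prob_topology H) (?m n)"
    "h \<in> D n \<Longrightarrow> \<phi> \<in> characters QA \<Longrightarrow>
      l1_dist (map_pmf (\<lambda>k. h \<otimes>\<^bsub>H\<^esub> k) (?m n \<phi>)) (?m n (dual_action H QA act h \<phi>)) \<le> 1 / Suc n" for n h \<phi>
  proof -
    obtain E where E: "approx_equivariant (D n) (1 / Suc n) E (f n)" using f by blast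
    show "continuous_map (spectrum_topology QA) (Prob_topology H) (?m n)"
      using spectral_map(1)[OF act D(2) _ E] by simp
    show "h \<in> D n \<Longrightarrow> \<phi> \<in> characters QA \<Longrightarrow>
      l1_dist (map_pmf (\<lambda>k. h \<otimes>\<^bsub>H\<^esub> k) (?m n \<phi>)) (?m n (dual_action H QA act h \<phi>)) \<le> 1 / Suc n"
      using spectral_map(2)[OF act D(2) _ E] by simp
  qed
  have "uniform_limit (characters QA)
      (\<lambda>m \<phi>. l1_dist (map_pmf (\<lambda>k. h \<otimes>\<^bsub>H\<^esub> k) (m \<phi>)) (m (dual_action H QA act h \<phi>))) (\<lambda>_. 0)
      (filtermap ?m sequentially)" if h: "h \<in> carrier H" for h
  proof (rule uniform_limitI)
    fix e :: real assume "e > 0"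
    then obtain N where N: "1 / Suc N < e" using nat_approx_posE by blast
    \<comment> \<open>\<open>D n\<close> holds the elements with index strictly below
      \<open>n\<close>, hence the successor.\<close>
    let ?M = "max N (Suc (to_nat_on (carrier H) h))"
    have "\<forall>\<phi>\<in>characters QA. dist (l1_dist (map_pmf (\<lambda>k. h \<otimes>\<^bsub>H\<^esub> k) (?m n \<phi>)) (?m n (dual_action H QA act h \<phi>))) 0 < e"
      if "n \<ge> ?M" for n
    proof
      fix \<phi> assume \<phi>: "\<phi> \<in> characters QA"
      have "h = from_nat_into (carrier H) (to_nat_on (carrier H) h)" using cnt h by simp
      then have "h \<in> D n" using that unfolding D_def by (intro image_eqI[of _ _ "to_nat_on (carrier H) h"]) auto
      then have "l1_dist (map_pmf (\<lambda>k. h \<otimes>\<^bsub>H\<^esub> k) (?m n \<phi>)) (?m n (dual_action H QA act h \<phi>)) \<le> 1 / Suc n"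
        using \<phi> by (rule m(2))
      also have "\<dots> \<le> 1 / Suc N" using that by (simp add: frac_le)
      finally show "dist (l1_dist (map_pmf (\<lambda>k. h \<otimes>\<^bsub>H\<^esub> k) (?m n \<phi>)) (?m n (dual_action H QA act h \<phi>))) 0 < e"
        using N by (simp add: l1_dist_def infsum_nonneg)
    qed
    then show "\<forall>\<^sub>F m in filtermap ?m sequentially. \<forall>\<phi>\<in>characters QA.
        dist (l1_dist (map_pmf (\<lambda>k. h \<otimes>\<^bsub>H\<^esub> k) (m \<phi>)) (m (dual_action H QA act h \<phi>))) 0 < e"
      unfolding eventually_filtermap eventually_sequentially by blast
  qed
  then show ?thesis
    unfolding amenable_action_def amenable_on_space_def topspace_spectrum
    using m(1) by (intro exI[of _ "filtermap ?m sequentially"]) (auto simp: filtermap_bot_iff eventually_filtermap)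
qed

end

section \<open>Exactness\<close>

text \<open>Restricting a map given by amenability at infinity to the points of the group yields
  almost equivariant measures. Tightness over the compact spectrum leaves only a little mass outside
  one finite set, and that mass can be moved.\<close>

lemma exact_group_finite_support:
  fixes G :: "('g, 'm) monoid_scheme"
  assumes "group G" and ex: "exact_group G" and D: "finite D" "D \<subseteq> carrier G" and \<epsilon>: "\<epsilon> > 0"
  obtains E p where "finite_prob_family (carrier G) E p" "E \<subseteq> carrier G"
    "\<And>h g B. h \<in> D \<Longrightarrow> g \<in> carrier G \<Longrightarrow> finite B \<Longrightarrow> B \<subseteq> carrier G \<Longrightarrow>
       (\<Sum>k\<in>B. \<bar>p (h \<otimes>\<^bsub>G\<^esub> g) k - p g (inv\<^bsub>G\<^esub> h \<otimes>\<^bsub>G\<^esub> k)\<bar>) \<le> \<epsilon>"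
proof -
  interpret G: group G by fact
  \<comment> \<open>Without shifts, and with only the empty set small, the algebra is
    \<open>linfty\<close> of the group.\<close>
  interpret shifts "carrier G" "{{}}" "{}" by unfold_locales (auto simp: small_rel_def)
  have \<A>: "\<A> = linfty (carrier G)" by (simp add: shift_algebra_def)
  let ?Y = "spectrum_topology FA"
  let ?act = "dual_action G FA (\<lambda>g. left_translate G (inv\<^bsub>G\<^esub> g))"
  have top: "topspace ?Y = characters FA" by (rule topspace_spectrum)
  obtain F where F: "F \<noteq> bot" "\<forall>\<^sub>F m in F. continuous_map ?Y (Prob_topology G) m"
    "\<And>h. h \<in> carrier G \<Longrightarrow> uniform_limit (characters FA)
       (\<lambda>m y. l1_dist (map_pmf (\<lambda>k. h \<otimes>\<^bsub>G\<^esub> k) (m y)) (m (?act h y))) (\<lambda>y. 0) F"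
    using ex unfolding exact_group_def amenable_action_def amenable_on_space_def \<A>[symmetric] top by blast
  have "\<forall>\<^sub>F m in F. \<forall>h\<in>D. \<forall>y\<in>characters FA.
      dist (l1_dist (map_pmf (\<lambda>k. h \<otimes>\<^bsub>G\<^esub> k) (m y)) (m (?act h y))) 0 < \<epsilon> / 3"
  proof (rule eventually_ball_finite[OF D(1)], rule ballI)
    fix h assume "h \<in> D"
    then show "\<forall>\<^sub>F m in F. \<forall>y\<in>characters FA.
        dist (l1_dist (map_pmf (\<lambda>k. h \<otimes>\<^bsub>G\<^esub> k) (m y)) (m (?act h y))) 0 < \<epsilon> / 3"
      using D(2) \<epsilon> by (intro uniform_limitD[OF F(3)]) auto
  qed
  with F(2) have "\<forall>\<^sub>F m in F. continuous_map ?Y (Prob_topology G) m \<and> (\<forall>h\<in>D. \<forall>y\<in>characters FA.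
      dist (l1_dist (map_pmf (\<lambda>k. h \<otimes>\<^bsub>G\<^esub> k) (m y)) (m (?act h y))) 0 < \<epsilon> / 3)"
    by (rule eventually_conj)
  from eventually_happens'[OF F(1) this] obtain m
    where m: "continuous_map ?Y (Prob_topology G) m"
      and m_dist: "\<forall>h\<in>D. \<forall>y\<in>characters FA.
        dist (l1_dist (map_pmf (\<lambda>k. h \<otimes>\<^bsub>G\<^esub> k) (m y)) (m (?act h y))) 0 < \<epsilon> / 3"
    by (elim exE conjE)
  have m_le: "l1_dist (map_pmf (\<lambda>k. h \<otimes>\<^bsub>G\<^esub> k) (m y)) (m (?act h y)) < \<epsilon> / 3"
    if "h \<in> D" "y \<in> characters FA" for h y
    using m_dist[rule_format, OF that] by simp
  \<comment> \<open>Evaluation at \<open>g\<close> is the point of the spectrum that represents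
    \<open>g\<close>; the dual action moves it by left multiplication.\<close>
  define ev where "ev g = (\<lambda>f\<in>\<A>. f g)" for g :: 'g
  have ev: "ev g \<in> characters FA" if "g \<in> carrier G" for g
    using that unfolding characters_def ev_def
    by (auto simp: FA_simps add_mem mult_mem smult_mem const_mem)
  have act_ev: "?act h (ev g) = ev (h \<otimes>\<^bsub>G\<^esub> g)" if "h \<in> carrier G" "g \<in> carrier G" for h g
  proof -
    have "left_translate G h f \<in> \<A>" if "f \<in> \<A>" for f
      using that \<open>h \<in> carrier G\<close> linfty_comp[of f "carrier G" "\<lambda>g. h \<otimes>\<^bsub>G\<^esub> g"]
      by (simp add: \<A> left_translate_def)
    then show ?thesis using that by (auto simp: dual_action_def ev_def FA_simps left_translate_def fun_eq_iff)
  qed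
  define P where "P g = m (ev g)" for g
  have PG: "set_pmf (P g) \<subseteq> carrier G" if "g \<in> carrier G" for g
    using continuous_map_funspace[OF m] ev[OF that] unfolding top topspace_Prob P_def Prob_def
    by blast
  \<comment> \<open>Each of the two truncations costs \<open>2 * \<delta>\<close>; with the
    equivariance error \<open>\<epsilon> / 3\<close> this adds up to
    \<open>\<epsilon>\<close>.\<close>
  define \<delta> where "\<delta> = \<epsilon> / 6"
  have \<delta>: "\<delta> > 0" using \<epsilon> by (simp add: \<delta>_def)
  obtain E0 where E0: "finite E0" "E0 \<subseteq> carrier G"
    "\<And>y. y \<in> topspace ?Y \<Longrightarrow> (\<Sum>k\<in>E0. pmf (m y) k) > 1 - \<delta>"
    using compact_tight[OF compact_spectrum m, of "1 - \<delta>"] \<delta> by auto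
  define E where "E = insert \<one>\<^bsub>G\<^esub> E0"
  have E: "finite E" "E \<subseteq> carrier G" using E0 by (auto simp: E_def)
  define r where "r g = 1 - (\<Sum>k\<in>E. pmf (P g) k)" for g
  have r: "0 \<le> r g" "r g \<le> \<delta>" if "g \<in> carrier G" for g
  proof -
    show "0 \<le> r g" using sum_pmf_le_1[OF E(1), of "P g"] by (simp add: r_def)
    have "(\<Sum>k\<in>E0. pmf (P g) k) \<le> (\<Sum>k\<in>E. pmf (P g) k)"
      using E by (intro sum_mono2) (auto simp: E_def)
    then show "r g \<le> \<delta>" using E0(3)[of "ev g"] ev[OF that] by (simp add: top r_def P_def)
  qed
  \<comment> \<open>The mass lost outside \<open>E\<close> is put on the unit, which was added to
    \<open>E\<close> for this purpose.\<close>
  define p where "p g k = (if k \<in> E then pmf (P g) k + (if k = \<one>\<^bsub>G\<^esub> then r g else 0) else 0)" for g k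
  have fam: "finite_prob_family (carrier G) E p"
  proof -
    have "(\<Sum>k\<in>E. p g k) = 1" for g
    proof -
      have "(\<Sum>k\<in>E. p g k) = (\<Sum>k\<in>E. pmf (P g) k) + (\<Sum>k\<in>E. if k = \<one>\<^bsub>G\<^esub> then r g else 0)"
        unfolding sum.distrib[symmetric] by (intro sum.cong) (auto simp: p_def)
      then show ?thesis using E by (simp add: E_def r_def)
    qed
    then show ?thesis using E r by (auto simp: finite_prob_family_def p_def)
  qed
  have close: "(\<Sum>k\<in>B. \<bar>p g k - pmf (P g) k\<bar>) \<le> 2 * \<delta>" if B: "finite B" and g: "g \<in> carrier G" for B g
  proof -
    have "(\<Sum>k\<in>B. \<bar>p g k - pmf (P g) k\<bar>)
        \<le> (\<Sum>k\<in>B. (if k = \<one>\<^bsub>G\<^esub> then r g else 0) + (if k \<in> B - E then pmf (P g) k else 0))"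
      using r[OF g] by (intro sum_mono) (auto simp: p_def)
    also have "\<dots> = (\<Sum>k\<in>B. if k = \<one>\<^bsub>G\<^esub> then r g else 0) + (\<Sum>k\<in>B - E. pmf (P g) k)"
      unfolding sum.distrib using B by (simp add: sum.If_cases Diff_eq Compl_eq)
    also have "(\<Sum>k\<in>B. if k = \<one>\<^bsub>G\<^esub> then r g else 0) \<le> r g" using B r[OF g] by simp
    also have "(\<Sum>k\<in>B - E. pmf (P g) k) = (\<Sum>k\<in>B \<union> E. pmf (P g) k) - (\<Sum>k\<in>E. pmf (P g) k)"
      using sum.subset_diff[of E "B \<union> E" "pmf (P g)"] B E by (simp add: Un_Diff)
    also have "\<dots> \<le> r g" using sum_pmf_le_1[of "B \<union> E" "P g"] B E by (simp add: r_def)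
    finally show ?thesis using r[OF g] by simp
  qed
  show ?thesis
  proof (rule that[OF fam E(2)])
    fix h g B assume hD: "h \<in> D" and g: "g \<in> carrier G" and B: "finite B" "B \<subseteq> carrier G"
    have h: "h \<in> carrier G" using hD D by auto
    let ?t = "\<lambda>k. inv\<^bsub>G\<^esub> h \<otimes>\<^bsub>G\<^esub> k"
    have "(\<Sum>k\<in>B. \<bar>p (h \<otimes>\<^bsub>G\<^esub> g) k - p g (?t k)\<bar>)
        \<le> (\<Sum>k\<in>B. \<bar>p (h \<otimes>\<^bsub>G\<^esub> g) k - pmf (P (h \<otimes>\<^bsub>G\<^esub> g)) k\<bar> +
             \<bar>pmf (P g) (?t k) - pmf (P (h \<otimes>\<^bsub>G\<^esub> g)) k\<bar> + \<bar>p g (?t k) - pmf (P g) (?t k)\<bar>)"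
      by (intro sum_mono) linarith
    also have "\<dots> = (\<Sum>k\<in>B. \<bar>p (h \<otimes>\<^bsub>G\<^esub> g) k - pmf (P (h \<otimes>\<^bsub>G\<^esub> g)) k\<bar>) +
        (\<Sum>k\<in>B. \<bar>pmf (P g) (?t k) - pmf (P (h \<otimes>\<^bsub>G\<^esub> g)) k\<bar>) + (\<Sum>k\<in>B. \<bar>p g (?t k) - pmf (P g) (?t k)\<bar>)"
      by (simp add: sum.distrib)
    also have "(\<Sum>k\<in>B. \<bar>p (h \<otimes>\<^bsub>G\<^esub> g) k - pmf (P (h \<otimes>\<^bsub>G\<^esub> g)) k\<bar>) \<le> 2 * \<delta>"
      using close[OF B(1)] h g by simp
    also have "(\<Sum>k\<in>B. \<bar>pmf (P g) (?t k) - pmf (P (h \<otimes>\<^bsub>G\<^esub> g)) k\<bar>)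
        = (\<Sum>k\<in>B. \<bar>pmf (map_pmf (\<lambda>k. h \<otimes>\<^bsub>G\<^esub> k) (P g)) k - pmf (P (h \<otimes>\<^bsub>G\<^esub> g)) k\<bar>)"
      using pmf_map_translate[OF \<open>group G\<close> h PG[OF g]] B by (intro sum.cong) auto
    also have "\<dots> \<le> l1_dist (map_pmf (\<lambda>k. h \<otimes>\<^bsub>G\<^esub> k) (P g)) (P (h \<otimes>\<^bsub>G\<^esub> g))"
      by (rule finite_sum_le_l1_dist[OF B(1)])
    also have "\<dots> \<le> \<epsilon> / 3" using m_le[OF hD ev[OF g]] act_ev[OF h g] by (simp add: P_def)
    also have "(\<Sum>k\<in>B. \<bar>p g (?t k) - pmf (P g) (?t k)\<bar>) = (\<Sum>k\<in>?t ` B. \<bar>p g k - pmf (P g) k\<bar>)"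
      using inj_on_subset[OF G.inj_on_cmult[OF G.inv_closed[OF h]] B(2)] by (simp add: sum.reindex)
    also have "\<dots> \<le> 2 * \<delta>" using close[OF finite_imageI[OF B(1)] g] .
    finally show "(\<Sum>k\<in>B. \<bar>p (h \<otimes>\<^bsub>G\<^esub> g) k - p g (?t k)\<bar>) \<le> \<epsilon>" by (simp add: \<delta>_def)
  qed
qed

section \<open>Words over a set with a group action\<close>

lemma sum_list_abs_diff:
  fixes f g :: "'a \<Rightarrow> real"
  assumes "\<And>y. y \<in> set x \<Longrightarrow> \<bar>f y - g y\<bar> \<le> c"
  shows "\<bar>sum_list (map f x) - sum_list (map g x)\<bar> \<le> c * length x"
  using assms
proof (induction x)
  case (Cons a x)
  have "\<bar>f a - g a\<bar> \<le> c" "\<bar>sum_list (map f x) - sum_list (map g x)\<bar> \<le> c * length x"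
    using Cons by auto
  then show ?case by (simp add: algebra_simps)
qed simp

lemma sum_sum_list:
  fixes F :: "'k \<Rightarrow> 'a \<Rightarrow> 'b::comm_monoid_add"
  shows "(\<Sum>k\<in>B. sum_list (map (F k) x)) = sum_list (map (\<lambda>y. \<Sum>k\<in>B. F k y) x)"
  by (induction x) (simp_all add: sum.distrib)

lemma sum_abs_sum_list_le:
  fixes F :: "'k \<Rightarrow> 'a \<Rightarrow> real"
  shows "(\<Sum>k\<in>B. \<bar>sum_list (map (F k) x)\<bar>) \<le> sum_list (map (\<lambda>y. \<Sum>k\<in>B. \<bar>F k y\<bar>) x)"
proof -
  have "\<bar>sum_list (map (F k) x)\<bar> \<le> sum_list (map (\<lambda>y. \<bar>F k y\<bar>) x)" for k
    by (induction x) auto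
  then show ?thesis unfolding sum_sum_list[symmetric] by (intro sum_mono)
qed

text \<open>Only \<open>\<alpha>\<close> is left as outer denominator, and \<open>\<beta>\<close>
  survives in the quotient \<open>b / \<beta>\<close>, a probability in the applications. So errors
  of numerator and normaliser are both measured against the mass at the original point.\<close>

lemma normalized_diff:
  fixes a b \<alpha> \<beta> :: real
  assumes "\<alpha> > 0" "\<beta> > 0" "0 \<le> b"
  shows "\<bar>b / \<beta> - a / \<alpha>\<bar> \<le> (\<bar>b - a\<bar> + (b / \<beta>) * \<bar>\<beta> - \<alpha>\<bar>) / \<alpha>"
proof -
  have "b / \<beta> - a / \<alpha> = ((b - a) - (b / \<beta>) * (\<beta> - \<alpha>)) / \<alpha>" using assms by (simp add: field_simps)
  then have "\<bar>b / \<beta> - a / \<alpha>\<bar> = \<bar>(b - a) - (b / \<beta>) * (\<beta> - \<alpha>)\<bar> / \<alpha>" using assms by simp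
  also have "\<dots> \<le> (\<bar>b - a\<bar> + \<bar>(b / \<beta>) * (\<beta> - \<alpha>)\<bar>) / \<alpha>"
    using assms(1) by (intro divide_right_mono abs_triangle_ineq4) simp
  finally show ?thesis using assms by (simp add: abs_mult)
qed

lemma abs_mult_add_le:
  fixes a b u v :: real
  assumes "0 \<le> b" "0 \<le> a" shows "\<bar>u * b + a * v\<bar> \<le> \<bar>u\<bar> * b + a * \<bar>v\<bar>"
  using abs_triangle_ineq[of "u * b" "a * v"] assms by (simp add: abs_mult)

locale word_action = group_action G X \<pi>
  for G :: "('g, 'm) monoid_scheme" (structure) and X :: "'x set" and \<pi> :: "'g \<Rightarrow> 'x \<Rightarrow> 'x" +
  assumes countable_G: "countable (carrier G)"
    and finite_stab: "x \<in> X \<Longrightarrow> finite (stabilizer G \<pi> x)"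
    and finite_orbits: "finite (orbits G X \<pi>)"
    and exact: "exact_group G"
begin

lemma group_G: "group G"
  using group_hom group_hom.axioms(1) by blast

sublocale group G by (rule group_G)

lemma act_in: "g \<in> carrier G \<Longrightarrow> x \<in> X \<Longrightarrow> \<pi> g x \<in> X"
  by (rule element_image) auto

lemma act_mult: "g \<in> carrier G \<Longrightarrow> h \<in> carrier G \<Longrightarrow> x \<in> X \<Longrightarrow> \<pi> (g \<otimes> h) x = \<pi> g (\<pi> h x)"
  by (rule composition_rule)

lemma act_one: "x \<in> X \<Longrightarrow> \<pi> \<one> x = x"
  by (metis id_eq_one restrict_apply')

lemma act_inv_left: "g \<in> carrier G \<Longrightarrow> x \<in> X \<Longrightarrow> \<pi> (inv g) (\<pi> g x) = x"
  using act_mult[of "inv g" g x] by (simp add: act_one)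

lemma act_inv_right: "g \<in> carrier G \<Longrightarrow> x \<in> X \<Longrightarrow> \<pi> g (\<pi> (inv g) x) = x"
  using act_mult[of g "inv g" x] by (simp add: act_one)

section \<open>Small subsets of the semidirect product\<close>

definition "ZM = full_semidirect G X \<pi>"
definition "ZZ = carrier ZM"
definition "GG = G_full G X \<pi>"

lemma ZZ_eq: "ZZ = lists X \<times> carrier G"
  by (simp add: ZZ_def ZM_def full_semidirect_def semidirect_def X_full_def)

lemma ZM_mult: "(x, g) \<otimes>\<^bsub>ZM\<^esub> (y, h) = (x @ map (\<pi> g) y, g \<otimes> h)"
  by (simp add: ZM_def full_semidirect_def semidirect_def X_full_def)

lemma map_act_one: "x \<in> lists X \<Longrightarrow> map (\<pi> \<one>) x = x"
  by (induction x) (auto simp: act_one)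

lemma map_act_in: "g \<in> carrier G \<Longrightarrow> x \<in> lists X \<Longrightarrow> map (\<pi> g) x \<in> lists X"
  by (auto intro!: act_in)

lemma map_act_mult:
  "g \<in> carrier G \<Longrightarrow> h \<in> carrier G \<Longrightarrow> x \<in> lists X \<Longrightarrow> map (\<pi> g) (map (\<pi> h) x) = map (\<pi> (g \<otimes> h)) x"
  by (auto simp: act_mult)

lemma sym_coset_eq:
  assumes "set_mset t \<subseteq> X"
  shows "sym_coset G X \<pi> s t = {(s + image_mset (\<pi> g) t, g) | g. g \<in> carrier G}"
  unfolding sym_coset_def Let_def Setcompr_eq_image
  by (rule image_cong) (auto simp: sym_semidirect_def semidirect_def X_sym_def)

lemma G_sym_eq:
  "E \<in> G_sym G X \<pi> \<longleftrightarrow> (\<exists>F. finite F \<and> (\<forall>(s, t)\<in>F. set_mset s \<subseteq> X \<and> set_mset t \<subseteq> X) \<and>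
     E = (\<Union>(s, t)\<in>F. {(s + image_mset (\<pi> g) t, g) | g. g \<in> carrier G}))"
proof
  assume "E \<in> G_sym G X \<pi>"
  then obtain \<F> where \<F>: "finite \<F>" "E = \<Union>\<F>"
    "\<F> \<subseteq> (\<lambda>(s, t). sym_coset G X \<pi> s t) ` ({s. set_mset s \<subseteq> X} \<times> {t. set_mset t \<subseteq> X})"
    by (auto simp: G_sym_def X_sym_def)
  then obtain F where F: "finite F" "F \<subseteq> {s. set_mset s \<subseteq> X} \<times> {t. set_mset t \<subseteq> X}"
    "\<F> = (\<lambda>(s, t). sym_coset G X \<pi> s t) ` F"
    by (meson finite_subset_image)
  have "E = (\<Union>(s, t)\<in>F. {(s + image_mset (\<pi> g) t, g) | g. g \<in> carrier G})"
    unfolding \<F>(2) F(3) using F(2) sym_coset_eq by (intro SUP_cong) auto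
  with F show "\<exists>F. finite F \<and> (\<forall>(s, t)\<in>F. set_mset s \<subseteq> X \<and> set_mset t \<subseteq> X) \<and>
     E = (\<Union>(s, t)\<in>F. {(s + image_mset (\<pi> g) t, g) | g. g \<in> carrier G})" by blast
next
  assume "\<exists>F. finite F \<and> (\<forall>(s, t)\<in>F. set_mset s \<subseteq> X \<and> set_mset t \<subseteq> X) \<and>
     E = (\<Union>(s, t)\<in>F. {(s + image_mset (\<pi> g) t, g) | g. g \<in> carrier G})"
  then obtain F where F: "finite F" "\<forall>(s, t)\<in>F. set_mset s \<subseteq> X \<and> set_mset t \<subseteq> X"
     "E = (\<Union>(s, t)\<in>F. {(s + image_mset (\<pi> g) t, g) | g. g \<in> carrier G})" by blast
  have "E = \<Union>((\<lambda>(s, t). sym_coset G X \<pi> s t) ` F)"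
    unfolding F(3) using F(2) sym_coset_eq by (intro SUP_cong) auto
  moreover have "(\<lambda>(s, t). sym_coset G X \<pi> s t) ` F
      \<subseteq> {sym_coset G X \<pi> s t | s t. set_mset s \<subseteq> X \<and> set_mset t \<subseteq> X}"
    using F(2) by fast
  ultimately show "E \<in> G_sym G X \<pi>"
    using F(1) unfolding G_sym_def X_sym_def partial_object.select_convs mem_Collect_eq by blast
qed

text \<open>In an element \<open>s g t\<close> the letters of \<open>s\<close> appear unchanged and
  those of \<open>t\<close> are moved by \<open>g\<close>; the two alternatives record from which
  side a letter may come.\<close>

definition near :: "'x set \<Rightarrow> 'g \<Rightarrow> 'x \<Rightarrow> bool" where
  "near K g y \<longleftrightarrow> y \<in> K \<or> \<pi> (inv g) y \<in> K"

lemma finite_bounded_multisets: "finite K \<Longrightarrow> finite {s. set_mset s \<subseteq> K \<and> size s \<le> n}"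
proof -
  assume "finite K"
  then have "finite (mset ` {xs. set xs \<subseteq> K \<and> length xs \<le> n})" by (intro finite_imageI finite_lists_length_le)
  moreover have "{s. set_mset s \<subseteq> K \<and> size s \<le> n} \<subseteq> mset ` {xs. set xs \<subseteq> K \<and> length xs \<le> n}"
  proof
    fix s assume s: "s \<in> {s. set_mset s \<subseteq> K \<and> size s \<le> n}"
    obtain xs where "mset xs = s" using ex_mset by blast
    then show "s \<in> mset ` {xs. set xs \<subseteq> K \<and> length xs \<le> n}" using s by auto
  qed
  ultimately show ?thesis by (rule rev_finite_subset)
qed

lemma smallE:
  assumes "small_rel GG A"
  obtains K n where "A \<subseteq> ZZ" "finite K" "K \<subseteq> X"
    "\<forall>x g. (x, g) \<in> A \<longrightarrow> length x \<le> n \<and> (\<forall>y\<in>set x. near K g y)"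
proof -
  obtain E where E: "E \<in> G_sym G X \<pi>" and AE: "A \<subseteq> Q_map -` E \<inter> ZZ"
    using assms unfolding small_rel_def GG_def G_full_def ZZ_def ZM_def by blast
  obtain F where F: "finite F" and Fs: "\<forall>(s, t)\<in>F. set_mset s \<subseteq> X \<and> set_mset t \<subseteq> X"
    and EF: "E = (\<Union>(s, t)\<in>F. {(s + image_mset (\<pi> g) t, g) | g. g \<in> carrier G})"
    using E unfolding G_sym_eq by (elim exE conjE)
  have FX: "set_mset s \<subseteq> X" "set_mset t \<subseteq> X" if "(s, t) \<in> F" for s t
    using bspec[OF Fs that] by auto
  define K where "K = (\<Union>(s, t)\<in>F. set_mset s \<union> set_mset t)"
  define n where "n = (\<Sum>(s, t)\<in>F. size s + size t)"
  have *: "length x \<le> n" "\<And>y. y \<in> set x \<Longrightarrow> near K g y" if "(x, g) \<in> A" for x g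
  proof -
    have "(mset x, g) \<in> E" using AE that by (auto simp: Q_map_def)
    then obtain s t where st: "(s, t) \<in> F" "mset x = s + image_mset (\<pi> g) t" and g: "g \<in> carrier G"
      unfolding EF by auto
    have "length x = size s + size t"
      using arg_cong[OF st(2), of size] by simp
    also have "\<dots> \<le> n"
      unfolding n_def using member_le_sum[OF st(1), of "\<lambda>(s, t). size s + size t"] F by auto
    finally show "length x \<le> n" .
    fix y assume "y \<in> set x"
    then have "y \<in> set_mset s \<or> (\<exists>u\<in>set_mset t. y = \<pi> g u)"
      using arg_cong[OF st(2), of set_mset] by auto
    then show "near K g y"
    proof (elim disjE bexE)
      assume "y \<in> set_mset s"
      then show ?thesis using st(1) by (auto simp: near_def K_def)
    next
      fix u assume u: "u \<in> set_mset t" "y = \<pi> g u"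
      then have "\<pi> (inv g) y = u" using act_inv_left[OF g] FX(2)[OF st(1)] by auto
      then show ?thesis using st(1) u(1) by (auto simp: near_def K_def)
    qed
  qed
  have "finite K" "K \<subseteq> X" using F FX unfolding K_def by auto blast+
  with that * show ?thesis using AE by blast
qed

text \<open>Letters in \<open>K\<close> are collected in \<open>s\<close>, the others are pulled
  back by \<open>inv g\<close> into \<open>t\<close>. The order of letters is lost in the quotient
  monoid, so this splitting is legitimate, and there are finitely many pairs of multisets over
  \<open>K\<close> of size at most \<open>n\<close>.\<close>

lemma smallI:
  assumes A: "A \<subseteq> ZZ" and K: "finite K" "K \<subseteq> X"
    and len: "\<And>x g. (x, g) \<in> A \<Longrightarrow> length x \<le> n"
    and near: "\<And>x g y. (x, g) \<in> A \<Longrightarrow> y \<in> set x \<Longrightarrow> near K g y"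
  shows "small_rel GG A"
proof -
  let ?M = "{s. set_mset s \<subseteq> K \<and> size s \<le> n}"
  let ?E = "\<Union>(s, t)\<in>?M \<times> ?M. {(s + image_mset (\<pi> g) t, g) | g. g \<in> carrier G}"
  have "?E \<in> G_sym G X \<pi>"
    unfolding G_sym_eq using finite_bounded_multisets[OF K(1)] K(2)
    by (intro exI[of _ "?M \<times> ?M"]) auto
  moreover have "A \<subseteq> Q_map -` ?E \<inter> ZZ"
  proof
    fix z assume z: "z \<in> A"
    obtain x g where zx: "z = (x, g)" by fastforce
    have xg: "x \<in> lists X" "g \<in> carrier G" using z A by (auto simp: zx ZZ_eq)
    define s where "s = filter_mset (\<lambda>y. y \<in> K) (mset x)"
    define t where "t = image_mset (\<pi> (inv g)) (filter_mset (\<lambda>y. y \<notin> K) (mset x))"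
    have "image_mset (\<pi> g) t = image_mset (\<lambda>y. y) (filter_mset (\<lambda>y. y \<notin> K) (mset x))"
      unfolding t_def multiset.map_comp using xg act_inv_right by (intro image_mset_cong) auto
    then have "mset x = s + image_mset (\<pi> g) t" by (simp add: s_def)
    moreover have "s \<in> ?M" "t \<in> ?M"
      using near[of x g] len[of x g] z size_filter_mset_lesseq[of _ "mset x"]
      by (auto simp: s_def t_def zx near_def intro: order_trans)
    ultimately show "z \<in> Q_map -` ?E \<inter> ZZ"
      using xg z A by (auto simp: zx Q_map_def intro!: bexI[of _ "(s, t)"])
  qed
  ultimately show "small_rel GG A"
    unfolding small_rel_def GG_def G_full_def ZZ_def ZM_def by blast
qed

lemma near_mono: "near K g y \<Longrightarrow> K \<subseteq> K' \<Longrightarrow> near K' g y"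
  by (auto simp: near_def)

text \<open>It suffices that \<open>T\<close> does not shorten words and that closeness of the new
  letters gives closeness of the old ones, after enlarging the finite set \<open>K\<close> to
  \<open>C K\<close> independently of the point.\<close>

lemma small_preimage:
  assumes A: "small_rel GG A"
    and len: "\<And>x g x' g'. (x, g) \<in> ZZ \<Longrightarrow> T (x, g) = (x', g') \<Longrightarrow> length x \<le> length x'"
    and C: "\<And>K. finite K \<Longrightarrow> K \<subseteq> X \<Longrightarrow> finite (C K) \<and> C K \<subseteq> X"
    and near: "\<And>K x g x' g' y. (x, g) \<in> ZZ \<Longrightarrow> T (x, g) = (x', g') \<Longrightarrow>
      \<forall>y\<in>set x'. near K g' y \<Longrightarrow> y \<in> set x \<Longrightarrow> near (C K) g y"
  shows "small_rel GG {z \<in> ZZ. T z \<in> A}"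
proof -
  obtain K n where "A \<subseteq> ZZ" and K: "finite K" "K \<subseteq> X"
    and n: "\<forall>x g. (x, g) \<in> A \<longrightarrow> length x \<le> n \<and> (\<forall>y\<in>set x. near K g y)"
    using A by (rule smallE)
  show ?thesis
  proof (rule smallI[of _ "C K" n])
    fix x g assume z: "(x, g) \<in> {z \<in> ZZ. T z \<in> A}"
    obtain x' g' where T: "T (x, g) = (x', g')" by fastforce
    with z have z': "(x, g) \<in> ZZ" "(x', g') \<in> A" by auto
    show "length x \<le> n" using len[OF z'(1) T] n z'(2) by (meson order_trans)
    show "near (C K) g y" if "y \<in> set x" for y using near[OF z'(1) T _ that] n z'(2) by blast
  qed (use C[OF K] in auto)
qed

section \<open>Translations and the exchange of the two sides\<close>

definition "lshift s z = (s, \<one>) \<otimes>\<^bsub>ZM\<^esub> z"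
definition "rshift s z = z \<otimes>\<^bsub>ZM\<^esub> (s, \<one>)"
definition "gshift h z = z \<otimes>\<^bsub>ZM\<^esub> ([], h)"
definition "gact h z = ([], h) \<otimes>\<^bsub>ZM\<^esub> z"
text \<open>The inverse on the right makes this a left action of the product group. At
  \<open>(inv g, inv h)\<close> it sends \<open>z\<close> to \<open>inv g z h\<close>, the
  substitution in \<open>left_right_action\<close>.\<close>

definition "lract = (\<lambda>(h1, h2) z. gact h1 (gshift (inv h2) z))"
definition "star = (\<lambda>(x, g). (map (\<pi> (inv g)) (rev x), inv g))"

definition "T1 = lshift ` lists X \<union> rshift ` lists X"
definition "T2 = T1 \<union> gshift ` carrier G"

lemma shift_simps:
  "(x, g) \<in> ZZ \<Longrightarrow> lshift s (x, g) = (s @ x, g)"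
  "(x, g) \<in> ZZ \<Longrightarrow> rshift s (x, g) = (x @ map (\<pi> g) s, g)"
  "(x, g) \<in> ZZ \<Longrightarrow> gshift h (x, g) = (x, g \<otimes> h)"
  "(x, g) \<in> ZZ \<Longrightarrow> gact h (x, g) = (map (\<pi> h) x, h \<otimes> g)"
  "star (x, g) = (map (\<pi> (inv g)) (rev x), inv g)"
  by (auto simp: ZZ_eq lshift_def rshift_def gshift_def gact_def star_def ZM_mult map_act_one)

lemma mem_ZZ: "(x, g) \<in> ZZ \<longleftrightarrow> x \<in> lists X \<and> g \<in> carrier G"
  by (auto simp: ZZ_eq)

lemma shift_in_ZZ:
  "z \<in> ZZ \<Longrightarrow> s \<in> lists X \<Longrightarrow> lshift s z \<in> ZZ"
  "z \<in> ZZ \<Longrightarrow> s \<in> lists X \<Longrightarrow> rshift s z \<in> ZZ"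
  "z \<in> ZZ \<Longrightarrow> h \<in> carrier G \<Longrightarrow> gshift h z \<in> ZZ"
  "z \<in> ZZ \<Longrightarrow> h \<in> carrier G \<Longrightarrow> gact h z \<in> ZZ"
  "z \<in> ZZ \<Longrightarrow> star z \<in> ZZ"
  by (cases z; auto simp: shift_simps mem_ZZ act_in)+

text \<open>Insertions keep the old letters and \<open>g\<close>, so \<open>K\<close> need not grow.
  Right multiplication by \<open>h\<close> enlarges \<open>K\<close> by \<open>h K\<close>, left
  translation by the image of \<open>K\<close> under \<open>inv h\<close>, and \<open>star\<close>
  merely swaps the two alternatives in \<open>near\<close>.\<close>

lemma small_shift:
  assumes A: "small_rel GG A"
  shows "s \<in> lists X \<Longrightarrow> small_rel GG {z \<in> ZZ. lshift s z \<in> A}"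
    and "s \<in> lists X \<Longrightarrow> small_rel GG {z \<in> ZZ. rshift s z \<in> A}"
    and "h \<in> carrier G \<Longrightarrow> small_rel GG {z \<in> ZZ. gshift h z \<in> A}"
    and "h \<in> carrier G \<Longrightarrow> small_rel GG {z \<in> ZZ. gact h z \<in> A}"
    and "small_rel GG {z \<in> ZZ. star z \<in> A}"
proof -
  show "small_rel GG {z \<in> ZZ. lshift s z \<in> A}" if "s \<in> lists X"
    by (rule small_preimage[OF A, of _ "\<lambda>K. K"]) (auto simp: shift_simps)
  show "small_rel GG {z \<in> ZZ. rshift s z \<in> A}" if "s \<in> lists X"
    by (rule small_preimage[OF A, of _ "\<lambda>K. K"]) (auto simp: shift_simps)
  show "small_rel GG {z \<in> ZZ. gshift h z \<in> A}" if h: "h \<in> carrier G"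
  proof -
    have "near (K \<union> \<pi> h ` K) g y" if "near K (g \<otimes> h) y" "g \<in> carrier G" "y \<in> X" for K g y
    proof -
      have "\<pi> h (\<pi> (inv (g \<otimes> h)) y) = \<pi> (h \<otimes> inv (g \<otimes> h)) y" using that h by (simp add: act_mult)
      also have "h \<otimes> inv (g \<otimes> h) = inv g" using that h by (simp add: inv_mult_group m_assoc[symmetric])
      finally show ?thesis using that unfolding near_def by (metis UnCI image_eqI)
    qed
    with h act_in show ?thesis
      by (intro small_preimage[OF A, of _ "\<lambda>K. K \<union> \<pi> h ` K"]) (auto simp: shift_simps mem_ZZ)
  qed
  show "small_rel GG {z \<in> ZZ. gact h z \<in> A}" if h: "h \<in> carrier G"
  proof -
    have "near (K \<union> \<pi> (inv h) ` K) g y" if "near K (h \<otimes> g) (\<pi> h y)" "g \<in> carrier G" "y \<in> X" for K g y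
    proof -
      have "\<pi> (inv (h \<otimes> g)) (\<pi> h y) = \<pi> (inv (h \<otimes> g) \<otimes> h) y" using that h by (simp add: act_mult)
      also have "inv (h \<otimes> g) \<otimes> h = inv g" using that h by (simp add: inv_mult_group m_assoc)
      finally show ?thesis using that act_inv_left[OF h \<open>y \<in> X\<close>] unfolding near_def by (metis UnCI image_eqI)
    qed
    with h act_in show ?thesis
      by (intro small_preimage[OF A, of _ "\<lambda>K. K \<union> \<pi> (inv h) ` K"]) (auto simp: shift_simps mem_ZZ)
  qed
  show "small_rel GG {z \<in> ZZ. star z \<in> A}"
  proof (rule small_preimage[OF A, of _ "\<lambda>K. K"])
    fix K x g x' g' y assume "(x, g) \<in> ZZ" "star (x, g) = (x', g')" "\<forall>y\<in>set x'. near K g' y" "y \<in> set x"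
    moreover from this have "near K (inv g) (\<pi> (inv g) y)" "g \<in> carrier G" "y \<in> X"
      by (auto simp: shift_simps mem_ZZ)
    ultimately show "near K g y" using act_inv_right[of g y] unfolding near_def by auto
  qed (auto simp: shift_simps)
qed

lemma small_sets_GG: "small_sets GG"
proof
  show "small_rel GG {}" by (rule smallI[of _ "{}" 0]) auto
  fix A B assume AB: "small_rel GG A" "small_rel GG B"
  obtain K n where K: "A \<subseteq> ZZ" "finite K" "K \<subseteq> X"
    "\<forall>x g. (x, g) \<in> A \<longrightarrow> length x \<le> n \<and> (\<forall>y\<in>set x. near K g y)"
    using AB(1) by (rule smallE)
  obtain K' n' where K': "B \<subseteq> ZZ" "finite K'" "K' \<subseteq> X"
    "\<forall>x g. (x, g) \<in> B \<longrightarrow> length x \<le> n' \<and> (\<forall>y\<in>set x. near K' g y)"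
    using AB(2) by (rule smallE)
  show "small_rel GG (A \<union> B)"
  proof (rule smallI[of _ "K \<union> K'" "n + n'"])
    fix x g assume xg: "(x, g) \<in> A \<union> B"
    show "length x \<le> n + n'" using xg K(4) K'(4) by (meson UnE trans_le_add1 trans_le_add2)
    show "near (K \<union> K') g y" if "y \<in> set x" for y
      using xg that K(4) K'(4) near_mono[of K g y "K \<union> K'"] near_mono[of K' g y "K \<union> K'"] by blast
  qed (use K K' in auto)
qed

sublocale left_right: shifts ZZ GG T1
proof (intro shifts.intro small_sets_GG shifts_axioms.intro)
  fix T z A
  assume T: "T \<in> T1"
  show "z \<in> ZZ \<Longrightarrow> T z \<in> ZZ" using T shift_in_ZZ unfolding T1_def by blast
  show "small_rel GG A \<Longrightarrow> small_rel GG {z \<in> ZZ. T z \<in> A}" using T small_shift(1,2) unfolding T1_def by blast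
qed

sublocale right_inv: shifts ZZ GG T2
proof (intro shifts.intro small_sets_GG shifts_axioms.intro)
  fix T z A
  assume T: "T \<in> T2"
  show "z \<in> ZZ \<Longrightarrow> T z \<in> ZZ" using T shift_in_ZZ unfolding T1_def T2_def by blast
  show "small_rel GG A \<Longrightarrow> small_rel GG {z \<in> ZZ. T z \<in> A}"
    using T small_shift(1,2,3) unfolding T1_def T2_def by blast
qed

lemma linfty_closure_eq: "linfty_closure G X \<pi> GG = shift_algebra ZZ GG T1"
  unfolding linfty_closure_def shift_algebra_def Let_def ZM_def[symmetric] ZZ_def[symmetric]
    left_translate_def right_translate_def T1_def
  by (auto simp: lshift_def rshift_def ball_Un X_full_def)

lemma C_closure_eq: "C_closure G X \<pi> GG = shift_algebra ZZ GG T2"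
  unfolding C_closure_def linfty_closure_eq unfolding Let_def shift_algebra_def
    ZM_def[symmetric] ZZ_def[symmetric] right_translate_def T2_def
  by (auto simp: gshift_def ball_Un)

text \<open>Left translation by \<open>h\<close> turns left insertion of \<open>s\<close> into left
  insertion of \<open>h s\<close> and commutes with everything done on the right.\<close>

sublocale left: shifts_action ZZ GG T2 G gact
proof
  fix h z assume h: "h \<in> carrier G"
  show "z \<in> ZZ \<Longrightarrow> gact h z \<in> ZZ" using h shift_in_ZZ by auto
  show "gact (inv h) (gact h z) = z" if "z \<in> ZZ"
  proof -
    obtain x g where z: "z = (x, g)" "x \<in> lists X" "g \<in> carrier G"
      using \<open>z \<in> ZZ\<close> unfolding ZZ_eq by blast
    have 1: "map (\<pi> (inv h)) (map (\<pi> h) x) = x" using h z by (simp add: map_act_mult map_act_one del: map_map)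
    have 2: "inv h \<otimes> (h \<otimes> g) = g" using h z by (simp add: m_assoc[symmetric])
    have "(map (\<pi> h) x, h \<otimes> g) \<in> ZZ" using h z by (simp add: mem_ZZ map_act_in del: lists_eq_set in_lists_conv_set)
    then show ?thesis using that 1 2 by (simp add: z shift_simps del: map_map)
  qed
  show "small_rel GG A \<Longrightarrow> small_rel GG {z \<in> ZZ. gact h z \<in> A}" for A using small_shift(4) h by blast
  fix T assume "T \<in> T2"
  then consider s where "s \<in> lists X" "T = lshift s" | s where "s \<in> lists X" "T = rshift s"
    | k where "k \<in> carrier G" "T = gshift k" by (auto simp: T1_def T2_def)
  then show "\<exists>T'\<in>T2. \<forall>z\<in>ZZ. gact h (T z) = T' (gact h z)"
  proof cases
    case (1 s)
    have "gact h (lshift s (x, g)) = lshift (map (\<pi> h) s) (gact h (x, g))" if "(x, g) \<in> ZZ" for x g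
      using that shift_in_ZZ(1)[OF that 1(1)] shift_in_ZZ(4)[OF that h] by (simp add: shift_simps)
    then show ?thesis using 1 map_act_in[OF h 1(1)] by (intro bexI[of _ "lshift (map (\<pi> h) s)"]) (auto simp: T1_def T2_def)
  next
    case (2 s)
    have "gact h (rshift s (x, g)) = rshift s (gact h (x, g))" if "(x, g) \<in> ZZ" for x g
      using that shift_in_ZZ(2)[OF that 2(1)] shift_in_ZZ(4)[OF that h] h 2(1) map_act_mult[of h g s]
      by (simp add: shift_simps mem_ZZ)
    then show ?thesis using 2 by (intro bexI[of _ "rshift s"]) (auto simp: T1_def T2_def)
  next
    case (3 k)
    have "gact h (gshift k (x, g)) = gshift k (gact h (x, g))" if "(x, g) \<in> ZZ" for x g
      using that shift_in_ZZ(3)[OF that 3(1)] shift_in_ZZ(4)[OF that h] h 3(1)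
      by (simp add: shift_simps mem_ZZ m_assoc)
    then show ?thesis using 3 by (intro bexI[of _ "gshift k"]) (auto simp: T2_def)
  qed
qed

lemma lract_eq:
  assumes "(x, g) \<in> ZZ" "h1 \<in> carrier G" "h2 \<in> carrier G"
  shows "lract (h1, h2) (x, g) = (map (\<pi> h1) x, h1 \<otimes> g \<otimes> inv h2)"
  using assms shift_in_ZZ(3)[OF assms(1), of "inv h2"]
  by (simp add: lract_def shift_simps mem_ZZ m_assoc)

text \<open>Right insertion of \<open>s\<close> becomes right insertion of \<open>h2 s\<close>: the
  letters \<open>h1 g s\<close> in the translated word equal
  \<open>(h1 g inv h2) (h2 s)\<close>.\<close>

sublocale both: shifts_action ZZ GG T1 "G \<times>\<times> G" lract
proof (intro shifts_action.intro shifts_action_axioms.intro DirProd_group group_G)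
  show "shifts ZZ GG T1" by unfold_locales
  fix h z assume "h \<in> carrier (G \<times>\<times> G)"
  then obtain h1 h2 where hh: "h = (h1, h2)" and h: "h1 \<in> carrier G" "h2 \<in> carrier G" by (cases h) auto
  have closed: "lract h z \<in> ZZ" if "z \<in> ZZ" for z
    using that h shift_in_ZZ by (auto simp: hh lract_def)
  then show "z \<in> ZZ \<Longrightarrow> lract h z \<in> ZZ" .
  show "lract (inv\<^bsub>G \<times>\<times> G\<^esub> h) (lract h z) = z" if "z \<in> ZZ"
  proof -
    obtain x g where z: "z = (x, g)" "x \<in> lists X" "g \<in> carrier G"
      using \<open>z \<in> ZZ\<close> unfolding ZZ_eq by blast
    have 1: "map (\<pi> (inv h1)) (map (\<pi> h1) x) = x" using h z by (simp add: map_act_mult map_act_one del: map_map)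
    have 2: "inv h1 \<otimes> (h1 \<otimes> g \<otimes> inv h2) \<otimes> h2 = g" using h z by (simp add: m_assoc) (simp add: m_assoc[symmetric])
    have "inv\<^bsub>G \<times>\<times> G\<^esub> h = (inv h1, inv h2)" using h by (simp add: hh inv_DirProd group_G)
    then show ?thesis using closed[OF that] that 1 2 h by (simp add: hh z lract_eq del: map_map)
  qed
  show "small_rel GG {z \<in> ZZ. lract h z \<in> A}" if "small_rel GG A" for A
  proof -
    have "small_rel GG {z \<in> ZZ. gshift (inv h2) z \<in> {z \<in> ZZ. gact h1 z \<in> A}}"
      using that h by (intro small_shift) auto
    also have "{z \<in> ZZ. gshift (inv h2) z \<in> {z \<in> ZZ. gact h1 z \<in> A}} = {z \<in> ZZ. lract h z \<in> A}"
      using h shift_in_ZZ(3) by (auto simp: hh lract_def)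
    finally show ?thesis .
  qed
  fix T assume "T \<in> T1"
  then consider s where "s \<in> lists X" "T = lshift s" | s where "s \<in> lists X" "T = rshift s"
    by (auto simp: T1_def)
  then show "\<exists>T'\<in>T1. \<forall>z\<in>ZZ. lract h (T z) = T' (lract h z)"
  proof cases
    case (1 s)
    have "lract h (lshift s (x, g)) = lshift (map (\<pi> h1) s) (lract h (x, g))" if "(x, g) \<in> ZZ" for x g
      using that shift_in_ZZ(1)[OF that 1(1)] closed[OF that] h by (simp add: hh lract_eq shift_simps)
    then show ?thesis using 1 map_act_in[OF h(1) 1(1)] by (intro bexI[of _ "lshift (map (\<pi> h1) s)"]) (auto simp: T1_def)
  next
    case (2 s)
    have "lract h (rshift s (x, g)) = rshift (map (\<pi> h2) s) (lract h (x, g))" if "(x, g) \<in> ZZ" for x g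
    proof -
      have g: "g \<in> carrier G" using that by (simp add: mem_ZZ)
      have "map (\<pi> (h1 \<otimes> g \<otimes> inv h2)) (map (\<pi> h2) s) = map (\<pi> (h1 \<otimes> g)) s"
        using h g 2(1) by (simp add: map_act_mult m_assoc del: map_map)
      also have "\<dots> = map (\<pi> h1) (map (\<pi> g) s)" using h g 2(1) by (simp add: map_act_mult del: map_map)
      finally show ?thesis
        using that shift_in_ZZ(2)[OF that 2(1)] closed[OF that] h by (simp add: hh lract_eq shift_simps del: map_map)
    qed
    then show ?thesis using 2 map_act_in[OF h(2) 2(1)] by (intro bexI[of _ "rshift (map (\<pi> h2) s)"]) (auto simp: T1_def)
  qed
qed

end

context word_action
begin

section \<open>A proper length function and equivariant measures on the letters\<close>

lemma orbit_representatives: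
  obtains R where "finite R" "R \<subseteq> X" "\<And>y. y \<in> X \<Longrightarrow> \<exists>r\<in>R. \<exists>g\<in>carrier G. y = \<pi> g r"
proof -
  define R where "R = (\<lambda>S. SOME r. r \<in> X \<and> S = orbit G \<pi> r) ` orbits G X \<pi>"
  have r: "(SOME r. r \<in> X \<and> orbit G \<pi> y = orbit G \<pi> r) \<in> X
      \<and> orbit G \<pi> y = orbit G \<pi> (SOME r. r \<in> X \<and> orbit G \<pi> y = orbit G \<pi> r)" if "y \<in> X" for y
    by (rule someI[of _ y]) (use that in simp)
  show ?thesis
  proof (rule that[of R])
    show "finite R" using finite_orbits by (simp add: R_def)
    show "R \<subseteq> X" using r by (auto simp: R_def orbits_def)
    fix y assume y: "y \<in> X"
    let ?r = "SOME r. r \<in> X \<and> orbit G \<pi> y = orbit G \<pi> r"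
    have "?r \<in> R" using y unfolding R_def orbits_def by blast
    moreover have "y \<in> orbit G \<pi> ?r" using r[OF y] orbit_refl[OF y] by simp
    ultimately show "\<exists>r\<in>R. \<exists>g\<in>carrier G. y = \<pi> g r" unfolding orbit_def by blast
  qed
qed

text \<open>The length is the stage at which a letter enters an increasing filtration by finite
  sets. Stage \<open>n + 1\<close> applies only the first group elements of an enumeration, which
  keeps it finite, while the i-th element delays entry by at most \<open>i + 1\<close>.\<close>

lemma length_function:
  obtains len :: "'x \<Rightarrow> nat" where "\<And>n. finite {y \<in> X. len y \<le> n}"
    "\<And>h. h \<in> carrier G \<Longrightarrow> \<exists>C. \<forall>y\<in>X. len (\<pi> h y) \<le> len y + C"
proof -
  obtain R where R: "finite R" "R \<subseteq> X" "\<And>y. y \<in> X \<Longrightarrow> \<exists>r\<in>R. \<exists>g\<in>carrier G. y = \<pi> g r"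
    using orbit_representatives by blast
  define e where "e = from_nat_into (carrier G)"
  have e: "e i \<in> carrier G" for i using from_nat_into[of "carrier G"] one_closed by (auto simp: e_def)
  have e_surj: "\<exists>i. g = e i" if "g \<in> carrier G" for g
    using from_nat_into_surj[OF countable_G that] by (auto simp: e_def)
  define B where "B = rec_nat R (\<lambda>n S. S \<union> (\<Union>i\<le>n. \<pi> (e i) ` S))"
  have B0: "B 0 = R" and BS: "B (Suc n) = B n \<union> (\<Union>i\<le>n. \<pi> (e i) ` B n)" for n by (simp_all add: B_def)
  have finB: "finite (B n)" for n by (induction n) (simp_all add: B0 BS R)
  have mono: "B m \<subseteq> B n" if "m \<le> n" for m n
    using that by (rule lift_Suc_mono_le[rotated]) (auto simp: BS)
  \<comment> \<open>Passing first to stage \<open>max n i\<close> makes the i-th element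
    available.\<close>
  have step: "\<pi> (e i) y \<in> B (Suc (max n i))" if "y \<in> B n" for y i n
    unfolding BS using subsetD[OF mono[of n "max n i"] that] by (intro UnI2 UN_I[of i]) auto
  define len where "len y = (LEAST n. y \<in> B n)" for y
  have ex: "\<exists>n. y \<in> B n" if "y \<in> X" for y
  proof -
    obtain r i where "r \<in> B 0" "y = \<pi> (e i) r" using R(3)[OF \<open>y \<in> X\<close>] e_surj B0 by metis
    then show ?thesis using step by blast
  qed
  have len: "y \<in> B (len y)" if "y \<in> X" for y unfolding len_def using ex[OF that] by (rule LeastI_ex)
  have le: "len y \<le> n" if "y \<in> B n" for y n unfolding len_def using that by (rule Least_le)
  show ?thesis
  proof (rule that)
    show "finite {y \<in> X. len y \<le> n}" for n
      by (rule finite_subset[OF _ finB[of n]]) (use len mono in blast)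
    fix h assume "h \<in> carrier G"
    then obtain i where i: "h = e i" using e_surj by blast
    have "len (\<pi> h y) \<le> len y + Suc i" if "y \<in> X" for y
      using le[OF step[OF len[OF that], of i]] by (simp add: i)
    then show "\<exists>C. \<forall>y\<in>X. len (\<pi> h y) \<le> len y + C" by blast
  qed
qed

text \<open>An equivariant choice of nonempty finite subsets of \<open>G\<close>: the elements carrying a fixed
  representative of the orbit of \<open>y\<close> to \<open>y\<close>, which form a coset of a stabilizer.\<close>

definition rep where "rep y = (SOME r. r \<in> orbit G \<pi> y)"
definition carriers where "carriers y = {g \<in> carrier G. \<pi> g (rep y) = y}"

lemma rep_props:
  assumes y: "y \<in> X"
  shows "rep y \<in> X" "h \<in> carrier G \<Longrightarrow> rep (\<pi> h y) = rep y" "carriers y \<noteq> {}"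
proof -
  have "rep y \<in> orbit G \<pi> y" unfolding rep_def using orbit_refl[OF y] by (rule someI)
  then obtain g where g: "g \<in> carrier G" "rep y = \<pi> g y" by (auto simp: orbit_def)
  then show "rep y \<in> X" using act_in y by simp
  have "\<pi> (inv g) (rep y) = y" using g y act_inv_left by simp
  then show "carriers y \<noteq> {}" using g unfolding carriers_def by blast
  assume h: "h \<in> carrier G"
  have "orbit G \<pi> (\<pi> h y) = orbit G \<pi> y"
  proof (intro subset_antisym subsetI)
    fix z assume "z \<in> orbit G \<pi> (\<pi> h y)"
    then obtain k where "k \<in> carrier G" "z = \<pi> k (\<pi> h y)" by (auto simp: orbit_def)
    then have "z = \<pi> (k \<otimes> h) y" "k \<otimes> h \<in> carrier G" using h y by (auto simp: act_mult)
    then show "z \<in> orbit G \<pi> y" unfolding orbit_def by blast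
  next
    fix z assume "z \<in> orbit G \<pi> y"
    then obtain k where k: "k \<in> carrier G" "z = \<pi> k y" by (auto simp: orbit_def)
    then have "z = \<pi> (k \<otimes> inv h) (\<pi> h y)" "k \<otimes> inv h \<in> carrier G"
      using h y by (auto simp: act_mult act_in act_inv_left)
    then show "z \<in> orbit G \<pi> (\<pi> h y)" unfolding orbit_def by blast
  qed
  then show "rep (\<pi> h y) = rep y" by (simp add: rep_def)
qed

lemma finite_carriers:
  assumes y: "y \<in> X" shows "finite (carriers y)"
proof -
  obtain g where g: "g \<in> carrier G" "\<pi> g (rep y) = y" using rep_props(3)[OF y] by (auto simp: carriers_def)
  have "carriers y \<subseteq> (\<lambda>k. g \<otimes> k) ` stabilizer G \<pi> (rep y)"
  proof
    fix k assume k: "k \<in> carriers y"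
    then have kc: "k \<in> carrier G" "\<pi> k (rep y) = y" by (auto simp: carriers_def)
    have "\<pi> (inv g) y = rep y" using act_inv_left[OF g(1) rep_props(1)[OF y]] g(2) by simp
    then have "\<pi> (inv g \<otimes> k) (rep y) = rep y" using g kc rep_props(1)[OF y] by (simp add: act_mult)
    then have "inv g \<otimes> k \<in> stabilizer G \<pi> (rep y)" using g kc by (simp add: stabilizer_def)
    moreover have "k = g \<otimes> (inv g \<otimes> k)" using g kc by (simp add: m_assoc[symmetric])
    ultimately show "k \<in> (\<lambda>k. g \<otimes> k) ` stabilizer G \<pi> (rep y)" by blast
  qed
  then show ?thesis using finite_stab[OF rep_props(1)[OF y]] by (meson finite_imageI finite_subset)
qed

text \<open>\<open>y\<close> and \<open>h y\<close> share their representative, so multiplication by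
  \<open>h\<close> carries one set of carrying elements onto the other. This is where equivariance
  of the averages comes from.\<close>

lemma carriers_translate:
  assumes y: "y \<in> X" and h: "h \<in> carrier G"
  shows "bij_betw (\<lambda>g. h \<otimes> g) (carriers y) (carriers (\<pi> h y))"
proof -
  have "inj_on (\<lambda>g. h \<otimes> g) (carriers y)"
    using inj_on_cmult[OF h] by (rule inj_on_subset) (auto simp: carriers_def)
  moreover have "(\<lambda>g. h \<otimes> g) ` carriers y = carriers (\<pi> h y)"
  proof (intro subset_antisym subsetI)
    fix k assume "k \<in> (\<lambda>g. h \<otimes> g) ` carriers y"
    then show "k \<in> carriers (\<pi> h y)"
      using h rep_props[OF y] by (auto simp: carriers_def act_mult)
  next
    fix k assume "k \<in> carriers (\<pi> h y)"
    then have k: "k \<in> carrier G" "\<pi> k (rep y) = \<pi> h y" using h rep_props[OF y] by (auto simp: carriers_def)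
    have "\<pi> (inv h \<otimes> k) (rep y) = y"
      using k h y rep_props(1)[OF y] by (simp add: act_mult act_inv_left)
    then have "inv h \<otimes> k \<in> carriers y" using k h by (simp add: carriers_def)
    moreover have "k = h \<otimes> (inv h \<otimes> k)" using k h by (simp add: m_assoc[symmetric])
    ultimately show "k \<in> (\<lambda>g. h \<otimes> g) ` carriers y" by blast
  qed
  ultimately show ?thesis by (simp add: bij_betw_def)
qed

definition orbit_average :: "('g \<Rightarrow> 'g \<Rightarrow> real) \<Rightarrow> 'x \<Rightarrow> 'g \<Rightarrow> real" where
  "orbit_average p y k = (\<Sum>g\<in>carriers y. p g k) / card (carriers y)"

lemma orbit_average_family:
  assumes p: "finite_prob_family (carrier G) E p"
  shows "finite_prob_family X E (orbit_average p)"
proof -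
  note D = finite_prob_familyD[OF p]
  have sub: "g \<in> carrier G" if "g \<in> carriers y" for g y using that by (simp add: carriers_def)
  have "(\<Sum>k\<in>E. orbit_average p y k) = 1" if y: "y \<in> X" for y
  proof -
    have "(\<Sum>k\<in>E. orbit_average p y k) = (\<Sum>g\<in>carriers y. \<Sum>k\<in>E. p g k) / card (carriers y)"
      unfolding orbit_average_def sum_divide_distrib[symmetric] by (subst sum.swap) simp
    also have "\<dots> = 1" using sub D(4) finite_carriers[OF y] rep_props(3)[OF y] by (simp add: card_gt_0_iff)
    finally show ?thesis .
  qed
  moreover have "0 \<le> orbit_average p y k" if "y \<in> X" for y k
    unfolding orbit_average_def using D(2) sub by (intro divide_nonneg_nonneg sum_nonneg) auto
  moreover have "orbit_average p y k = 0" if "k \<notin> E" for y k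
    using that D(3) sub by (simp add: orbit_average_def)
  ultimately show ?thesis using D(1) by (simp add: finite_prob_family_def)
qed

lemma orbit_average_equivariant:
  assumes h: "h \<in> carrier G" and y: "y \<in> X"
    and p: "\<And>g. g \<in> carrier G \<Longrightarrow> (\<Sum>k\<in>B. \<bar>p (h \<otimes> g) k - p g (inv h \<otimes> k)\<bar>) \<le> \<epsilon>"
  shows "(\<Sum>k\<in>B. \<bar>orbit_average p (\<pi> h y) k - orbit_average p y (inv h \<otimes> k)\<bar>) \<le> \<epsilon>"
proof -
  let ?c = "card (carriers y)"
  have c: "?c > 0" using finite_carriers[OF y] rep_props(3)[OF y] by (simp add: card_gt_0_iff)
  have bij: "bij_betw (\<lambda>g. h \<otimes> g) (carriers y) (carriers (\<pi> h y))" by (rule carriers_translate[OF y h])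
  have diff: "orbit_average p (\<pi> h y) k - orbit_average p y (inv h \<otimes> k)
      = (\<Sum>g\<in>carriers y. p (h \<otimes> g) k - p g (inv h \<otimes> k)) / ?c" for k
    unfolding orbit_average_def bij_betw_same_card[OF bij, symmetric] sum_subtractf
      sum.reindex_bij_betw[OF bij, symmetric] by (simp add: diff_divide_distrib)
  have "(\<Sum>k\<in>B. \<bar>orbit_average p (\<pi> h y) k - orbit_average p y (inv h \<otimes> k)\<bar>)
      \<le> (\<Sum>k\<in>B. (\<Sum>g\<in>carriers y. \<bar>p (h \<otimes> g) k - p g (inv h \<otimes> k)\<bar>) / ?c)"
    unfolding diff by (intro sum_mono) (simp add: divide_right_mono)
  also have "\<dots> = (\<Sum>g\<in>carriers y. \<Sum>k\<in>B. \<bar>p (h \<otimes> g) k - p g (inv h \<otimes> k)\<bar>) / ?c"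
    unfolding sum_divide_distrib[symmetric] by (subst sum.swap) simp
  also have "\<dots> \<le> (\<Sum>g\<in>carriers y. \<epsilon>) / ?c"
    by (intro divide_right_mono sum_mono p) (auto simp: carriers_def)
  also have "\<dots> = \<epsilon>" using c by simp
  finally show ?thesis .
qed

end

text \<open>The letter \<open>y\<close> of a word \<open>x\<close> of length \<open>n\<close> at the point \<open>(x, g)\<close> gets a weight that is small
  only if \<open>n\<close> is small and \<open>y\<close> is close to a base point on the left or on the right. The summand
  \<open>n\<close> makes bounded changes of the weights negligible on long words, the constant \<open>L\<close> makes the
  weights almost invariant under finitely many group elements.\<close>

locale weighted_words = word_action G X \<pi>
  for G :: "('g, 'm) monoid_scheme" (structure) and X :: "'x set" and \<pi> :: "'g \<Rightarrow> 'x \<Rightarrow> 'x" +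
  fixes len :: "'x \<Rightarrow> nat" and L :: nat
  assumes finite_balls: "finite {y \<in> X. len y \<le> n}"
    and length_bound: "h \<in> carrier G \<Longrightarrow> \<exists>C. \<forall>y\<in>X. len (\<pi> h y) \<le> len y + C"
begin

definition depth :: "'x \<Rightarrow> 'g \<Rightarrow> nat" where
  "depth y g = min (len y) (len (\<pi> (inv g) y))"

definition weight :: "nat \<Rightarrow> 'x \<Rightarrow> 'g \<Rightarrow> real" where
  "weight n y g = L + n + depth y g"

definition wsum :: "('g \<Rightarrow> real) \<Rightarrow> ('x \<Rightarrow> real) \<Rightarrow> 'x list \<times> 'g \<Rightarrow> real" where
  "wsum p q = (\<lambda>(x, g). p g + sum_list (map (\<lambda>y. weight (length x) y g * q y) x))"

abbreviation total :: "'x list \<times> 'g \<Rightarrow> real" where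
  "total \<equiv> wsum (\<lambda>_. 1) (\<lambda>_. 1)"

lemma weight_nonneg: "0 \<le> weight n y g" by (simp add: weight_def)

section \<open>Growth of the total mass and its variation under shifts\<close>

lemma length_lipschitz:
  assumes h: "h \<in> carrier G"
  obtains C where "\<And>y. y \<in> X \<Longrightarrow> len (\<pi> h y) \<le> len y + C" "\<And>y. y \<in> X \<Longrightarrow> len y \<le> len (\<pi> h y) + C"
proof -
  obtain C where C: "\<forall>y\<in>X. len (\<pi> h y) \<le> len y + C" using length_bound[OF h] by blast
  obtain C' where C': "\<forall>y\<in>X. len (\<pi> (inv h) y) \<le> len y + C'" using length_bound[of "inv h"] h by auto
  show ?thesis
  proof (rule that[of "C + C'"])
    fix y assume y: "y \<in> X"
    show "len (\<pi> h y) \<le> len y + (C + C')" using C y by fastforce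
    show "len y \<le> len (\<pi> h y) + (C + C')"
      using bspec[OF C', of "\<pi> h y"] act_in[OF h y] act_inv_left[OF h y] by simp
  qed
qed

text \<open>The first bound controls the length of the word, the second the position of each letter:
  together, bounded mass confines a point to a small set. The summand 1 is the contribution of
  \<open>g\<close>.\<close>

lemma total_lower:
  "1 + real (length x) * length x \<le> total (x, g)"
  "y \<in> set x \<Longrightarrow> depth y g \<le> total (x, g)"
proof -
  have "sum_list (map (\<lambda>y. real (length x)) x) \<le> sum_list (map (\<lambda>y. weight (length x) y g) x)"
    by (rule sum_list_mono) (simp add: weight_def)
  then show "1 + real (length x) * length x \<le> total (x, g)" by (simp add: wsum_def sum_list_triv)
  assume "y \<in> set x"
  then have "weight (length x) y g \<le> sum_list (map (\<lambda>y. weight (length x) y g) x)"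
    by (intro member_le_sum_list) (auto simp: weight_nonneg)
  then show "depth y g \<le> total (x, g)" by (simp add: wsum_def weight_def)
qed

lemma total_pos: "1 \<le> total z"
  by (cases z) (use total_lower(1) in \<open>simp add: order_trans[OF _ total_lower(1)]\<close>)

text \<open>This is the order of the change under a shift relative to the mass; its vanishing makes
  the normalised coordinates almost invariant.\<close>

definition ratio :: "'x list \<times> 'g \<Rightarrow> real" where
  "ratio z = (real (length (fst z)) + 1) / total z"

lemma ratio_vanishing: "left_right.vanishing ratio"
  unfolding left_right.vanishing_def
proof (intro allI impI)
  fix \<delta> :: real assume \<delta>: "\<delta> > 0"
  \<comment> \<open>If the ratio exceeds \<open>\<delta>\<close>, then
    \<open>\<delta> n^2 < n + 1\<close>, which is at most \<open>2 n\<close> for nonempty words, so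
    \<open>n\<close> is below \<open>2 / \<delta>\<close>. The mass is then below
    \<open>(2 / \<delta> + 1) / \<delta>\<close>.\<close>
  define N where "N = nat \<lceil>2 / \<delta>\<rceil>"
  define R where "R = nat \<lceil>(2 / \<delta> + 1) / \<delta>\<rceil>"
  have n: "length x \<le> N" "total (x, g) \<le> R" if "norm (ratio (x, g)) > \<delta>" for x g
  proof -
    let ?n = "real (length x)"
    have T: "total (x, g) > 0" using total_pos[of "(x, g)"] by simp
    have "\<delta> < (?n + 1) / total (x, g)" using that T by (simp add: ratio_def add.commute)
    then have t: "\<delta> * total (x, g) < ?n + 1" using T by (simp add: pos_less_divide_eq)
    have "\<delta> * (1 + ?n * ?n) \<le> \<delta> * total (x, g)" using total_lower(1) \<delta> by (intro mult_left_mono) auto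
    with t have s: "\<delta> * (1 + ?n * ?n) < ?n + 1" by linarith
    have le: "?n \<le> 2 / \<delta>"
    proof (cases "x = []")
      case False
      then have n1: "1 \<le> ?n" by (cases x) auto
      have "\<delta> * ?n * ?n < 2 * ?n" using s n1 \<delta> by (simp add: algebra_simps)
      then have "\<delta> * ?n < 2"
        using n1 by (metis less_le_trans mult_less_cancel_right_pos zero_less_one)
      then show ?thesis using \<delta> by (simp add: pos_le_divide_eq mult.commute)
    qed (use \<delta> in simp)
    then show "length x \<le> N" unfolding N_def by linarith
    have "total (x, g) < (?n + 1) / \<delta>" using t \<delta> by (simp add: pos_less_divide_eq mult.commute)
    also have "\<dots> \<le> (2 / \<delta> + 1) / \<delta>" using le \<delta> by (intro divide_right_mono) auto
    finally show "total (x, g) \<le> R" unfolding R_def by linarith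
  qed
  show "small_rel GG {z \<in> ZZ. norm (ratio z) > \<delta>}"
  proof (rule smallI[of _ "{y \<in> X. len y \<le> R}" N])
    fix x g assume xg: "(x, g) \<in> {z \<in> ZZ. norm (ratio z) > \<delta>}"
    then have r: "norm (ratio (x, g)) > \<delta>" and z: "(x, g) \<in> ZZ" by auto
    show "length x \<le> N" by (rule n(1)[OF r])
    fix y assume y: "y \<in> set x"
    then have "real (depth y g) \<le> R" using total_lower(2)[OF y, of g] n(2)[OF r] by linarith
    then show "near {y \<in> X. len y \<le> R} g y"
      using z y act_in[of "inv g" y] by (auto simp: near_def depth_def mem_ZZ min_le_iff_disj)
  qed (use finite_balls in auto)
qed

text \<open>Inserting \<open>s\<close> raises each old weight by the length of \<open>s\<close> and
  adds boundedly many letters of weight linear in \<open>n\<close>. Right multiplication by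
  \<open>h\<close> changes each depth by a constant. Both effects are linear in
  \<open>n\<close>.\<close>

lemma wsum_shift:
  assumes T: "T \<in> T2" and p: "\<And>g. g \<in> carrier G \<Longrightarrow> 0 \<le> p g \<and> p g \<le> 1"
    and q: "\<And>y. y \<in> X \<Longrightarrow> 0 \<le> q y \<and> q y \<le> 1"
  shows "\<exists>K. \<forall>z\<in>ZZ. \<bar>wsum p q z - wsum p q (T z)\<bar> \<le> K * (real (length (fst z)) + 1)"
proof -
  have new: "\<bar>sum_list (map (\<lambda>y. weight n (\<sigma> y) g * q (\<sigma> y)) s)\<bar> \<le> (L + n + sum_list (map len s)) * length s"
    if s: "s \<in> lists X" and \<sigma>: "\<And>y. y \<in> set s \<Longrightarrow> \<sigma> y \<in> X \<and> depth (\<sigma> y) g \<le> len y" for n \<sigma> g s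
  proof -
    have "\<bar>weight n (\<sigma> y) g * q (\<sigma> y) - 0\<bar> \<le> L + n + sum_list (map len s)" if "y \<in> set s" for y
    proof -
      have "weight n (\<sigma> y) g * q (\<sigma> y) \<le> weight n (\<sigma> y) g * 1"
        using q \<sigma>[OF that] weight_nonneg by (intro mult_left_mono) auto
      also have "\<dots> \<le> L + n + len y" using \<sigma>[OF that] by (simp add: weight_def)
      also have "\<dots> \<le> L + n + sum_list (map len s)" using that by (simp add: member_le_sum_list)
      finally show ?thesis using q \<sigma>[OF that] weight_nonneg[of n "\<sigma> y" g] by simp
    qed
    from sum_list_abs_diff[of s _ "\<lambda>_. 0", OF this] show ?thesis by simp
  qed
  have old: "\<bar>sum_list (map (\<lambda>y. weight (length x) y g * q y) x) -
      sum_list (map (\<lambda>y. weight (length x + n) y g * q y) x)\<bar> \<le> real n * real (length x)"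
    if x: "x \<in> lists X" for x g n
  proof (rule sum_list_abs_diff)
    fix y assume "y \<in> set x"
    then have "0 \<le> q y" "q y \<le> 1" using x q by auto
    moreover have "weight (length x) y g * q y - weight (length x + n) y g * q y = - (n * q y)"
      by (simp add: weight_def algebra_simps)
    ultimately show "\<bar>weight (length x) y g * q y - weight (length x + n) y g * q y\<bar> \<le> n"
      using mult_left_le[of "q y" "real n"] by simp
  qed
  \<comment> \<open>The map \<open>\<sigma>\<close> treats both insertions together: it is the
    identity on the left and \<open>\<pi> g\<close> on the right.\<close>
  have ins: "\<bar>wsum p q (x, g) - (p g + (sum_list (map (\<lambda>y. weight (length x + length s) y g * q y) x)
        + sum_list (map (\<lambda>y. weight (length x + length s) (\<sigma> y) g * q (\<sigma> y)) s)))\<bar>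
      \<le> ((L + length s + sum_list (map len s)) * length s + 2 * length s) * (real (length x) + 1)"
    if x: "x \<in> lists X" and s: "s \<in> lists X"
      and \<sigma>: "\<And>y. y \<in> set s \<Longrightarrow> \<sigma> y \<in> X \<and> depth (\<sigma> y) g \<le> len y" for x g s \<sigma>
  proof -
    let ?n = "real (length x)" and ?m = "real (length s)" and ?A = "real (L + length s + sum_list (map len s))"
    have "\<bar>sum_list (map (\<lambda>y. weight (length x + length s) (\<sigma> y) g * q (\<sigma> y)) s)\<bar> \<le> (?A + ?n) * ?m"
      using new[OF s \<sigma>, of "length x + length s"] by (simp add: algebra_simps)
    moreover have "\<bar>sum_list (map (\<lambda>y. weight (length x) y g * q y) x) -
        sum_list (map (\<lambda>y. weight (length x + length s) y g * q y) x)\<bar> \<le> ?m * ?n"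
      by (rule old[OF x])
    ultimately have "\<bar>wsum p q (x, g) - (p g + (sum_list (map (\<lambda>y. weight (length x + length s) y g * q y) x)
        + sum_list (map (\<lambda>y. weight (length x + length s) (\<sigma> y) g * q (\<sigma> y)) s)))\<bar>
      \<le> (?A + ?n) * ?m + ?m * ?n" unfolding wsum_def by simp
    also have "\<dots> \<le> (?A * ?m + 2 * ?m) * (?n + 1)" by (simp add: algebra_simps)
    finally show ?thesis by (simp add: distrib_left distrib_right)
  qed
  consider s where "s \<in> lists X" "T = lshift s" | s where "s \<in> lists X" "T = rshift s"
    | h where "h \<in> carrier G" "T = gshift h" using T unfolding T1_def T2_def by blast
  then show ?thesis
  proof cases
    case (1 s)
    show ?thesis
    proof (rule exI, rule ballI)
      fix z assume "z \<in> ZZ"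
      then obtain x g where z: "z = (x, g)" "(x, g) \<in> ZZ" "x \<in> lists X" "g \<in> carrier G" unfolding ZZ_eq by blast
      have "wsum p q (T z) = p g + (sum_list (map (\<lambda>y. weight (length x + length s) y g * q y) x)
        + sum_list (map (\<lambda>y. weight (length x + length s) y g * q y) s))"
        using z by (simp add: 1 shift_simps wsum_def add.commute add.left_commute)
      then show "\<bar>wsum p q z - wsum p q (T z)\<bar>
          \<le> ((L + length s + sum_list (map len s)) * length s + 2 * length s) * (real (length (fst z)) + 1)"
        using ins[OF z(3) 1(1), of "\<lambda>y. y" g] 1(1) by (auto simp: z(1) depth_def)
    qed
  next
    case (2 s)
    show ?thesis
    proof (rule exI, rule ballI)
      fix z assume "z \<in> ZZ"
      then obtain x g where z: "z = (x, g)" "(x, g) \<in> ZZ" "x \<in> lists X" "g \<in> carrier G" unfolding ZZ_eq by blast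
      have "wsum p q (T z) = p g + (sum_list (map (\<lambda>y. weight (length x + length s) y g * q y) x)
        + sum_list (map (\<lambda>y. weight (length x + length s) (\<pi> g y) g * q (\<pi> g y)) s))"
        using z by (simp add: 2 shift_simps wsum_def o_def)
      \<comment> \<open>The second argument of the minimum in \<open>depth\<close> undoes
        \<open>g\<close>, which makes the bound uniform in \<open>g\<close>.\<close>
      moreover have "\<pi> g y \<in> X \<and> depth (\<pi> g y) g \<le> len y" if "y \<in> set s" for y
        using that 2(1) z(4) by (auto simp: depth_def act_in act_inv_left)
      ultimately show "\<bar>wsum p q z - wsum p q (T z)\<bar>
          \<le> ((L + length s + sum_list (map len s)) * length s + 2 * length s) * (real (length (fst z)) + 1)"
        using ins[OF z(3) 2(1), of "\<pi> g" g] by (simp only: z(1) fst_conv)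
    qed
  next
    case (3 h)
    obtain C where C: "\<And>y. y \<in> X \<Longrightarrow> len (\<pi> (inv h) y) \<le> len y + C" "\<And>y. y \<in> X \<Longrightarrow> len y \<le> len (\<pi> (inv h) y) + C"
      using length_lipschitz[of "inv h"] 3(1) by auto
    show ?thesis
    proof (rule exI, rule ballI)
      fix z assume "z \<in> ZZ"
      then obtain x g where z: "z = (x, g)" "(x, g) \<in> ZZ" "x \<in> lists X" "g \<in> carrier G" unfolding ZZ_eq by blast
      have "\<bar>sum_list (map (\<lambda>y. weight (length x) y g * q y) x) -
          sum_list (map (\<lambda>y. weight (length x) y (g \<otimes> h) * q y) x)\<bar> \<le> real C * real (length x)"
      proof (rule sum_list_abs_diff)
        fix y assume "y \<in> set x"
        then have y: "y \<in> X" using z by auto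
        have "\<pi> (inv (g \<otimes> h)) y = \<pi> (inv h) (\<pi> (inv g) y)"
          using 3(1) z y by (simp add: inv_mult_group act_mult)
        then have "\<bar>weight (length x) y g - weight (length x) y (g \<otimes> h)\<bar> \<le> C"
          using C[of "\<pi> (inv g) y"] act_in[of "inv g" y] y z by (auto simp: weight_def depth_def)
        moreover have "\<bar>q y\<bar> \<le> 1" using q[OF y] by simp
        ultimately have "\<bar>weight (length x) y g - weight (length x) y (g \<otimes> h)\<bar> * \<bar>q y\<bar> \<le> real C * 1"
          by (intro mult_mono) auto
        then show "\<bar>weight (length x) y g * q y - weight (length x) y (g \<otimes> h) * q y\<bar> \<le> C"
          by (simp add: left_diff_distrib[symmetric] abs_mult)
      qed
      moreover have "\<bar>p g - p (g \<otimes> h)\<bar> \<le> 1" using p[of g] p[of "g \<otimes> h"] z 3(1) by auto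
      ultimately have "\<bar>wsum p q z - wsum p q (T z)\<bar> \<le> 1 + C * length x"
        using z by (simp add: 3 shift_simps wsum_def)
      also have "\<dots> \<le> (C + 1) * (real (length (fst z)) + 1)" by (simp add: z algebra_simps)
      finally show "\<bar>wsum p q z - wsum p q (T z)\<bar> \<le> real (C + 1) * (real (length (fst z)) + 1)" by (simp add: algebra_simps)
    qed
  qed
qed

end

context weighted_words
begin

section \<open>Normalised measures on words\<close>

definition word_measure :: "('g \<Rightarrow> 'g \<Rightarrow> real) \<Rightarrow> 'x list \<times> 'g \<Rightarrow> 'g \<Rightarrow> real" where
  "word_measure p z k = wsum (\<lambda>g. p g k) (\<lambda>y. orbit_average p y k) z / total z"

lemma word_measure_family:
  assumes p: "finite_prob_family (carrier G) E p"
  shows "finite_prob_family ZZ E (word_measure p)"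
  unfolding finite_prob_family_def
proof (intro conjI ballI allI impI)
  note P = finite_prob_familyD[OF p] and Q = finite_prob_familyD[OF orbit_average_family[OF p]]
  show "finite E" by (rule P(1))
  fix z assume "z \<in> ZZ"
  then obtain x g where z: "z = (x, g)" "x \<in> lists X" "g \<in> carrier G" unfolding ZZ_eq by blast
  have yX: "y \<in> X" if "y \<in> set x" for y using that z by auto
  show "0 \<le> word_measure p z k" for k
    unfolding word_measure_def wsum_def z(1) case_prod_conv
    using P(2)[OF z(3)] Q(2)[OF yX] weight_nonneg
    by (intro divide_nonneg_nonneg add_nonneg_nonneg sum_list_nonneg) auto
  show "word_measure p z k = 0" if "k \<notin> E" for k
  proof -
    have "map (\<lambda>y. weight (length x) y g * orbit_average p y k) x = map (\<lambda>y. 0) x"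
      using Q(3)[OF yX that] by (intro map_cong) auto
    then have "sum_list (map (\<lambda>y. weight (length x) y g * orbit_average p y k) x) = 0"
      by (simp only: sum_list_triv mult_zero_right)
    then show ?thesis using P(3)[OF z(3) that] by (simp only: word_measure_def wsum_def z(1) case_prod_conv) simp
  qed
  have eq: "map (\<lambda>y. \<Sum>k\<in>E. weight (length x) y g * orbit_average p y k) x = map (\<lambda>y. weight (length x) y g * 1) x"
    using Q(4)[OF yX] by (intro map_cong) (auto simp: sum_distrib_left[symmetric])
  have "(\<Sum>k\<in>E. wsum (\<lambda>g. p g k) (\<lambda>y. orbit_average p y k) z)
      = (\<Sum>k\<in>E. p g k) + sum_list (map (\<lambda>y. \<Sum>k\<in>E. weight (length x) y g * orbit_average p y k) x)"
    by (simp add: wsum_def z(1) sum.distrib sum_sum_list)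
  also have "\<dots> = total z" unfolding eq P(4)[OF z(3)] by (simp add: wsum_def z(1))
  finally show "(\<Sum>k\<in>E. word_measure p z k) = 1"
    unfolding word_measure_def sum_divide_distrib[symmetric] using total_pos[of z] by simp
qed

lemma word_measure_mem:
  assumes p: "finite_prob_family (carrier G) E p"
  shows "right_inv.coord (word_measure p) k \<in> shift_algebra ZZ GG T2"
  unfolding right_inv.coord_def right_inv.restrict_mem_iff
proof (intro conjI ballI)
  note F = word_measure_family[OF p]
  have bounds: "0 \<le> word_measure p z k" "word_measure p z k \<le> 1" if "z \<in> ZZ" for z
    using finite_prob_familyD(2)[OF F that] finite_prob_family_le_1[OF F that] by auto
  show "(\<lambda>z\<in>ZZ. complex_of_real (word_measure p z k)) \<in> linfty ZZ"
    by (rule linftyI[of _ _ 1]) (use bounds in simp)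
  fix T assume T: "T \<in> T2"
  let ?w = "wsum (\<lambda>g. p g k) (\<lambda>y. orbit_average p y k)"
  have "\<exists>K. \<forall>z\<in>ZZ. \<bar>?w z - ?w (T z)\<bar> \<le> K * (real (length (fst z)) + 1)"
    using finite_prob_familyD(2)[OF p] finite_prob_family_le_1[OF p]
      finite_prob_familyD(2)[OF orbit_average_family[OF p]]
      finite_prob_family_le_1[OF orbit_average_family[OF p]] by (intro wsum_shift[OF T]) auto
  then obtain K where K: "\<forall>z\<in>ZZ. \<bar>?w z - ?w (T z)\<bar> \<le> K * (real (length (fst z)) + 1)" by blast
  have "\<exists>K. \<forall>z\<in>ZZ. \<bar>total z - total (T z)\<bar> \<le> K * (real (length (fst z)) + 1)"
    by (intro wsum_shift[OF T]) auto
  then obtain K' where K': "\<forall>z\<in>ZZ. \<bar>total z - total (T z)\<bar> \<le> K' * (real (length (fst z)) + 1)" by blast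
  show "left_right.vanishing (\<lambda>z. complex_of_real (word_measure p z k) - complex_of_real (word_measure p (T z) k))"
  proof (rule left_right.vanishing_dominated1[OF ratio_vanishing, of _ "K + K'"])
    fix z assume z: "z \<in> ZZ"
    let ?b = "word_measure p (T z) k"
    have Tz: "T z \<in> ZZ" using T z by (rule right_inv.shift_closed)
    have pos: "total z > 0" "total (T z) > 0" using total_pos[of z] total_pos[of "T z"] by auto
    have w0: "0 \<le> ?w (T z)" using bounds(1)[OF Tz] pos(2) by (simp add: word_measure_def zero_le_divide_iff)
    have "\<bar>?w (T z) / total (T z) - ?w z / total z\<bar>
        \<le> (\<bar>?w (T z) - ?w z\<bar> + (?w (T z) / total (T z)) * \<bar>total (T z) - total z\<bar>) / total z"
      by (rule normalized_diff[OF pos w0])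
    also have "\<dots> \<le> (K * (real (length (fst z)) + 1) + 1 * (K' * (real (length (fst z)) + 1))) / total z"
      using K K' z bounds[OF Tz] pos
      by (intro divide_right_mono add_mono mult_mono) (auto simp: abs_minus_commute word_measure_def)
    also have "\<dots> = (K + K') * ratio z" by (simp add: ratio_def algebra_simps add_divide_distrib)
    finally have "\<bar>word_measure p z k - ?b\<bar> \<le> (K + K') * ratio z"
      by (simp add: word_measure_def abs_minus_commute)
    moreover have "0 \<le> ratio z" using pos by (simp add: ratio_def)
    ultimately show "norm (complex_of_real (word_measure p z k) - complex_of_real ?b) \<le> (K + K') * norm (ratio z)"
      by (simp add: of_real_diff[symmetric] del: of_real_diff)
  qed
qed

text \<open>The numerators account for \<open>2 * \<epsilon>\<close> relative to the mass and the
  normaliser for another \<open>\<epsilon>\<close>. Unlike invariance under shifts, this bound holds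
  at every point.\<close>

lemma word_measure_equivariant:
  assumes p: "finite_prob_family (carrier G) E p" and h: "h \<in> carrier G" and B: "finite B" "B \<subseteq> carrier G"
    and eq: "\<And>g. g \<in> carrier G \<Longrightarrow> (\<Sum>k\<in>B. \<bar>p (h \<otimes> g) k - p g (inv h \<otimes> k)\<bar>) \<le> \<epsilon>"
    and C: "\<And>y. y \<in> X \<Longrightarrow> len (\<pi> h y) \<le> len y + C" "\<And>y. y \<in> X \<Longrightarrow> len y \<le> len (\<pi> h y) + C"
    and L: "real C \<le> \<epsilon> * real L" and \<epsilon>: "\<epsilon> \<ge> 0" and z: "z \<in> ZZ"
  shows "(\<Sum>k\<in>B. \<bar>word_measure p (gact h z) k - word_measure p z (inv h \<otimes> k)\<bar>) \<le> 3 * \<epsilon>"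
proof -
  note F = word_measure_family[OF p]
  note Q = orbit_average_family[OF p]
  obtain x g where zx: "z = (x, g)" "x \<in> lists X" "g \<in> carrier G" using z unfolding ZZ_eq by blast
  let ?n = "length x" and ?t = "\<lambda>k. inv h \<otimes> k" and ?q = "orbit_average p"
  let ?w = "\<lambda>k. wsum (\<lambda>g. p g k) (\<lambda>y. ?q y k)"
  have hz: "gact h z = (map (\<pi> h) x, h \<otimes> g)" using z by (simp add: zx shift_simps)
  have hz_in: "gact h z \<in> ZZ" using z h shift_in_ZZ by blast
  have yX: "y \<in> X" if "y \<in> set x" for y using that zx by auto
  have depth: "\<bar>weight ?n (\<pi> h y) (h \<otimes> g) - weight ?n y g\<bar> \<le> C" if "y \<in> X" for y
  proof -
    \<comment> \<open>Left translation leaves the length seen from the right unchanged; only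
      \<open>len y\<close> varies.\<close>
    have "\<pi> (inv (h \<otimes> g)) (\<pi> h y) = \<pi> (inv g) (\<pi> (inv h) (\<pi> h y))"
      using h zx that act_in[OF h that] by (simp add: inv_mult_group act_mult)
    then have "\<pi> (inv (h \<otimes> g)) (\<pi> h y) = \<pi> (inv g) y" using act_inv_left[OF h that] by simp
    then show ?thesis using C[OF that] by (auto simp: weight_def depth_def)
  qed
  let ?W = "sum_list (map (\<lambda>y. weight ?n y g) x)"
  have W: "total z = 1 + ?W" by (simp add: wsum_def zx)
  \<comment> \<open>Each letter weighs at least \<open>L\<close>, so the accumulated error of
    \<open>C\<close> per letter is a small fraction of the mass.\<close>
  have nC: "C * real ?n \<le> \<epsilon> * ?W"
  proof -
    have "sum_list (map (\<lambda>y. real L) x) \<le> ?W" by (rule sum_list_mono) (simp add: weight_def)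
    then have "real ?n * L \<le> ?W" by (simp add: sum_list_triv)
    then have "\<epsilon> * (real ?n * L) \<le> \<epsilon> * ?W" using \<epsilon> by (rule mult_left_mono)
    moreover have "C * real ?n \<le> (\<epsilon> * L) * real ?n" using L by (intro mult_right_mono) auto
    ultimately show ?thesis by (simp add: mult_ac)
  qed
  have tot: "\<bar>total (gact h z) - total z\<bar> \<le> C * real ?n"
  proof -
    have "\<bar>sum_list (map (\<lambda>y. weight ?n (\<pi> h y) (h \<otimes> g)) x) - ?W\<bar> \<le> C * real ?n"
      by (rule sum_list_abs_diff) (use depth yX in blast)
    moreover have "total (gact h z) = 1 + sum_list (map (\<lambda>y. weight ?n (\<pi> h y) (h \<otimes> g)) x)"
      unfolding hz wsum_def by (simp add: o_def)
    ultimately show ?thesis by (simp add: W)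
  qed
  have "(\<Sum>k\<in>B. \<bar>?w k (gact h z) - ?w (?t k) z\<bar>)
      = (\<Sum>k\<in>B. \<bar>(p (h \<otimes> g) k - p g (?t k)) + sum_list (map (\<lambda>y.
           weight ?n (\<pi> h y) (h \<otimes> g) * ?q (\<pi> h y) k - weight ?n y g * ?q y (?t k)) x)\<bar>)"
  proof (intro sum.cong refl)
    fix k
    have "?w k (gact h z) = p (h \<otimes> g) k
        + sum_list (map (\<lambda>y. weight ?n (\<pi> h y) (h \<otimes> g) * ?q (\<pi> h y) k) x)"
      unfolding hz wsum_def by (simp add: o_def)
    moreover have "?w (?t k) z = p g (?t k) + sum_list (map (\<lambda>y. weight ?n y g * ?q y (?t k)) x)"
      unfolding zx(1) wsum_def by simp
    ultimately show "\<bar>?w k (gact h z) - ?w (?t k) z\<bar> = \<bar>(p (h \<otimes> g) k - p g (?t k)) + sum_list (map (\<lambda>y.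
           weight ?n (\<pi> h y) (h \<otimes> g) * ?q (\<pi> h y) k - weight ?n y g * ?q y (?t k)) x)\<bar>"
      by (simp only: sum_list_subtractf)
  qed
  also have "\<dots> \<le> (\<Sum>k\<in>B. \<bar>p (h \<otimes> g) k - p g (?t k)\<bar>) + (\<Sum>k\<in>B. \<bar>sum_list (map (\<lambda>y.
           weight ?n (\<pi> h y) (h \<otimes> g) * ?q (\<pi> h y) k - weight ?n y g * ?q y (?t k)) x)\<bar>)"
    unfolding sum.distrib[symmetric] by (intro sum_mono abs_triangle_ineq)
  also have "\<dots> \<le> \<epsilon> + sum_list (map (\<lambda>y. \<Sum>k\<in>B. \<bar>weight ?n (\<pi> h y) (h \<otimes> g) * ?q (\<pi> h y) k - weight ?n y g * ?q y (?t k)\<bar>) x)"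
    by (intro add_mono eq zx sum_abs_sum_list_le)
  also have "\<dots> \<le> \<epsilon> + sum_list (map (\<lambda>y. C + \<epsilon> * weight ?n y g) x)"
  proof (intro add_left_mono sum_list_mono)
    fix y assume "y \<in> set x"
    then have y: "y \<in> X" by (rule yX)
    have hy: "\<pi> h y \<in> X" by (rule act_in[OF h y])
    have "(\<Sum>k\<in>B. \<bar>weight ?n (\<pi> h y) (h \<otimes> g) * ?q (\<pi> h y) k - weight ?n y g * ?q y (?t k)\<bar>)
        \<le> (\<Sum>k\<in>B. C * ?q (\<pi> h y) k + weight ?n y g * \<bar>?q (\<pi> h y) k - ?q y (?t k)\<bar>)"
    proof (rule sum_mono)
      fix k
      have q0: "0 \<le> ?q (\<pi> h y) k" using finite_prob_familyD(2)[OF Q hy] .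
      have e: "weight ?n (\<pi> h y) (h \<otimes> g) * ?q (\<pi> h y) k - weight ?n y g * ?q y (?t k)
          = (weight ?n (\<pi> h y) (h \<otimes> g) - weight ?n y g) * ?q (\<pi> h y) k
            + weight ?n y g * (?q (\<pi> h y) k - ?q y (?t k))" by (simp add: algebra_simps)
      have "\<bar>weight ?n (\<pi> h y) (h \<otimes> g) * ?q (\<pi> h y) k - weight ?n y g * ?q y (?t k)\<bar>
          \<le> \<bar>weight ?n (\<pi> h y) (h \<otimes> g) - weight ?n y g\<bar> * ?q (\<pi> h y) k
            + weight ?n y g * \<bar>?q (\<pi> h y) k - ?q y (?t k)\<bar>"
        unfolding e using q0 weight_nonneg by (rule abs_mult_add_le)
      also have "\<dots> \<le> C * ?q (\<pi> h y) k + weight ?n y g * \<bar>?q (\<pi> h y) k - ?q y (?t k)\<bar>"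
        using depth[OF y] q0 by (intro add_right_mono mult_right_mono) auto
      finally show "\<bar>weight ?n (\<pi> h y) (h \<otimes> g) * ?q (\<pi> h y) k - weight ?n y g * ?q y (?t k)\<bar>
          \<le> C * ?q (\<pi> h y) k + weight ?n y g * \<bar>?q (\<pi> h y) k - ?q y (?t k)\<bar>" .
    qed
    also have "\<dots> = C * (\<Sum>k\<in>B. ?q (\<pi> h y) k) + weight ?n y g * (\<Sum>k\<in>B. \<bar>?q (\<pi> h y) k - ?q y (?t k)\<bar>)"
      by (simp add: sum.distrib sum_distrib_left)
    also have "\<dots> \<le> real C * 1 + weight ?n y g * \<epsilon>"
      using finite_prob_family_sum_le[OF Q hy B(1)] orbit_average_equivariant[where p = p and B = B, OF h y eq] weight_nonneg
      by (intro add_mono mult_left_mono) auto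
    finally show "(\<Sum>k\<in>B. \<bar>weight ?n (\<pi> h y) (h \<otimes> g) * ?q (\<pi> h y) k - weight ?n y g * ?q y (?t k)\<bar>)
        \<le> C + \<epsilon> * weight ?n y g" by (simp add: mult.commute)
  qed
  also have "\<dots> = \<epsilon> + (C * real ?n + \<epsilon> * ?W)"
    by (simp add: sum_list_addf sum_list_triv sum_list_const_mult mult.commute)
  \<comment> \<open>The group coordinate contributes \<open>\<epsilon>\<close>; the changes of the
    weights and of the averages contribute at most \<open>\<epsilon> * ?W\<close> each, where the
    mass is \<open>1 + ?W\<close>.\<close>
  finally have diff: "(\<Sum>k\<in>B. \<bar>?w k (gact h z) - ?w (?t k) z\<bar>) \<le> 2 * \<epsilon> * total z"
    using nC \<epsilon> by (simp add: W algebra_simps)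
  have pos: "total z > 0" "total (gact h z) > 0" using total_pos[of z] total_pos[of "gact h z"] by auto
  have "(\<Sum>k\<in>B. \<bar>word_measure p (gact h z) k - word_measure p z (?t k)\<bar>)
      \<le> (\<Sum>k\<in>B. (\<bar>?w k (gact h z) - ?w (?t k) z\<bar>
            + word_measure p (gact h z) k * \<bar>total (gact h z) - total z\<bar>) / total z)"
  proof (rule sum_mono)
    fix k
    have "0 \<le> ?w k (gact h z)"
      using finite_prob_familyD(2)[OF F hz_in, of k] pos(2) by (simp add: word_measure_def zero_le_divide_iff)
    from normalized_diff[OF pos this]
    show "\<bar>word_measure p (gact h z) k - word_measure p z (?t k)\<bar> \<le> (\<bar>?w k (gact h z) - ?w (?t k) z\<bar>
            + word_measure p (gact h z) k * \<bar>total (gact h z) - total z\<bar>) / total z"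
      by (simp add: word_measure_def)
  qed
  also have "\<dots> = ((\<Sum>k\<in>B. \<bar>?w k (gact h z) - ?w (?t k) z\<bar>)
      + (\<Sum>k\<in>B. word_measure p (gact h z) k) * \<bar>total (gact h z) - total z\<bar>) / total z"
    by (simp add: sum_divide_distrib[symmetric] sum.distrib sum_distrib_right)
  also have "\<dots> \<le> (2 * \<epsilon> * total z + 1 * (\<epsilon> * total z)) / total z"
  proof (intro divide_right_mono add_mono mult_mono diff)
    show "(\<Sum>k\<in>B. word_measure p (gact h z) k) \<le> 1" by (rule finite_prob_family_sum_le[OF F hz_in B(1)])
    have "\<epsilon> * ?W \<le> \<epsilon> * total z" using \<epsilon> by (intro mult_left_mono) (auto simp: W)
    then show "\<bar>total (gact h z) - total z\<bar> \<le> \<epsilon> * total z" using tot nC by linarith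
  qed (use pos in auto)
  also have "\<dots> = 3 * \<epsilon>" using pos by (simp add: field_simps)
  finally show ?thesis .
qed

end

context word_action
begin

section \<open>Amenability of the left action and of the bi-action\<close>

lemma left_approx:
  assumes D: "finite D" "D \<subseteq> carrier G" and \<epsilon>: "\<epsilon> > 0"
  obtains E f where "finite_prob_family ZZ E f" "E \<subseteq> carrier G"
    "\<forall>k. right_inv.coord f k \<in> shift_algebra ZZ GG T2"
    "\<forall>h\<in>D. \<forall>B. finite B \<longrightarrow> B \<subseteq> carrier G \<longrightarrow>
       (\<forall>z\<in>ZZ. (\<Sum>k\<in>B. \<bar>f (gact h z) k - f z (inv h \<otimes> k)\<bar>) \<le> \<epsilon>)"
proof -
  obtain E p where p: "finite_prob_family (carrier G) E p" "E \<subseteq> carrier G"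
    and eq: "\<And>h g B. h \<in> D \<Longrightarrow> g \<in> carrier G \<Longrightarrow> finite B \<Longrightarrow> B \<subseteq> carrier G \<Longrightarrow>
       (\<Sum>k\<in>B. \<bar>p (h \<otimes> g) k - p g (inv h \<otimes> k)\<bar>) \<le> \<epsilon> / 3"
    using exact_group_finite_support[OF group_G exact D, of "\<epsilon> / 3"] \<epsilon> by auto
  obtain len :: "'x \<Rightarrow> nat" where fin: "\<And>n. finite {y \<in> X. len y \<le> n}"
    and lip: "\<And>h. h \<in> carrier G \<Longrightarrow> \<exists>C. \<forall>y\<in>X. len (\<pi> h y) \<le> len y + C"
    using length_function by blast
  \<comment> \<open>The provisional value 0 gives access to the Lipschitz constants, on which the
    final \<open>L\<close> depends.\<close>
  interpret w0: weighted_words G X \<pi> len 0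
    by unfold_locales (use fin lip in auto)
  have "\<exists>C. (\<forall>y\<in>X. len (\<pi> h y) \<le> len y + C) \<and> (\<forall>y\<in>X. len y \<le> len (\<pi> h y) + C)" if "h \<in> D" for h
    using w0.length_lipschitz[of h] that D(2) by (metis subsetD)
  then obtain C where C: "\<And>h. h \<in> D \<Longrightarrow> (\<forall>y\<in>X. len (\<pi> h y) \<le> len y + C h) \<and> (\<forall>y\<in>X. len y \<le> len (\<pi> h y) + C h)"
    by metis
  \<comment> \<open>The sum dominates every single constant; the factor 3 matches the tolerance
    \<open>\<epsilon> / 3\<close>, chosen because equivariance of the word measures costs a factor
    3.\<close>
  define L where "L = nat \<lceil>3 * (\<Sum>h\<in>D. C h) / \<epsilon>\<rceil>"
  have L: "real (C h) \<le> \<epsilon> / 3 * real L" if "h \<in> D" for h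
  proof -
    have "real (C h) \<le> real (\<Sum>h\<in>D. C h)"
      using D(1) that by (intro of_nat_mono member_le_sum) auto
    moreover have "3 * real (\<Sum>h\<in>D. C h) / \<epsilon> \<le> real L" unfolding L_def by linarith
    then have "3 * real (\<Sum>h\<in>D. C h) \<le> real L * \<epsilon>" using \<epsilon> by (simp only: pos_divide_le_eq)
    ultimately have "3 * real (C h) \<le> real L * \<epsilon>" by linarith
    then show ?thesis by (simp add: mult.commute)
  qed
  interpret w: weighted_words G X \<pi> len L
    by unfold_locales (use fin lip in auto)
  show ?thesis
  proof (rule that[OF w.word_measure_family[OF p(1)] p(2)], intro allI w.word_measure_mem[OF p(1)], intro ballI allI impI)
    fix h B z assume h: "h \<in> D" and B: "finite B" "B \<subseteq> carrier G" and z: "z \<in> ZZ"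
    have "(\<Sum>k\<in>B. \<bar>w.word_measure p (gact h z) k - w.word_measure p z (inv h \<otimes> k)\<bar>) \<le> 3 * (\<epsilon> / 3)"
      by (rule w.word_measure_equivariant[OF p(1) _ B eq[OF h _ B] _ _ L[OF h] _ z])
         (use h D(2) C[OF h] \<epsilon> in auto)
    then show "(\<Sum>k\<in>B. \<bar>w.word_measure p (gact h z) k - w.word_measure p z (inv h \<otimes> k)\<bar>) \<le> \<epsilon>" by simp
  qed
qed

lemma amenable_C_boundary: "amenable_action G (C_boundary G X \<pi> GG) (left_action G X \<pi>)"
proof -
  have "amenable_action G (quotient_algebra (function_algebra ZZ (shift_algebra ZZ GG T2)) (c0 ZZ GG)) (left_action G X \<pi>)"
  proof (rule left.amenable_actionI[OF _ countable_G])
    fix h C assume "h \<in> carrier G"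
    show "left_action G X \<pi> h C = (\<lambda>f. \<lambda>z\<in>ZZ. f (gact (inv h) z)) ` C"
      unfolding left_action_def Let_def left_translate_def ZM_def[symmetric] ZZ_def[symmetric] gact_def by simp
  next
    fix D :: "'g set" and \<epsilon> :: real assume D: "finite D" "D \<subseteq> carrier G" and \<epsilon>: "\<epsilon> > 0"
    obtain E f where f: "finite_prob_family ZZ E f" "E \<subseteq> carrier G"
        "\<forall>k. right_inv.coord f k \<in> shift_algebra ZZ GG T2"
      and eq': "\<forall>h\<in>D. \<forall>B. finite B \<longrightarrow> B \<subseteq> carrier G \<longrightarrow>
        (\<forall>z\<in>ZZ. (\<Sum>k\<in>B. \<bar>f (gact h z) k - f z (inv h \<otimes> k)\<bar>) \<le> \<epsilon>)"
      by (rule left_approx[OF D \<epsilon>])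
    have eq: "(\<Sum>k\<in>B. \<bar>f (gact h z) k - f z (inv h \<otimes> k)\<bar>) \<le> \<epsilon>"
      if "h \<in> D" "finite B" "B \<subseteq> carrier G" "z \<in> ZZ" for h B z
      using eq'[rule_format, OF that] .
    have "small_rel GG {z \<in> ZZ. (\<Sum>k\<in>B. \<bar>f (gact h z) k - f z (inv h \<otimes> k)\<bar>) > \<epsilon>}"
      if "h \<in> D" "finite B" "B \<subseteq> carrier G" for h B
      by (rule left_right.small_mono[OF left_right.small_empty]) (use eq[OF that] in fastforce)
    with f have "left.approx_equivariant D \<epsilon> E f" unfolding left.approx_equivariant_def by simp
    then show "\<exists>E f. left.approx_equivariant D \<epsilon> E f" by blast
  qed
  then show ?thesis
    unfolding C_boundary_def Let_def ZM_def[symmetric] ZZ_def[symmetric] C_closure_eq .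
qed

lemma star_lract:
  assumes "z \<in> ZZ" "h1 \<in> carrier G" "h2 \<in> carrier G"
  shows "star (lract (h1, h2) z) = lract (h2, h1) (star z)"
proof -
  obtain x g where z: "z = (x, g)" "(x, g) \<in> ZZ" "x \<in> lists X" "g \<in> carrier G"
    using assms(1) unfolding ZZ_eq by blast
  have i: "inv (h1 \<otimes> g \<otimes> inv h2) = h2 \<otimes> inv g \<otimes> inv h1"
    using z assms by (simp add: inv_mult_group m_assoc)
  have "\<pi> (h2 \<otimes> inv g \<otimes> inv h1) (\<pi> h1 y) = \<pi> h2 (\<pi> (inv g) y)" if "y \<in> X" for y
    using that z(4) assms(2,3) by (simp add: act_mult act_in act_inv_left)
  then have "map (\<pi> (h2 \<otimes> inv g \<otimes> inv h1)) (map (\<pi> h1) (rev x)) = map (\<pi> h2) (map (\<pi> (inv g)) (rev x))"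
    using z(3) by auto
  then show ?thesis
    using shift_in_ZZ(5)[OF z(2)] z assms i by (simp add: lract_eq shift_simps rev_map)
qed

lemma star_shift:
  assumes "z \<in> ZZ" "s \<in> lists X"
  shows "star (lshift s z) = rshift (rev s) (star z)" "star (rshift s z) = lshift (rev s) (star z)"
proof -
  obtain x g where z: "z = (x, g)" "(x, g) \<in> ZZ" "x \<in> lists X" "g \<in> carrier G"
    using assms(1) unfolding ZZ_eq by blast
  show "star (lshift s z) = rshift (rev s) (star z)"
    using shift_in_ZZ(5)[OF z(2)] z by (simp add: shift_simps)
  have "map (\<pi> (inv g)) (rev (map (\<pi> g) s)) = rev s"
    using z assms(2) act_inv_left by (auto simp: rev_map intro!: map_idI)
  then show "star (rshift s z) = lshift (rev s) (star z)"
    using shift_in_ZZ(5)[OF z(2)] z by (simp add: shift_simps rev_map)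
qed

text \<open>\<open>star\<close> exchanges left and right insertions, so it preserves the algebra for
  \<open>T1\<close>. It turns right multiplication by a group element into left translation, over
  which \<open>T2\<close> gives no control.\<close>

lemma star_mem:
  assumes "f \<in> shift_algebra ZZ GG T1" shows "(\<lambda>z\<in>ZZ. f (star z)) \<in> shift_algebra ZZ GG T1"
proof (rule left_right.comp_mem[OF assms shift_in_ZZ(5) small_shift(5)])
  fix T assume "T \<in> T1"
  then consider s where "s \<in> lists X" "T = lshift s" | s where "s \<in> lists X" "T = rshift s"
    unfolding T1_def by blast
  then show "\<exists>T'\<in>T1. \<forall>z\<in>ZZ. star (T z) = T' (star z)"
  proof cases
    case (1 s)
    then show ?thesis using star_shift(1) by (intro bexI[of _ "rshift (rev s)"]) (auto simp: T1_def)
  next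
    case (2 s)
    then show ?thesis using star_shift(2) by (intro bexI[of _ "lshift (rev s)"]) (auto simp: T1_def)
  qed
qed

text \<open>The coordinates are invariant under right multiplication by \<open>inv h2\<close> up to
  a vanishing function, so \<open>f\<close> follows \<open>h1\<close> and ignores \<open>h2\<close>
  off a small set. One \<open>\<epsilon>\<close> pays for each of the two translations.\<close>

lemma two_sided_small:
  assumes mem: "\<And>k. right_inv.coord f k \<in> shift_algebra ZZ GG T2" and \<epsilon>: "\<epsilon> > 0"
    and h1: "h1 \<in> carrier G" and h2: "h2 \<in> carrier G" and B: "finite B"
    and eq: "\<And>z. z \<in> ZZ \<Longrightarrow> (\<Sum>k\<in>B. \<bar>f (gact h1 z) k - f z (inv h1 \<otimes> k)\<bar>) \<le> \<epsilon>"
  shows "small_rel GG {z \<in> ZZ. (\<Sum>k\<in>B. \<bar>f (lract (h1, h2) z) k - f z (inv h1 \<otimes> k)\<bar>) > 2 * \<epsilon>}"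
proof -
  let ?g = "\<lambda>z. \<Sum>k\<in>B. \<bar>f z k - f (gshift (inv h2) z) k\<bar>"
  have "left_right.vanishing (\<lambda>z. \<bar>f z k - f (gshift (inv h2) z) k\<bar>)" for k
  proof -
    have "gshift (inv h2) \<in> T2" using h2 by (simp add: T2_def)
    then have "left_right.vanishing (\<lambda>z. right_inv.coord f k z - right_inv.coord f k (gshift (inv h2) z))"
      using mem[of k] by (auto simp: right_inv.mem_iff)
    then show ?thesis
    proof (rule left_right.vanishing_dominated1[where K = 1])
      fix z assume "z \<in> ZZ"
      then show "norm \<bar>f z k - f (gshift (inv h2) z) k\<bar>
          \<le> 1 * norm (right_inv.coord f k z - right_inv.coord f k (gshift (inv h2) z))"
        using shift_in_ZZ(3)[of z "inv h2"] h2
        by (simp add: right_inv.coord_def of_real_diff[symmetric] del: of_real_diff)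
    qed
  qed
  then have v: "left_right.vanishing ?g" by (intro left_right.vanishing_sum[OF B])
  have "left_right.vanishing (\<lambda>z. ?g (gact h1 z))"
    by (rule left_right.vanishing_comp[OF v shift_in_ZZ(4)[OF _ h1] small_shift(4)[OF _ h1]])
  then have "small_rel GG {z \<in> ZZ. norm (?g (gact h1 z)) > \<epsilon>}"
    using \<epsilon> unfolding left_right.vanishing_def by blast
  then show ?thesis
  proof (rule left_right.small_mono, intro subsetI)
    fix z assume "z \<in> {z \<in> ZZ. (\<Sum>k\<in>B. \<bar>f (lract (h1, h2) z) k - f z (inv h1 \<otimes> k)\<bar>) > 2 * \<epsilon>}"
    then have z: "z \<in> ZZ" and gt: "(\<Sum>k\<in>B. \<bar>f (lract (h1, h2) z) k - f z (inv h1 \<otimes> k)\<bar>) > 2 * \<epsilon>" by auto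
    have comm: "gshift (inv h2) (gact h1 z) = lract (h1, h2) z"
    proof -
      obtain x g where "z = (x, g)" "(x, g) \<in> ZZ" using z by (cases z) auto
      then show ?thesis using h1 h2 shift_in_ZZ(4)[of z h1] by (simp add: shift_simps lract_eq)
    qed
    have "(\<Sum>k\<in>B. \<bar>f (lract (h1, h2) z) k - f z (inv h1 \<otimes> k)\<bar>)
        \<le> (\<Sum>k\<in>B. \<bar>f (gact h1 z) k - f (lract (h1, h2) z) k\<bar> + \<bar>f (gact h1 z) k - f z (inv h1 \<otimes> k)\<bar>)"
      by (intro sum_mono) linarith
    also have "\<dots> \<le> ?g (gact h1 z) + \<epsilon>" unfolding sum.distrib comm using eq[OF z] by simp
    finally have "?g (gact h1 z) > \<epsilon>" using gt by linarith
    then show "z \<in> {z \<in> ZZ. norm (?g (gact h1 z)) > \<epsilon>}" using z by auto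
  qed
qed

lemma T1_subset: "shift_algebra ZZ GG T2 \<subseteq> shift_algebra ZZ GG T1"
  by (auto simp: shift_algebra_def T2_def)

lemma bi_exact: "bi_exact_rel G X \<pi> GG"
proof -
  have "amenable_action (G \<times>\<times> G) (quotient_algebra (function_algebra ZZ (shift_algebra ZZ GG T1)) (c0 ZZ GG))
      (left_right_action G X \<pi>)"
  proof (rule both.amenable_actionI)
    show "countable (carrier (G \<times>\<times> G))" using countable_G by simp
    fix h C assume "h \<in> carrier (G \<times>\<times> G)"
    then obtain h1 h2 where h: "h = (h1, h2)" "h1 \<in> carrier G" "h2 \<in> carrier G" by (cases h) auto
    have "left_translate ZM ([], inv h1) (right_translate ZM ([], h2) f) = (\<lambda>z\<in>ZZ. f (lract (inv h1, inv h2) z))" for f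
    proof (rule ext)
      fix z
      have "gshift h2 (gact (inv h1) z) = lract (inv h1, inv h2) z" "gact (inv h1) z \<in> ZZ" if "z \<in> ZZ"
      proof -
        obtain x g where "z = (x, g)" "(x, g) \<in> ZZ" using \<open>z \<in> ZZ\<close> by (cases z) auto
        then show "gact (inv h1) z \<in> ZZ" "gshift h2 (gact (inv h1) z) = lract (inv h1, inv h2) z"
          using h shift_in_ZZ(4)[of z "inv h1"] by (simp_all add: shift_simps lract_eq)
      qed
      then show "left_translate ZM ([], inv h1) (right_translate ZM ([], h2) f) z
          = (\<lambda>z\<in>ZZ. f (lract (inv h1, inv h2) z)) z"
        by (simp add: left_translate_def right_translate_def ZZ_def[symmetric] gact_def[symmetric] gshift_def[symmetric])
    qed
    then show "left_right_action G X \<pi> h C = (\<lambda>f. \<lambda>z\<in>ZZ. f (lract (inv\<^bsub>G \<times>\<times> G\<^esub> h) z)) ` C"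
      using h by (simp add: left_right_action_def Let_def ZM_def[symmetric] inv_DirProd group_G)
  next
    fix D :: "('g \<times> 'g) set" and \<epsilon> :: real
    assume D: "finite D" "D \<subseteq> carrier (G \<times>\<times> G)" and \<epsilon>: "\<epsilon> > 0"
    define D' where "D' = fst ` D \<union> snd ` D"
    have D': "finite D'" "D' \<subseteq> carrier G" using D by (auto simp: D'_def)
    \<comment> \<open>Each factor of the product costs \<open>2 * (\<epsilon> / 4)\<close> off a
      small set, and there are two factors.\<close>
    have e4: "\<epsilon> / 4 > 0" using \<epsilon> by simp
    obtain E f where f: "finite_prob_family ZZ E f" "E \<subseteq> carrier G"
        "\<forall>k. right_inv.coord f k \<in> shift_algebra ZZ GG T2"
      and eq': "\<forall>h\<in>D'. \<forall>B. finite B \<longrightarrow> B \<subseteq> carrier G \<longrightarrow>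
        (\<forall>z\<in>ZZ. (\<Sum>k\<in>B. \<bar>f (gact h z) k - f z (inv h \<otimes> k)\<bar>) \<le> \<epsilon> / 4)"
      by (rule left_approx[OF D' e4])
    have eq: "(\<Sum>k\<in>B. \<bar>f (gact h z) k - f z (inv h \<otimes> k)\<bar>) \<le> \<epsilon> / 4"
      if "h \<in> D'" "finite B" "B \<subseteq> carrier G" "z \<in> ZZ" for h B z
      using eq'[rule_format, OF that] .
    note P = finite_prob_familyD[OF f(1)]
    have star: "star z \<in> ZZ" if "z \<in> ZZ" for z using that shift_in_ZZ by blast
    \<comment> \<open>The first factor follows \<open>h1\<close>; the second, read at
      \<open>star z\<close>, follows \<open>h2\<close> because \<open>star\<close> swaps the two
      coordinates of the acting group.\<close>
    define F where "F z = (\<lambda>(k, l). f z k * f (star z) l)" for z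
    have fam: "finite_prob_family ZZ (E \<times> E) F"
      unfolding finite_prob_family_def
    proof (intro conjI ballI allI impI)
      fix z assume z: "z \<in> ZZ"
      show "0 \<le> F z k" for k using P(2) z star by (simp add: F_def split_beta)
      show "F z k = 0" if "k \<notin> E \<times> E" for k using that P(3)[OF z] P(3)[OF star[OF z]] by (cases k) (auto simp: F_def)
      have "(\<Sum>k\<in>E \<times> E. F z k) = (\<Sum>k\<in>E. f z k) * (\<Sum>l\<in>E. f (star z) l)"
        unfolding F_def sum_product sum.cartesian_product by simp
      then show "(\<Sum>k\<in>E \<times> E. F z k) = 1" using P(4) z star by simp
    qed (use P in auto)
    have mem: "left_right.coord F k \<in> shift_algebra ZZ GG T1" for k
    proof -
      have c: "right_inv.coord f k \<in> shift_algebra ZZ GG T1" for k using f(3) T1_subset by blast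
      have "(\<lambda>z\<in>ZZ. right_inv.coord f (fst k) z * (\<lambda>z\<in>ZZ. right_inv.coord f (snd k) (star z)) z)
          \<in> shift_algebra ZZ GG T1"
        by (intro left_right.mult_mem star_mem c)
      also have "(\<lambda>z\<in>ZZ. right_inv.coord f (fst k) z * (\<lambda>z\<in>ZZ. right_inv.coord f (snd k) (star z)) z)
          = left_right.coord F k"
        unfolding right_inv.coord_def left_right.coord_def F_def
        by (rule restrict_ext) (simp add: star split_beta)
      finally show ?thesis .
    qed
    have "small_rel GG {z \<in> ZZ. (\<Sum>k\<in>B. \<bar>F (lract h z) k - F z (inv\<^bsub>G \<times>\<times> G\<^esub> h \<otimes>\<^bsub>G \<times>\<times> G\<^esub> k)\<bar>) > \<epsilon>}"
      if hD: "h \<in> D" and B: "finite B" "B \<subseteq> carrier (G \<times>\<times> G)" for h B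
    proof -
      obtain h1 h2 where h: "h = (h1, h2)" "h1 \<in> carrier G" "h2 \<in> carrier G"
        using hD D(2) by (cases h) auto
      have hD': "h1 \<in> D'" "h2 \<in> D'" using hD unfolding D'_def h(1) by force+
      \<comment> \<open>Enlarging \<open>B\<close> to the product of its projections lets the double
        sum factor.\<close>
      define B1 where "B1 = fst ` B"
      define B2 where "B2 = snd ` B"
      have BB: "finite B1" "B1 \<subseteq> carrier G" "finite B2" "B2 \<subseteq> carrier G" "B \<subseteq> B1 \<times> B2"
        using B by (force simp: B1_def B2_def)+
      let ?S1 = "\<lambda>z. \<Sum>k\<in>B1. \<bar>f (lract (h1, h2) z) k - f z (inv h1 \<otimes> k)\<bar>"
      let ?S2 = "\<lambda>z. \<Sum>l\<in>B2. \<bar>f (lract (h2, h1) z) l - f z (inv h2 \<otimes> l)\<bar>"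
      have s1: "small_rel GG {z \<in> ZZ. ?S1 z > 2 * (\<epsilon> / 4)}"
        by (rule two_sided_small[OF f(3)[rule_format] e4 h(2,3) BB(1) eq[OF hD'(1) BB(1,2)]])
      have s2: "small_rel GG {z \<in> ZZ. ?S2 z > 2 * (\<epsilon> / 4)}"
        by (rule two_sided_small[OF f(3)[rule_format] e4 h(3,2) BB(3) eq[OF hD'(2) BB(3,4)]])
      have "small_rel GG ({z \<in> ZZ. ?S1 z > 2 * (\<epsilon> / 4)} \<union> {z \<in> ZZ. star z \<in> {z \<in> ZZ. ?S2 z > 2 * (\<epsilon> / 4)}})"
        by (intro left_right.small_Un s1 small_shift(5) s2)
      then show ?thesis
      proof (rule left_right.small_mono, intro subsetI)
        fix z assume "z \<in> {z \<in> ZZ. (\<Sum>k\<in>B. \<bar>F (lract h z) k - F z (inv\<^bsub>G \<times>\<times> G\<^esub> h \<otimes>\<^bsub>G \<times>\<times> G\<^esub> k)\<bar>) > \<epsilon>}"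
        then have z: "z \<in> ZZ" and gt: "(\<Sum>k\<in>B. \<bar>F (lract h z) k - F z (inv\<^bsub>G \<times>\<times> G\<^esub> h \<otimes>\<^bsub>G \<times>\<times> G\<^esub> k)\<bar>) > \<epsilon>" by auto
        have lz: "lract (h1, h2) z \<in> ZZ" "lract (h2, h1) (star z) \<in> ZZ"
          using both.act_closed[of "(h1, h2)" z] both.act_closed[of "(h2, h1)" "star z"] h z star by auto
        let ?a = "f (lract (h1, h2) z)" and ?b = "f (lract (h2, h1) (star z))"
        let ?a' = "\<lambda>k. f z (inv h1 \<otimes> k)" and ?b' = "\<lambda>l. f (star z) (inv h2 \<otimes> l)"
        have nn: "0 \<le> ?b l" "0 \<le> ?a' k" for k l using P(2) lz z by auto
        have c1: "(\<Sum>k\<in>B. \<bar>F (lract h z) k - F z (inv\<^bsub>G \<times>\<times> G\<^esub> h \<otimes>\<^bsub>G \<times>\<times> G\<^esub> k)\<bar>)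
            = (\<Sum>(k, l)\<in>B. \<bar>?a k * ?b l - ?a' k * ?b' l\<bar>)"
          using h z by (intro sum.cong) (auto simp: F_def star_lract inv_DirProd group_G)
        have c2: "(\<Sum>(k, l)\<in>B. \<bar>?a k * ?b l - ?a' k * ?b' l\<bar>)
            \<le> (\<Sum>(k, l)\<in>B1 \<times> B2. \<bar>?a k * ?b l - ?a' k * ?b' l\<bar>)"
          using BB by (intro sum_mono2) auto
        have c3: "(\<Sum>(k, l)\<in>B1 \<times> B2. \<bar>?a k * ?b l - ?a' k * ?b' l\<bar>)
            \<le> (\<Sum>(k, l)\<in>B1 \<times> B2. \<bar>?a k - ?a' k\<bar> * ?b l + ?a' k * \<bar>?b l - ?b' l\<bar>)"
        proof (rule sum_mono, clarsimp)
          fix k l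
          have e: "?a k * ?b l - ?a' k * ?b' l = (?a k - ?a' k) * ?b l + ?a' k * (?b l - ?b' l)"
            by (simp add: algebra_simps)
          show "\<bar>?a k * ?b l - ?a' k * ?b' l\<bar> \<le> \<bar>?a k - ?a' k\<bar> * ?b l + ?a' k * \<bar>?b l - ?b' l\<bar>"
            unfolding e by (rule abs_mult_add_le) (use nn in auto)
        qed
        have c4: "(\<Sum>(k, l)\<in>B1 \<times> B2. \<bar>?a k - ?a' k\<bar> * ?b l + ?a' k * \<bar>?b l - ?b' l\<bar>)
            = (\<Sum>k\<in>B1. \<bar>?a k - ?a' k\<bar>) * (\<Sum>l\<in>B2. ?b l)
            + (\<Sum>k\<in>B1. ?a' k) * (\<Sum>l\<in>B2. \<bar>?b l - ?b' l\<bar>)"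
          by (simp add: sum_product sum.cartesian_product sum.distrib split_beta)
        have c5: "(\<Sum>k\<in>B1. \<bar>?a k - ?a' k\<bar>) * (\<Sum>l\<in>B2. ?b l)
            + (\<Sum>k\<in>B1. ?a' k) * (\<Sum>l\<in>B2. \<bar>?b l - ?b' l\<bar>)
            \<le> ?S1 z * 1 + 1 * ?S2 (star z)"
        proof (intro add_mono mult_mono)
          show "(\<Sum>l\<in>B2. ?b l) \<le> 1" by (rule finite_prob_family_sum_le[OF f(1) lz(2) BB(3)])
          have "(\<Sum>k\<in>B1. ?a' k) = (\<Sum>k\<in>(\<lambda>k. inv h1 \<otimes> k) ` B1. f z k)"
            using inj_on_subset[OF inj_on_cmult[OF inv_closed[OF h(2)]] BB(2)] by (simp add: sum.reindex)
          then show "(\<Sum>k\<in>B1. ?a' k) \<le> 1"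
            using finite_prob_family_sum_le[OF f(1) z finite_imageI[OF BB(1)], of "\<lambda>k. inv h1 \<otimes> k"] by linarith
        qed (auto intro!: sum_nonneg nn)
        have "(\<Sum>k\<in>B. \<bar>F (lract h z) k - F z (inv\<^bsub>G \<times>\<times> G\<^esub> h \<otimes>\<^bsub>G \<times>\<times> G\<^esub> k)\<bar>) \<le> ?S1 z * 1 + 1 * ?S2 (star z)"
          unfolding c1 by (rule order_trans[OF c2 order_trans[OF c3 c5[folded c4]]])
        then have "?S1 z > 2 * (\<epsilon> / 4) \<or> ?S2 (star z) > 2 * (\<epsilon> / 4)" using gt by linarith
        then show "z \<in> {z \<in> ZZ. ?S1 z > 2 * (\<epsilon> / 4)} \<union> {z \<in> ZZ. star z \<in> {z \<in> ZZ. ?S2 z > 2 * (\<epsilon> / 4)}}"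
          using z star by blast
      qed
    qed
    then have "both.approx_equivariant D \<epsilon> (E \<times> E) F"
      unfolding both.approx_equivariant_def using fam mem f(2) by auto
    then show "\<exists>E f. both.approx_equivariant D \<epsilon> E f" by blast
  qed
  then show ?thesis
    unfolding bi_exact_rel_def linfty_boundary_def Let_def ZM_def[symmetric] ZZ_def[symmetric] linfty_closure_eq .
qed

end

theorem theorem4p5:
  fixes G :: "('g, 'm) monoid_scheme"
    and X :: "'x set"
    and \<pi> :: "'g \<Rightarrow> 'x \<Rightarrow> 'x"
    and I :: "'x \<Rightarrow> 'x"
  assumes "group G" and "countable (carrier G)"
    and "group_action G X \<pi>"
    and "bij_betw I X X"
    and "\<And>x. x \<in> X \<Longrightarrow> I (I x) = x"
    and "\<And>g x. g \<in> carrier G \<Longrightarrow> x \<in> X \<Longrightarrow> I (\<pi> g x) = \<pi> g (I x)"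
    and "exact_group G"
    and "\<And>x. x \<in> X \<Longrightarrow> finite (stabilizer G \<pi> x)"
    and "finite (orbits G X \<pi>)"
  shows "amenable_action G (C_boundary G X \<pi> (G_full G X \<pi>)) (left_action G X \<pi>) \<and>
         bi_exact_rel G X \<pi> (G_full G X \<pi>)"
proof -
  interpret word_action G X \<pi>
    by (intro word_action.intro word_action_axioms.intro) (use assms in auto)
  show ?thesis using amenable_C_boundary bi_exact by (simp add: GG_def)
qed

end
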